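(* Let $X=X(\Sigma)$ be a smooth projective toric variety of dimension $3$ and Picard number $r=4$, and let $\gamma_\Sigma=\mathrm{Nef}(X)\subset\mathrm{Cl}(X)\otimes\mathbb{R}$ be the associated chamber of the secondary fan. Then $\Sigma$ admits a nef primitive collection $\mathcal{P}$ such that $\gamma_\Sigma$ is a bordering chamber with respect to the support hyperplane $H_P$ of $\mathcal{P}$, i.e. $H_P$ cuts out a facet of the pseudo-effective cone $\overline{\mathrm{Eff}}(X)$ and $\dim(\mathrm{Nef}(X)\cap H_P)\geq 1$. In particular $X$ admits a non-trivial nef and non-big divisor.
   Context: Let $\Sigma$ be a complete regular fan in $N_{\mathbb{R}}$, with primitive ray generators $\mathbf{v}_1,\dots,\mathbf{v}_{n+r}$ and corresponding torus-invariant prime divisors $D_1,\dots,D_{n+r}$ on the $n$-dimensional variety $X$ (here $n=3$); $r$ is the Picard number. The pseudo-effective cone $\overline{\mathrm{Eff}}(X)$ is the cone in $\mathrm{Cl}(X)\otimes\mathbb{R}\cong\mathbb{R}^r$ generated by the classes $[D_j]$. A subset $\mathcal{P}=\{\langle\mathbf{v}_j\rangle : j\in P\}$ of $\Sigma(1)$, $P\subseteq\{1,\dots,n+r\}$, is a \emph{primitive collection} for $\Sigma$ if it is not contained in the set of rays of a single cone of $\Sigma$ but every proper subset is. The vector $\sum_{j\in P}\mathbf{v}_j$ lies in the relative interior of a unique cone $\sigma\in\Sigma$, and there is a unique relation $\sum_{j\in P}\mathbf{v}_j-\sum_{\rho\in\sigma(1)}c_\rho\mathbf{v}_\rho=0$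 with all $c_\rho>0$ (the \emph{primitive relation}). Let $b_j$ be the total coefficient of $\mathbf{v}_j$ in this relation. There is a unique linear functional $\mathbf{n}_P$ on $\mathrm{Cl}(X)\otimes\mathbb{R}$ with $\mathbf{n}_P([D_j])=b_j$ for all $j$. The \emph{support} of $\mathcal{P}$ is the hyperplane $H_P=\ker\mathbf{n}_P\subset\mathrm{Cl}(X)\otimes\mathbb{R}$. The primitive collection $\mathcal{P}$ is \emph{nef} if $b_j\geq 0$ for all $j$. *)

theory Defs
  imports "HOL-Analysis.Analysis"
begin

(* The lattice N is Z^n inside N_R = real^'n; the dual lattice M is identified with Z^n
   through the standard inner product. *)

definition lattice_points :: "(real^'n) set" where
  "lattice_points = {x. \<forall>i. x $ i \<in> \<int>}"

definition lattice_basis :: "(real^'n) set \<Rightarrow> bool" where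
  "lattice_basis B \<longleftrightarrow> finite B \<and> independent B \<and>
     lattice_points = range (\<lambda>c :: real^'n \<Rightarrow> int. \<Sum>b\<in>B. of_int (c b) *\<^sub>R b)"

definition rational_strongly_convex_cone :: "(real^'n) set \<Rightarrow> bool" where
  "rational_strongly_convex_cone \<sigma> \<longleftrightarrow>
     (\<exists>S. finite S \<and> S \<subseteq> lattice_points \<and> \<sigma> = convex_cone hull S) \<and> \<sigma> \<inter> uminus ` \<sigma> = {0}"

(* The empty set is a face in the sense of face_of, so it has to be excluded here. *)
definition fan :: "(real^'n) set set \<Rightarrow> bool" where
  "fan \<Sigma> \<longleftrightarrow> finite \<Sigma> \<and> \<Sigma> \<noteq> {} \<and>
     (\<forall>\<sigma>\<in>\<Sigma>. rational_strongly_convex_cone \<sigma>) \<and>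
     (\<forall>\<sigma>\<in>\<Sigma>. \<forall>\<tau>. \<tau> face_of \<sigma> \<and> \<tau> \<noteq> {} \<longrightarrow> \<tau> \<in> \<Sigma>) \<and>
     (\<forall>\<sigma>\<in>\<Sigma>. \<forall>\<tau>\<in>\<Sigma>. (\<sigma> \<inter> \<tau>) face_of \<sigma> \<and> (\<sigma> \<inter> \<tau>) face_of \<tau>)"

definition complete_fan :: "(real^'n) set set \<Rightarrow> bool" where
  "complete_fan \<Sigma> \<longleftrightarrow> fan \<Sigma> \<and> \<Union>\<Sigma> = UNIV"

definition regular_fan :: "(real^'n) set set \<Rightarrow> bool" where
  "regular_fan \<Sigma> \<longleftrightarrow> fan \<Sigma> \<and>
     (\<forall>\<sigma>\<in>\<Sigma>. \<exists>B S. lattice_basis B \<and> S \<subseteq> B \<and> \<sigma> = convex_cone hull S)"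

definition maximal_cones :: "(real^'n) set set \<Rightarrow> (real^'n) set set" where
  "maximal_cones \<Sigma> = {\<sigma> \<in> \<Sigma>. dim \<sigma> = CARD('n)}"

definition primitive_vector :: "real^'n \<Rightarrow> bool" where
  "primitive_vector u \<longleftrightarrow> u \<in> lattice_points \<and> u \<noteq> 0 \<and>
     (\<forall>t>0. t *\<^sub>R u \<in> lattice_points \<longrightarrow> 1 \<le> t)"

(* The finite type 'k is the index set {1, ..., n + r}: v enumerates the primitive
   generators of the rays of the fan without repetition. *)
definition ray_generators :: "(real^'n) set set \<Rightarrow> ('k::finite \<Rightarrow> real^'n) \<Rightarrow> bool" where
  "ray_generators \<Sigma> v \<longleftrightarrow> inj v \<and>
     range v = {u. primitive_vector u \<and> convex_cone hull {u} \<in> \<Sigma>}"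

(* The set sigma(1) of rays of a cone, as a set of indices. *)
definition rays_of :: "('k::finite \<Rightarrow> real^'n) \<Rightarrow> (real^'n) set \<Rightarrow> 'k set" where
  "rays_of v \<sigma> = {j. (convex_cone hull {v j}) face_of \<sigma>}"

(* A vector a represents the torus-invariant divisor with coefficient a $ j along D_j, and
   m in M_R gives the principal divisor with coefficients m \<bullet> v j. A class map is a linear
   surjection whose kernel is the space of principal divisors, i.e. it exhibits its
   codomain as Cl(X) tensor R; the dimension of the codomain is then the Picard number. *)
definition class_map ::
    "('k::finite \<Rightarrow> real^'n) \<Rightarrow> (real^'k \<Rightarrow> 'c::euclidean_space) \<Rightarrow> bool" where
  "class_map v cl \<longleftrightarrow> linear cl \<and> surj cl \<and>
     {a. cl a = 0} = range (\<lambda>m. \<chi> j. m \<bullet> v j)"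

definition prime_class :: "(real^'k \<Rightarrow> 'c::euclidean_space) \<Rightarrow> 'k::finite \<Rightarrow> 'c" where
  "prime_class cl j = cl (axis j 1)"

definition divisor_class :: "(real^'k \<Rightarrow> 'c::euclidean_space) \<Rightarrow> int^'k::finite \<Rightarrow> 'c" where
  "divisor_class cl a = cl (\<chi> j. of_int (a $ j))"

(* X has an ample torus-invariant divisor: the support function of the divisor a, given by
   a lattice point m on each maximal cone, is strictly convex. *)
definition ample_divisor ::
    "(real^'n) set set \<Rightarrow> ('k::finite \<Rightarrow> real^'n) \<Rightarrow> int^'k \<Rightarrow> bool" where
  "ample_divisor \<Sigma> v a \<longleftrightarrow>
     (\<forall>\<sigma>\<in>maximal_cones \<Sigma>. \<exists>m\<in>lattice_points.
        (\<forall>j\<in>rays_of v \<sigma>. m \<bullet> v j = - of_int (a $ j)) \<and>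
        (\<forall>j. j \<notin> rays_of v \<sigma> \<longrightarrow> m \<bullet> v j > - of_int (a $ j)))"

definition projective_fan :: "(real^'n) set set \<Rightarrow> ('k::finite \<Rightarrow> real^'n) \<Rightarrow> bool" where
  "projective_fan \<Sigma> v \<longleftrightarrow> complete_fan \<Sigma> \<and> (\<exists>a. ample_divisor \<Sigma> v a)"

definition eff_cone :: "(real^'k::finite \<Rightarrow> 'c::euclidean_space) \<Rightarrow> 'c set" where
  "eff_cone cl = convex_cone hull (range (prime_class cl))"

(* The closed chamber of the secondary fan attached to the fan, which is Nef(X);
   see nef_cone_iff for the description by convex support functions. *)
definition nef_cone ::
    "(real^'n) set set \<Rightarrow> ('k::finite \<Rightarrow> real^'n) \<Rightarrow> (real^'k \<Rightarrow> 'c::euclidean_space) \<Rightarrow> 'c set"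
  where
  "nef_cone \<Sigma> v cl =
     (\<Inter>\<sigma>\<in>maximal_cones \<Sigma>. convex_cone hull (prime_class cl ` (- rays_of v \<sigma>)))"

definition nef_divisor ::
    "(real^'n) set set \<Rightarrow> ('k::finite \<Rightarrow> real^'n) \<Rightarrow> (real^'k \<Rightarrow> 'c::euclidean_space) \<Rightarrow> int^'k \<Rightarrow> bool"
  where
  "nef_divisor \<Sigma> v cl a \<longleftrightarrow> divisor_class cl a \<in> nef_cone \<Sigma> v cl"

(* The big cone is the interior of the pseudo-effective cone. *)
definition big_divisor :: "(real^'k::finite \<Rightarrow> 'c::euclidean_space) \<Rightarrow> int^'k \<Rightarrow> bool" where
  "big_divisor cl a \<longleftrightarrow> divisor_class cl a \<in> interior (eff_cone cl)"

definition primitive_collection ::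
    "(real^'n) set set \<Rightarrow> ('k::finite \<Rightarrow> real^'n) \<Rightarrow> 'k set \<Rightarrow> bool" where
  "primitive_collection \<Sigma> v P \<longleftrightarrow>
     \<not> (\<exists>\<sigma>\<in>\<Sigma>. P \<subseteq> rays_of v \<sigma>) \<and> (\<forall>Q. Q \<subset> P \<longrightarrow> (\<exists>\<sigma>\<in>\<Sigma>. Q \<subseteq> rays_of v \<sigma>))"

(* b j is the total coefficient of v j in the primitive relation of P. *)
definition primitive_relation ::
    "(real^'n) set set \<Rightarrow> ('k::finite \<Rightarrow> real^'n) \<Rightarrow> 'k set \<Rightarrow> ('k \<Rightarrow> real) \<Rightarrow> bool" where
  "primitive_relation \<Sigma> v P b \<longleftrightarrow>
     (\<exists>\<sigma>\<in>\<Sigma>. \<exists>c. (\<Sum>j\<in>P. v j) \<in> rel_interior \<sigma> \<and>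
        (\<forall>j\<in>rays_of v \<sigma>. c j > 0) \<and>
        (\<Sum>j\<in>P. v j) - (\<Sum>j\<in>rays_of v \<sigma>. c j *\<^sub>R v j) = 0 \<and>
        b = (\<lambda>j. (if j \<in> P then 1 else 0) - (if j \<in> rays_of v \<sigma> then c j else 0)))"

definition support_functional ::
    "(real^'k::finite \<Rightarrow> 'c::euclidean_space) \<Rightarrow> ('k \<Rightarrow> real) \<Rightarrow> ('c \<Rightarrow> real) \<Rightarrow> bool"
  where
  "support_functional cl b f \<longleftrightarrow> linear f \<and> (\<forall>j. f (prime_class cl j) = b j)"

definition bordering_chamber ::
    "(real^'k::finite \<Rightarrow> 'c::euclidean_space) \<Rightarrow> 'c set \<Rightarrow> 'c set \<Rightarrow> bool" where
  "bordering_chamber cl \<gamma> H \<longleftrightarrow>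
     (eff_cone cl \<inter> H) facet_of (eff_cone cl) \<and> dim (\<gamma> \<inter> H) \<ge> 1"

lemma class_eq_sum:
  fixes cl :: "real^'k::finite \<Rightarrow> 'c::euclidean_space"
  assumes "linear cl"
  shows "cl a = (\<Sum>j\<in>UNIV. a $ j *\<^sub>R prime_class cl j)"
proof -
  have "a = (\<Sum>j\<in>UNIV. a $ j *\<^sub>R axis j 1)"
    using basis_expansion[of a] by (simp add: scalar_mult_eq_scaleR)
  then have "cl a = cl (\<Sum>j\<in>UNIV. a $ j *\<^sub>R axis j 1)" by simp
  then show ?thesis
    using assms by (simp add: linear_sum linear_scale prime_class_def)
qed

lemma support_functional_unique:
  assumes cm: "class_map v cl"
    and f: "support_functional cl b f" and g: "support_functional cl b g"
  shows "f = g"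
proof
  fix x
  have lin: "linear cl" and "surj cl" using cm by (auto simp: class_map_def)
  then obtain a where a: "x = cl a" by (metis surjD)
  show "f x = g x"
    using f g by (simp add: support_functional_def a class_eq_sum[OF lin] linear_sum linear_scale)
qed

lemma cone_of_prime_classes:
  fixes cl :: "real^'k::finite \<Rightarrow> 'c::euclidean_space"
  assumes lin: "linear cl"
  shows "convex_cone hull (prime_class cl ` J) =
    cl ` {l. (\<forall>j. l $ j \<ge> 0) \<and> (\<forall>j. j \<notin> J \<longrightarrow> l $ j = 0)}" (is "_ = cl ` ?L")
proof (rule hull_unique)
  show "prime_class cl ` J \<subseteq> cl ` ?L"
    by (auto simp: axis_def prime_class_def)
  have "convex_cone ?L" by (auto simp: convex_cone_iff)
  then show "convex_cone (cl ` ?L)" using lin by (simp add: convex_cone_linear_image)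
next
  fix T assume T: "prime_class cl ` J \<subseteq> T" "convex_cone T"
  show "cl ` ?L \<subseteq> T"
  proof
    fix x assume "x \<in> cl ` ?L"
    then obtain l where l: "\<And>j. l $ j \<ge> 0" "\<And>j. j \<notin> J \<Longrightarrow> l $ j = 0" "x = cl l" by auto
    have sum_in: "(\<Sum>j\<in>A. l $ j *\<^sub>R prime_class cl j) \<in> T" if "finite A" for A
      using that
    proof induction
      case empty
      then show ?case using T by (simp add: convex_cone_contains_0)
    next
      case (insert j A)
      have "l $ j *\<^sub>R prime_class cl j \<in> T"
      proof (cases "j \<in> J")
        case True
        then show ?thesis using T l(1) by (auto intro: convex_cone_scaleR)
      next
        case False
        then show ?thesis using T l(2) by (simp add: convex_cone_contains_0)
      qed
      then show ?case using insert T by (simp add: convex_cone_add)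
    qed
    show "x \<in> T" using sum_in[of UNIV] l(3) class_eq_sum[OF lin, of l] by simp
  qed
qed

lemma nef_cone_iff:
  assumes cm: "class_map v cl"
  shows "cl a \<in> nef_cone \<Sigma> v cl \<longleftrightarrow>
    (\<forall>\<sigma>\<in>maximal_cones \<Sigma>. \<exists>m. (\<forall>j\<in>rays_of v \<sigma>. m \<bullet> v j = - (a $ j)) \<and>
                              (\<forall>j. j \<notin> rays_of v \<sigma> \<longrightarrow> m \<bullet> v j \<ge> - (a $ j)))"
proof -
  have lin: "linear cl" and ker: "{a. cl a = 0} = range (\<lambda>m. \<chi> j. m \<bullet> v j)"
    using cm by (auto simp: class_map_def)
  have "cl a \<in> cl ` {l. (\<forall>j. l $ j \<ge> 0) \<and> (\<forall>j. j \<notin> - R \<longrightarrow> l $ j = 0)} \<longleftrightarrow>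
      (\<exists>m. (\<forall>j\<in>R. m \<bullet> v j = - (a $ j)) \<and> (\<forall>j. j \<notin> R \<longrightarrow> m \<bullet> v j \<ge> - (a $ j)))"
      (is "?A \<longleftrightarrow> ?B") for R
  proof
    assume ?A
    then obtain l where l: "\<And>j. l $ j \<ge> 0" "\<And>j. j \<in> R \<Longrightarrow> l $ j = 0" "cl a = cl l" by auto
    then have "cl (l - a) = 0" using lin by (simp add: linear_diff)
    then obtain m where "l - a = (\<chi> j. m \<bullet> v j)" using ker by blast
    then have "m \<bullet> v j = l $ j - a $ j" for j by (metis vec_lambda_beta vector_minus_component)
    then show ?B using l by (intro exI[of _ m]) simp
  next
    assume ?B
    then obtain m where m: "\<And>j. j \<in> R \<Longrightarrow> m \<bullet> v j = - (a $ j)"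
      "\<And>j. j \<notin> R \<Longrightarrow> m \<bullet> v j \<ge> - (a $ j)" by auto
    have "cl (\<chi> j. m \<bullet> v j) = 0" using ker by blast
    then have eq: "cl a = cl (a + (\<chi> j. m \<bullet> v j))" using lin by (simp add: linear_add)
    have "a $ j + m \<bullet> v j \<ge> 0" for j using m[of j] by (cases "j \<in> R") auto
    then show ?A unfolding eq using m by (intro imageI) simp
  qed
  then show ?thesis
    unfolding nef_cone_def cone_of_prime_classes[OF lin] by simp
qed

end

(* A nef class on the boundary of the pseudo-effective cone comes from a zero-sum primitive collection P
   together with a concave piecewise linear function that is linear on the cones of the fan and vanishes
   on the span of P. Batyrev's least-degree argument provides a zero-sum P, of size 2 or 3.
   For size 3 the plane spanned by P is a union of cones, and the minimum of 0 and a linear form vanishing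
   on it works. For P = {p, w} with v w = - v p one looks for "good" half-planes bounded by the line
   through v p, namely those that are unions of cones: two opposite ones, or three that positively span
   modulo v p, give the function. The half-plane through a ray adjacent to both p and w is good. There are
   only five rays other than p and w, so either one of the links of p and w contains the other and there
   are enough common rays, or the links are cycles of length 3 or 4. In the latter cases the remaining
   triangles of the fan are almost determined, and unimodularity of these triangles forces either more
   good half-planes, or a zero-sum triple, or another opposite pair whose links are nested. *)

theory Submission
  imports Defs
begin

section \<open>Unimodular triangulations of the sphere\<close>

text \<open>The facet condition holds for every zero-sum primitive collection, so the whole
  difficulty is to find one whose hyperplane contains a nonzero nef class. A zero-sum pair does not
  come with a piecewise linear function of that kind; this is what makes the case analysis
  unavoidable here. The Picard number enters by counting: 4 + 3 = 7 rays leave five vertices for the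
  links of a pair, and for most edges a single candidate for the vertex of the opposite triangle.
  Once the fan is turned into index sets, no topology of the sphere is used. Existence and
  uniqueness of nonnegative representations do all the work: an identity between points of two cones
  forces equal coefficients, which excludes edges and triangles. In the basis of one triangle the
  determinant 1 of every further triangle is a polynomial equation in a few coefficients, and the
  cases come from factoring these equations.\<close>

definition vol :: "real^3 \<Rightarrow> real^3 \<Rightarrow> real^3 \<Rightarrow> real" where
  "vol x y z = x \<bullet> cross3 y z"

lemma vol_rotate: "vol y z x = vol x y z" and vol_swap: "vol y x z = - vol x y z"
  and vol_swap': "vol x z y = - vol x y z"
  by (simp_all add: vol_def cross3_simps)

lemma abs_vol_perm:
  "\<bar>vol x z y\<bar> = \<bar>vol x y z\<bar>" "\<bar>vol y x z\<bar> = \<bar>vol x y z\<bar>" "\<bar>vol y z x\<bar> = \<bar>vol x y z\<bar>"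
  "\<bar>vol z x y\<bar> = \<bar>vol x y z\<bar>" "\<bar>vol z y x\<bar> = \<bar>vol x y z\<bar>"
  using vol_swap[of x y z] vol_swap'[of x y z] vol_swap[of z x y] vol_rotate[of x y z] vol_rotate[of y z x]
    vol_rotate[of z y x] by simp_all

lemma vol_refl [simp]: "vol x x y = 0" "vol x y x = 0" "vol y x x = 0"
  by (simp_all add: vol_def cross3_simps)

lemma cross3_inner: "cross3 x y \<bullet> z = vol x y z"
  by (simp add: vol_def cross3_simps)

lemma vol_linear:
  "vol (x + x') y z = vol x y z + vol x' y z"
  "vol x (y + y') z = vol x y z + vol x y' z"
  "vol x y (z + z') = vol x y z + vol x y z'"
  "vol (x - x') y z = vol x y z - vol x' y z"
  "vol x (y - y') z = vol x y z - vol x y' z"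
  "vol x y (z - z') = vol x y z - vol x y z'"
  "vol (r *\<^sub>R x) y z = r * vol x y z"
  "vol x (r *\<^sub>R y) z = r * vol x y z"
  "vol x y (r *\<^sub>R z) = r * vol x y z"
  "vol (- x) y z = - vol x y z"
  "vol x (- y) z = - vol x y z"
  "vol x y (- z) = - vol x y z"
  "vol 0 y z = 0" "vol x 0 z = 0" "vol x y 0 = 0"
  by (simp_all add: vol_def cross3_simps)

lemma cramer:
  "vol x y z *\<^sub>R q = vol q y z *\<^sub>R x + vol x q z *\<^sub>R y + vol x y q *\<^sub>R z"
proof -
  have "(vol x y z *\<^sub>R q) $ i = (vol q y z *\<^sub>R x + vol x q z *\<^sub>R y + vol x y q *\<^sub>R z) $ i" for i
    using exhaust_3[of i] by (elim disjE) (simp_all add: vol_def cross3_simps)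
  then show ?thesis by (simp add: vec_eq_iff)
qed

lemma vol_coordinates:
  assumes "vol p a b = 1"
  shows "q = vol q a b *\<^sub>R p + vol p q b *\<^sub>R a + vol p a q *\<^sub>R b"
  using cramer[of p a b q] assms by simp

lemma vol_in_Ints:
  assumes "x \<in> lattice_points" "y \<in> lattice_points" "z \<in> lattice_points"
  shows "vol x y z \<in> \<int>"
  using assms by (auto simp: vol_def lattice_points_def cross3_simps intro!: Ints_add Ints_diff Ints_mult)

lemma cross3_lattice_points:
  assumes "x \<in> lattice_points" "y \<in> lattice_points"
  shows "cross3 x y \<in> lattice_points"
  unfolding lattice_points_def
proof (intro CollectI allI)
  fix i :: 3
  show "cross3 x y $ i \<in> \<int>"
    using exhaust_3[of i] assms
    by (elim disjE) (auto simp: lattice_points_def cross_components intro!: Ints_diff Ints_mult)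
qed

lemma zero_lattice_point: "0 \<in> lattice_points"
  by (simp add: lattice_points_def)

lemma lattice_points_scaleR:
  assumes "x \<in> lattice_points" "r \<in> \<int>"
  shows "r *\<^sub>R x \<in> lattice_points"
  using assms by (auto simp: lattice_points_def)

text \<open>Encodes that \<open>q\<close> lies in the relative interior of the cone over the support
  of \<open>c\<close>. Coefficient functions on all indices replace cones as point sets.\<close>

definition nonneg_rep :: "'k set set \<Rightarrow> ('k::finite \<Rightarrow> real^3) \<Rightarrow> ('k \<Rightarrow> real) \<Rightarrow> real^3 \<Rightarrow> bool" where
  "nonneg_rep F v c q \<longleftrightarrow> (\<forall>j. 0 \<le> c j) \<and> {j. c j \<noteq> 0} \<in> F \<and> q = (\<Sum>j\<in>UNIV. c j *\<^sub>R v j)"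

definition link :: "'k set set \<Rightarrow> 'k \<Rightarrow> 'k set" where
  "link F p = {j. j \<noteq> p \<and> {p, j} \<in> F}"

text \<open>A pair \<open>P\<close>, \<open>M\<close> with this property yields the nef divisor with coefficients
  \<open>- Min {m \<bullet> v j | m \<in> M}\<close>, which is trivial on the curve class of the zero-sum collection \<open>P\<close>.\<close>

definition nef_certificate :: "'k set set \<Rightarrow> ('k::finite \<Rightarrow> real^3) \<Rightarrow> 'k set \<Rightarrow> (real^3) set \<Rightarrow> bool" where
  "nef_certificate F v P M \<longleftrightarrow>
     P \<notin> F \<and> (\<forall>Q. Q \<subset> P \<longrightarrow> Q \<in> F) \<and> (\<Sum>j\<in>P. v j) = 0 \<and>
     finite M \<and> M \<subseteq> lattice_points \<and> 0 \<in> M \<and> M \<noteq> {0} \<and>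
     (\<forall>m\<in>M. \<forall>j\<in>P. m \<bullet> v j = 0) \<and>
     (\<forall>S\<in>F. \<exists>m\<in>M. \<forall>j\<in>S. \<forall>m'\<in>M. m \<bullet> v j \<le> m' \<bullet> v j)"

text \<open>A smooth complete fan in dimension three, reduced to index sets. Existence of
  representations is completeness; uniqueness contains the independence of the generators of a cone
  and the fact that two cones meet along a common face. \<open>face_max\<close> combines smoothness
  with purity.\<close>

locale unimodular_fan3 =
  fixes F :: "'k::finite set set" and v :: "'k \<Rightarrow> real^3"
  assumes lattice: "v j \<in> lattice_points"
    and face_subset: "S \<in> F \<Longrightarrow> S' \<subseteq> S \<Longrightarrow> S' \<in> F"
    and face_single: "{j} \<in> F"
    and face_max: "S \<in> F \<Longrightarrow> \<exists>x y z. S \<subseteq> {x, y, z} \<and> {x, y, z} \<in> F \<and> \<bar>vol (v x) (v y) (v z)\<bar> = 1"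
    and rep_exists: "\<exists>c. nonneg_rep F v c q"
    and rep_unique: "nonneg_rep F v c q \<Longrightarrow> nonneg_rep F v c' q \<Longrightarrow> c = c'"
begin

text \<open>The orientation is included so that every oriented edge has exactly one third vertex.
  Around a fixed vertex this gives a successor map on the link.\<close>

definition triangle :: "'k \<Rightarrow> 'k \<Rightarrow> 'k \<Rightarrow> bool" where
  "triangle x y z \<longleftrightarrow> {x, y, z} \<in> F \<and> vol (v x) (v y) (v z) = 1"

lemma triangle_rotate: "triangle x y z \<Longrightarrow> triangle y z x"
  by (simp add: triangle_def vol_rotate insert_commute)

lemma triangle_distinct: "triangle x y z \<Longrightarrow> x \<noteq> y \<and> y \<noteq> z \<and> x \<noteq> z"
  by (auto simp: triangle_def)

lemma triangle_vol: "triangle x y z \<Longrightarrow> vol (v x) (v y) (v z) = 1"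
  by (simp add: triangle_def)

lemma triangle_face: "triangle x y z \<Longrightarrow> S \<subseteq> {x, y, z} \<Longrightarrow> S \<in> F"
  using face_subset unfolding triangle_def by blast

text \<open>A sum of indicator terms, so that vertices may coincide: rays and edges are handled as
  triples with a repeated vertex of weight 0.\<close>

definition comb3 :: "real \<Rightarrow> 'k \<Rightarrow> real \<Rightarrow> 'k \<Rightarrow> real \<Rightarrow> 'k \<Rightarrow> 'k \<Rightarrow> real" where
  "comb3 r x s y t z = (\<lambda>j. (if j = x then r else 0) + (if j = y then s else 0) + (if j = z then t else 0))"

lemma rep_comb3:
  assumes "{x, y, z} \<in> F" "0 \<le> r" "0 \<le> s" "0 \<le> t"
  shows "nonneg_rep F v (comb3 r x s y t z) (r *\<^sub>R v x + s *\<^sub>R v y + t *\<^sub>R v z)"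
proof -
  have "{j. comb3 r x s y t z j \<noteq> 0} \<subseteq> {x, y, z}" by (auto simp: comb3_def)
  moreover have "(\<Sum>j\<in>UNIV. comb3 r x s y t z j *\<^sub>R v j) = r *\<^sub>R v x + s *\<^sub>R v y + t *\<^sub>R v z"
    by (simp add: comb3_def scaleR_add_left sum.distrib if_distrib[of "\<lambda>r. r *\<^sub>R _"] cong: if_cong)
  ultimately show ?thesis
    using assms face_subset by (auto simp: nonneg_rep_def comb3_def)
qed

text \<open>The form in which uniqueness is applied: an identity between vectors in two cones
  becomes an equality of functions, which is then evaluated at a single vertex.\<close>

lemma rep_comb3_unique:
  assumes "{x, y, z} \<in> F" "0 \<le> r" "0 \<le> s" "0 \<le> t"
    and "{x', y', z'} \<in> F" "0 \<le> r'" "0 \<le> s'" "0 \<le> t'"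
    and "r *\<^sub>R v x + s *\<^sub>R v y + t *\<^sub>R v z = r' *\<^sub>R v x' + s' *\<^sub>R v y' + t' *\<^sub>R v z'"
  shows "comb3 r x s y t z = comb3 r' x' s' y' t' z'"
  using rep_comb3[OF assms(1-4)] rep_comb3[OF assms(5-8)] assms(9) rep_unique by metis

lemma v_nonzero: "v j \<noteq> 0"
proof
  assume "v j = 0"
  then have "comb3 1 j 0 j 0 j = comb3 0 j 0 j 0 j"
    by (intro rep_comb3_unique) (auto simp: face_single)
  then show False by (auto simp: comb3_def fun_eq_iff dest: spec[of _ j])
qed

definition cone2 :: "'k \<Rightarrow> 'k \<Rightarrow> (real^3) set" where
  "cone2 x y = {r *\<^sub>R v x + s *\<^sub>R v y |r s. 0 \<le> r \<and> 0 \<le> s}"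

text \<open>For a convex cone this says that it is a union of cones of the fan, expressed through
  the smallest cone at each of its points.\<close>

definition covered :: "(real^3) set \<Rightarrow> bool" where
  "covered H \<longleftrightarrow> (\<forall>q\<in>H. \<forall>c. nonneg_rep F v c q \<longrightarrow> (\<forall>j. c j \<noteq> 0 \<longrightarrow> v j \<in> H))"

lemma covered_Un: "covered H \<Longrightarrow> covered H' \<Longrightarrow> covered (H \<union> H')"
  by (auto simp: covered_def)

text \<open>Moving from the barycentre of \<open>S\<close> towards a vertex where another functional becomes
  smaller, one hits a tie; its cell is a union of cones of faces and thus contains \<open>S\<close>.\<close>

lemma common_minimiser:
  assumes M: "finite M" "M \<noteq> {}"
    and ties: "\<And>m m'. m \<in> M \<Longrightarrow> m' \<in> M \<Longrightarrow> m \<noteq> m' \<Longrightarrow>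
      covered {q. m \<bullet> q = m' \<bullet> q \<and> (\<forall>m''\<in>M. m \<bullet> q \<le> m'' \<bullet> q)}"
    and S: "S \<in> F"
  shows "\<exists>m\<in>M. \<forall>j\<in>S. \<forall>m'\<in>M. m \<bullet> v j \<le> m' \<bullet> v j"
proof -
  define q where "q = (\<Sum>j\<in>S. v j)"
  obtain m where m: "m \<in> M" "\<And>m'. m' \<in> M \<Longrightarrow> m \<bullet> q \<le> m' \<bullet> q"
    using ex_min_if_finite[of "(\<lambda>m. m \<bullet> q) ` M"] M by (auto simp: not_less)
  have "m \<bullet> v j \<le> m' \<bullet> v j" if j: "j \<in> S" and m': "m' \<in> M" for j m'
  proof (rule ccontr)
    assume less: "\<not> m \<bullet> v j \<le> m' \<bullet> v j"
    define L where "L = {n \<in> M. n \<bullet> v j < m \<bullet> v j}"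
    define t where "t n = (n \<bullet> q - m \<bullet> q) / (m \<bullet> v j - n \<bullet> v j)" for n
    have "finite L" "L \<noteq> {}" using M m' less by (auto simp: L_def)
    then obtain n where n: "n \<in> L" "\<And>n'. n' \<in> L \<Longrightarrow> t n \<le> t n'"
      using ex_min_if_finite[of "t ` L"] by (auto simp: not_less)
    have t0: "t n \<ge> 0" using n(1) m by (auto simp: L_def t_def)
    define q' where "q' = q + t n *\<^sub>R v j"
    have eq: "m \<bullet> q' = n \<bullet> q'"
      using n(1) by (simp add: q'_def t_def L_def inner_add_right field_simps)
    have le: "m \<bullet> q' \<le> k \<bullet> q'" if k: "k \<in> M" for k
    proof (cases "k \<in> L")
      case True
      then have "t n \<le> (k \<bullet> q - m \<bullet> q) / (m \<bullet> v j - k \<bullet> v j)" using n(2) by (simp add: t_def)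
      then have "t n * (m \<bullet> v j - k \<bullet> v j) \<le> k \<bullet> q - m \<bullet> q"
        using True by (subst (asm) pos_le_divide_eq) (auto simp: L_def)
      then show ?thesis by (simp add: q'_def inner_add_right algebra_simps)
    next
      case False
      then have "m \<bullet> v j \<le> k \<bullet> v j" using k by (auto simp: L_def)
      then have "t n * (m \<bullet> v j) \<le> t n * (k \<bullet> v j)" using t0 by (rule mult_left_mono)
      then show ?thesis using m(2)[OF k] by (simp add: q'_def inner_add_right)
    qed
    define c where "c i = (if i \<in> S then 1 else 0) + (if i = j then t n else 0)" for i
    have "{i. c i \<noteq> 0} = S" using j t0 by (auto simp: c_def split: if_splits)
    moreover have "q' = (\<Sum>i\<in>UNIV. c i *\<^sub>R v i)"
      by (simp add: c_def q'_def q_def scaleR_add_left sum.distrib if_distrib[of "\<lambda>r. r *\<^sub>R _"] sum.If_cases cong: if_cong)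
    ultimately have "nonneg_rep F v c q'" using S t0 by (simp add: nonneg_rep_def c_def)
    moreover have "c j \<noteq> 0" using j t0 by (simp add: c_def)
    moreover have "n \<in> M" "m \<noteq> n" using n(1) by (auto simp: L_def)
    ultimately have "m \<bullet> v j = n \<bullet> v j"
      using ties[OF m(1), of n] eq le unfolding covered_def by blast
    then show False using n(1) by (simp add: L_def)
  qed
  then show ?thesis using m(1) by blast
qed

end

section \<open>Triangles across an edge and around a vertex\<close>

context unimodular_fan3
begin

lemma rep_expand:
  assumes "nonneg_rep F v c q" "{j. c j \<noteq> 0} \<subseteq> {x, y, z}" "x \<noteq> y" "y \<noteq> z" "x \<noteq> z"
  shows "q = c x *\<^sub>R v x + c y *\<^sub>R v y + c z *\<^sub>R v z"
proof -
  have "q = (\<Sum>j\<in>UNIV. c j *\<^sub>R v j)" using assms(1) by (simp add: nonneg_rep_def)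
  also have "\<dots> = (\<Sum>j\<in>{x, y, z}. c j *\<^sub>R v j)"
    using assms(2) by (intro sum.mono_neutral_right) auto
  finally show ?thesis using assms(3-) by simp
qed

lemma face_max2:
  assumes "S \<in> F" "x \<in> S" "y \<in> S" "x \<noteq> y"
  shows "\<exists>u. S \<subseteq> {x, y, u} \<and> {x, y, u} \<in> F \<and> \<bar>vol (v x) (v y) (v u)\<bar> = 1"
proof -
  obtain a b c where abc: "S \<subseteq> {a, b, c}" "{a, b, c} \<in> F" "\<bar>vol (v a) (v b) (v c)\<bar> = 1"
    using face_max[OF assms(1)] by blast
  note * = abs_vol_perm[of "v a" "v b" "v c"]
  have "(x = a \<and> y = b) \<or> (x = a \<and> y = c) \<or> (x = b \<and> y = a) \<or> (x = b \<and> y = c) \<or> (x = c \<and> y = a) \<or> (x = c \<and> y = b)"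
    using subsetD[OF abc(1) assms(2)] subsetD[OF abc(1) assms(3)] assms(4) by auto
  then obtain u where u: "{a, b, c} = {x, y, u}" "\<bar>vol (v x) (v y) (v u)\<bar> = 1"
    using abc(3) * by (elim disjE conjE; metis insert_commute)
  then show ?thesis
    using abc(1,2) by metis
qed

lemma face_max1:
  assumes "S \<in> F" "x \<in> S"
  shows "\<exists>y u. S \<subseteq> {x, y, u} \<and> {x, y, u} \<in> F \<and> \<bar>vol (v x) (v y) (v u)\<bar> = 1"
proof -
  obtain a b c where abc: "S \<subseteq> {a, b, c}" "{a, b, c} \<in> F" "\<bar>vol (v a) (v b) (v c)\<bar> = 1"
    using face_max[OF assms(1)] by blast
  then have "\<exists>y. y \<in> {a, b, c} \<and> y \<noteq> x" by (metis insertCI vol_refl(1) abs_0 zero_neq_one)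
  then obtain y where "y \<in> {a, b, c}" "y \<noteq> x" by blast
  moreover have "x \<in> {a, b, c}" using abc(1) assms(2) by blast
  ultimately obtain u where "{a, b, c} \<subseteq> {x, y, u}" "{x, y, u} \<in> F" "\<bar>vol (v x) (v y) (v u)\<bar> = 1"
    using face_max2[OF abc(2), of x y] by auto
  then show ?thesis using abc(1) by (meson order_trans)
qed

lemma triangle_or_swap:
  assumes "{x, y, z} \<in> F" "\<bar>vol (v x) (v y) (v z)\<bar> = 1"
  shows "triangle x y z \<or> triangle y x z"
  using assms vol_swap[of "v y" "v x" "v z"] unfolding triangle_def by (auto simp: insert_commute abs_if split: if_splits)

text \<open>The points q + n d lie in finitely many cones, so one closed cone contains infinitely
  many of them and hence also the direction \<open>d\<close>. Taking \<open>d\<close> inside a given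
  face produces a face that extends it towards \<open>q\<close>; this replaces arguments about
  neighbourhoods on the sphere.\<close>

lemma ray_limit:
  "\<exists>c c' r. nonneg_rep F v c d \<and> nonneg_rep F v c' (q + r *\<^sub>R d) \<and> {j. c j \<noteq> 0} \<union> {j. c' j \<noteq> 0} \<in> F"
proof -
  define good where "good n w = (case w of (x, y, z) \<Rightarrow> {x, y, z} \<in> F \<and> \<bar>vol (v x) (v y) (v z)\<bar> = 1 \<and>
    (\<exists>r s t. 0 \<le> r \<and> 0 \<le> s \<and> 0 \<le> t \<and> q + real n *\<^sub>R d = r *\<^sub>R v x + s *\<^sub>R v y + t *\<^sub>R v z))" for n w
  have "\<exists>w. good n w" for n
  proof -
    obtain c where c: "nonneg_rep F v c (q + real n *\<^sub>R d)" using rep_exists by blast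
    then have "{j. c j \<noteq> 0} \<in> F" by (simp add: nonneg_rep_def)
    then obtain x y z where xyz: "{j. c j \<noteq> 0} \<subseteq> {x, y, z}" "{x, y, z} \<in> F" "\<bar>vol (v x) (v y) (v z)\<bar> = 1"
      using face_max by blast
    then have "x \<noteq> y" "y \<noteq> z" "x \<noteq> z" by auto
    with c xyz have "q + real n *\<^sub>R d = c x *\<^sub>R v x + c y *\<^sub>R v y + c z *\<^sub>R v z" by (intro rep_expand)
    moreover have "c j \<ge> 0" for j using c by (simp add: nonneg_rep_def)
    ultimately show ?thesis using xyz by (intro exI[of _ "(x, y, z)"]) (auto simp: good_def)
  qed
  then obtain f where f: "\<And>n. good n (f n)" by metis
  obtain n0 where "infinite {n. f n = f n0}"
    using pigeonhole_infinite[of "UNIV :: nat set" f] by (auto intro: finite_subset[of _ UNIV])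
  moreover obtain x y z where w: "f n0 = (x, y, z)" by (metis prod_cases3)
  moreover have "{n. f n = f n0} \<subseteq> {n. good n (x, y, z)}"
  proof clarify
    fix n assume "f n = f n0"
    then show "good n (x, y, z)" using f[of n] w by simp
  qed
  ultimately have inf: "infinite {n. good n (x, y, z)}" using infinite_super by blast
  define e where "e = vol (v x) (v y) (v z)"
  have face: "{x, y, z} \<in> F" and e1: "\<bar>e\<bar> = 1" using f[of n0] w by (auto simp: good_def e_def)
  \<comment> \<open>Being 1 or -1, \<open>e\<close> is its own inverse, so multiplying by it
    replaces the division in Cramer's rule and treats both orientations alike.\<close>
  have e: "e * e = 1" using e1 by (auto simp: abs_if split: if_splits)
  \<comment> \<open>An affine function of n that is nonnegative for infinitely many n has
    nonnegative slope. It is applied to each of the three coordinates.\<close>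
  have lim: "0 \<le> B" if "\<And>n. n \<in> N \<Longrightarrow> 0 \<le> A + real n * B" "infinite N" for A B :: real and N
  proof (rule ccontr)
    assume "\<not> 0 \<le> B"
    obtain m :: nat where m: "- A / B < m" using reals_Archimedean2 by blast
    obtain n where n: "n \<in> N" "m < n" using \<open>infinite N\<close> infinite_nat_iff_unbounded by blast
    have "real m * B < (- A / B) * B" using m \<open>\<not> 0 \<le> B\<close> by (intro mult_strict_right_mono_neg) auto
    then have "real m * B < - A" using \<open>\<not> 0 \<le> B\<close> by simp
    moreover have "real n * B \<le> real m * B" using n \<open>\<not> 0 \<le> B\<close> by (intro mult_right_mono_neg) auto
    ultimately show False using that(1)[OF n(1)] by linarith
  qed
  have coord: "0 \<le> e * vol (q + real n *\<^sub>R d) (v y) (v z) \<and> 0 \<le> e * vol (v x) (q + real n *\<^sub>R d) (v z) \<and>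
       0 \<le> e * vol (v x) (v y) (q + real n *\<^sub>R d)" if g: "good n (x, y, z)" for n
  proof -
    obtain r s t where rst: "0 \<le> r" "0 \<le> s" "0 \<le> t" and
      q: "q + real n *\<^sub>R d = r *\<^sub>R v x + s *\<^sub>R v y + t *\<^sub>R v z" using g by (auto simp: good_def)
    have "e * vol (q + real n *\<^sub>R d) (v y) (v z) = r * (e * e)" "e * vol (v x) (q + real n *\<^sub>R d) (v z) = s * (e * e)"
       "e * vol (v x) (v y) (q + real n *\<^sub>R d) = t * (e * e)"
      unfolding q by (simp_all add: vol_linear e_def)
    then show ?thesis using rst e by simp
  qed
  have d1: "0 \<le> e * vol d (v y) (v z)"
    by (rule lim[OF _ inf, of "e * vol q (v y) (v z)"], drule CollectD, drule coord) (simp add: vol_linear algebra_simps)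
  have d2: "0 \<le> e * vol (v x) d (v z)"
    by (rule lim[OF _ inf, of "e * vol (v x) q (v z)"], drule CollectD, drule coord) (simp add: vol_linear algebra_simps)
  have d3: "0 \<le> e * vol (v x) (v y) d"
    by (rule lim[OF _ inf, of "e * vol (v x) (v y) q"], drule CollectD, drule coord) (simp add: vol_linear algebra_simps)
  have exp: "u = (e * vol u (v y) (v z)) *\<^sub>R v x + (e * vol (v x) u (v z)) *\<^sub>R v y + (e * vol (v x) (v y) u) *\<^sub>R v z" for u
  proof -
    have "e *\<^sub>R e *\<^sub>R u = e *\<^sub>R (vol u (v y) (v z) *\<^sub>R v x + vol (v x) u (v z) *\<^sub>R v y + vol (v x) (v y) u *\<^sub>R v z)"
      by (simp only: cramer[of "v x" "v y" "v z" u, folded e_def])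
    then show ?thesis using e by (simp add: scaleR_right_distrib)
  qed
  let ?c = "\<lambda>u. comb3 (e * vol u (v y) (v z)) x (e * vol (v x) u (v z)) y (e * vol (v x) (v y) u) z"
  have rep: "nonneg_rep F v (?c u) u"
    if "0 \<le> e * vol u (v y) (v z)" "0 \<le> e * vol (v x) u (v z)" "0 \<le> e * vol (v x) (v y) u" for u
    using rep_comb3[OF face that] unfolding exp[of u, symmetric] .
  have "nonneg_rep F v (?c d) d" using rep d1 d2 d3 by blast
  moreover have "good n0 (x, y, z)" using f[of n0] w by simp
  then have "nonneg_rep F v (?c (q + real n0 *\<^sub>R d)) (q + real n0 *\<^sub>R d)"
    using coord[of n0] by (intro rep) auto
  moreover have "{j. ?c u j \<noteq> 0} \<subseteq> {x, y, z}" for u by (auto simp: comb3_def)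
  then have "{j. ?c d j \<noteq> 0} \<union> {j. ?c (q + real n0 *\<^sub>R d) j \<noteq> 0} \<in> F"
    using face face_subset by (meson Un_least)
  ultimately show ?thesis by blast
qed

text \<open>Start in the relative interior of the edge cone and move slightly in the direction
  \<open>- v z\<close>: the face reached contains the edge, and its third vertex lies on the side
  opposite to \<open>z\<close>.\<close>

lemma triangle_opposite:
  assumes T: "triangle x y z"
  shows "\<exists>u. triangle y x u"
proof -
  obtain c c' r where c: "nonneg_rep F v c (v x + v y)" "nonneg_rep F v c' (- v z + r *\<^sub>R (v x + v y))"
    "{j. c j \<noteq> 0} \<union> {j. c' j \<noteq> 0} \<in> F" using ray_limit by blast
  have xy: "x \<noteq> y" using T triangle_distinct by blast
  have "nonneg_rep F v (comb3 1 x 1 y 0 y) (v x + v y)"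
    using rep_comb3[of x y y 1 1 0] triangle_face[OF T] by simp
  then have "c = comb3 1 x 1 y 0 y" using c(1) rep_unique by blast
  then have "c x \<noteq> 0" "c y \<noteq> 0" by (auto simp: comb3_def)
  then obtain u where u: "{j. c j \<noteq> 0} \<union> {j. c' j \<noteq> 0} \<subseteq> {x, y, u}" "{x, y, u} \<in> F" "\<bar>vol (v x) (v y) (v u)\<bar> = 1"
    using face_max2[OF c(3), of x y] xy by blast
  then have "x \<noteq> u" "y \<noteq> u" by auto
  then have eq: "- v z + r *\<^sub>R (v x + v y) = c' x *\<^sub>R v x + c' y *\<^sub>R v y + c' u *\<^sub>R v u"
    using c(2) u(1) xy by (intro rep_expand) auto
  have "vol (v x) (v y) (- v z + r *\<^sub>R (v x + v y)) = - 1"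
    using T by (simp add: vol_linear triangle_def)
  then have "c' u * vol (v x) (v y) (v u) = -1" unfolding eq by (simp add: vol_linear)
  moreover have "0 \<le> c' u" using c(2) by (simp add: nonneg_rep_def)
  ultimately have "vol (v x) (v y) (v u) = -1" using u(3) by (auto simp: abs_if split: if_splits)
  then show ?thesis using u(2) vol_swap[of "v y" "v x" "v u"] by (auto simp: triangle_def insert_commute)
qed

text \<open>Both third vertices have determinant 1 over the edge, so they differ by a combination of
  \<open>v x\<close> and \<open>v y\<close>. Adding enough of these two vectors to each of them
  gives one point in both cones.\<close>

lemma triangle_unique:
  assumes "triangle x y z" "triangle x y u"
  shows "z = u"
proof -
  define r s where "r = vol (v u) (v y) (v z)" and "s = vol (v x) (v u) (v z)"
  have "v u = r *\<^sub>R v x + s *\<^sub>R v y + v z"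
    using cramer[of "v x" "v y" "v z" "v u"] assms by (simp add: triangle_def r_def s_def)
  then have "max (-r) 0 *\<^sub>R v x + max (-s) 0 *\<^sub>R v y + 1 *\<^sub>R v u
    = (r + max (-r) 0) *\<^sub>R v x + (s + max (-s) 0) *\<^sub>R v y + 1 *\<^sub>R v z"
    by (simp add: algebra_simps)
  then have "comb3 (max (-r) 0) x (max (-s) 0) y 1 u = comb3 (r + max (-r) 0) x (s + max (-s) 0) y 1 z"
    using assms by (intro rep_comb3_unique) (auto simp: triangle_def)
  then show ?thesis
    using triangle_distinct[OF assms(1)] triangle_distinct[OF assms(2)]
    by (auto simp: comb3_def fun_eq_iff dest: spec[of _ u] split: if_splits)
qed

lemma edge_triangle:
  assumes "x \<noteq> y" "{x, y} \<in> F"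
  shows "\<exists>z. triangle x y z"
proof -
  obtain u where "{x, y, u} \<in> F" "\<bar>vol (v x) (v y) (v u)\<bar> = 1" using face_max2[OF assms(2), of x y] assms(1) by blast
  then show ?thesis using triangle_or_swap triangle_opposite by blast
qed

text \<open>Far along the ray of \<open>v p\<close> only cones containing that ray are met, so
  modulo \<open>v p\<close> the triangles at \<open>p\<close> cover the quotient plane. Only the
  coefficient \<open>k\<close> may be negative.\<close>

lemma mod_cover:
  "\<exists>y z k s t. triangle p y z \<and> 0 \<le> s \<and> 0 \<le> t \<and> q = k *\<^sub>R v p + s *\<^sub>R v y + t *\<^sub>R v z"
proof -
  obtain c c' r where c: "nonneg_rep F v c (v p)" "nonneg_rep F v c' (q + r *\<^sub>R v p)"
    "{j. c j \<noteq> 0} \<union> {j. c' j \<noteq> 0} \<in> F" using ray_limit by blast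
  have "nonneg_rep F v (comb3 1 p 0 p 0 p) (v p)"
    using rep_comb3[of p p p 1 0 0] face_single by simp
  then have "c = comb3 1 p 0 p 0 p" using c(1) rep_unique by blast
  then have "c p \<noteq> 0" by (auto simp: comb3_def)
  then obtain y z where u: "{j. c j \<noteq> 0} \<union> {j. c' j \<noteq> 0} \<subseteq> {p, y, z}" "{p, y, z} \<in> F" "\<bar>vol (v p) (v y) (v z)\<bar> = 1"
    using face_max1[OF c(3), of p] by blast
  then have "p \<noteq> y" "y \<noteq> z" "p \<noteq> z" by auto
  then have "q + r *\<^sub>R v p = c' p *\<^sub>R v p + c' y *\<^sub>R v y + c' z *\<^sub>R v z"
    using c(2) u(1) by (intro rep_expand) auto
  then have q: "q = (c' p - r) *\<^sub>R v p + c' y *\<^sub>R v y + c' z *\<^sub>R v z" by (simp add: algebra_simps)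
  have nn: "0 \<le> c' y" "0 \<le> c' z" using c(2) by (simp_all add: nonneg_rep_def)
  have "triangle p y z \<or> triangle p z y"
    using triangle_or_swap[OF u(2,3)] triangle_rotate[of y p z] by auto
  then show ?thesis
  proof
    assume "triangle p y z"
    then show ?thesis using q nn by (intro exI[of _ y] exI[of _ z] exI[of _ "c' p - r"] exI[of _ "c' y"] exI[of _ "c' z"] conjI)
  next
    assume "triangle p z y"
    moreover have "q = (c' p - r) *\<^sub>R v p + c' z *\<^sub>R v z + c' y *\<^sub>R v y" using q by (simp only: add_ac)
    ultimately show ?thesis using nn by (intro exI[of _ z] exI[of _ y] exI[of _ "c' p - r"] exI[of _ "c' y"] exI[of _ "c' z"] conjI)
  qed
qed

end

section \<open>A pair of opposite rays\<close>

locale opposite_pair = unimodular_fan3 F v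
  for F :: "'k::finite set set" and v :: "'k \<Rightarrow> real^3" +
  fixes p w :: 'k
  assumes card_seven: "CARD('k) = 7" and opposite: "v w = - v p"
begin

lemma swap: "opposite_pair F v w p"
  by unfold_locales (simp_all add: card_seven opposite)

lemma p_neq_w: "p \<noteq> w"
proof
  assume "p = w"
  then have "2 *\<^sub>R v p = 0" using opposite by (simp add: scaleR_2 add_eq_0_iff)
  then show False using v_nonzero by simp
qed

text \<open>The line through \<open>v p\<close> is already the union of the rays of \<open>p\<close>
  and \<open>w\<close>, so by uniqueness no other vertex occurs in a representation of a point on
  it. Most non-faces and non-edges below are found in this way.\<close>

lemma no_vertical:
  assumes "{x, y, z} \<in> F" "0 < r" "0 \<le> s" "0 \<le> t" "r *\<^sub>R v x + s *\<^sub>R v y + t *\<^sub>R v z = l *\<^sub>R v p"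
    "x \<noteq> p" "x \<noteq> w"
  shows False
proof (cases "0 \<le> l")
  case True
  then have "comb3 r x s y t z = comb3 l p 0 p 0 p"
    using assms by (intro rep_comb3_unique) (auto simp: face_single)
  then have "comb3 r x s y t z x = comb3 l p 0 p 0 p x" by simp
  then show False using assms by (auto simp: comb3_def split: if_splits)
next
  case False
  then have "comb3 r x s y t z = comb3 (-l) w 0 w 0 w"
    using assms by (intro rep_comb3_unique) (auto simp: face_single opposite)
  then have "comb3 r x s y t z x = comb3 (-l) w 0 w 0 w x" by simp
  then show False using assms by (auto simp: comb3_def split: if_splits)
qed

lemma pw_not_face: "{p, w} \<notin> F"
proof
  assume "{p, w} \<in> F"
  then have "comb3 1 p 1 w 0 w = comb3 0 p 0 w 0 w"
    by (intro rep_comb3_unique) (auto simp: opposite)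
  then have "comb3 1 p 1 w 0 w p = comb3 0 p 0 w 0 w p" by simp
  then show False using p_neq_w by (simp add: comb3_def)
qed

lemma link_p: "link F p \<subseteq> UNIV - {p, w}"
  using pw_not_face by (auto simp: link_def)

lemma triangle_link:
  assumes "triangle p x y"
  shows "x \<in> link F p" "y \<in> link F p" "x \<noteq> y" "x \<noteq> p" "y \<noteq> p" "x \<noteq> w" "y \<noteq> w"
proof -
  show "x \<in> link F p" "y \<in> link F p" "x \<noteq> y" "x \<noteq> p" "y \<noteq> p"
    using triangle_distinct[OF assms] triangle_face[OF assms] by (auto simp: link_def)
  then show "x \<noteq> w" "y \<noteq> w" using link_p by auto
qed

lemma link_next: "x \<in> link F p \<Longrightarrow> \<exists>y. triangle p x y"
  using edge_triangle by (auto simp: link_def)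

lemma link_next_inj: "triangle p x y \<Longrightarrow> triangle p x' y \<Longrightarrow> x = x'"
  using triangle_unique triangle_rotate by blast

lemma card_others: "card (UNIV - {p, w}) = 5"
  using card_seven p_neq_w by (simp add: card_Diff_subset)

text \<open>A second cycle would need three more vertices, but only five are available.\<close>

lemma link_no_other_cycle:
  assumes C: "C \<subseteq> link F p" "3 \<le> card C" and C_next: "\<And>x. x \<in> C \<Longrightarrow> \<exists>y\<in>C. triangle p y x"
  shows "link F p \<subseteq> C"
proof
  fix x assume x: "x \<in> link F p"
  show "x \<in> C"
  proof (rule ccontr)
    assume xC: "x \<notin> C"
    obtain y where y: "triangle p x y" using link_next x by blast
    obtain z where z: "triangle p y z" using link_next triangle_link(2)[OF y] by blast
    have yC: "y \<notin> C" using C_next xC link_next_inj[OF y] by blast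
    then have zC: "z \<notin> C" using C_next link_next_inj[OF z] by blast
    have xz: "x \<noteq> z"
    proof
      assume "x = z"
      then show False using triangle_vol[OF y] triangle_vol[OF z] vol_swap'[of "v p" "v y" "v z"] by simp
    qed
    have "card {x, y, z} = 3" using xz triangle_link(3)[OF y] triangle_link(3)[OF z] by simp
    then have "card (C \<union> {x, y, z}) = card C + 3" using xC yC zC by (subst card_Un_disjoint) auto
    moreover have "C \<union> {x, y, z} \<subseteq> UNIV - {p, w}"
      using C(1) link_p x triangle_link[OF y] triangle_link[OF z] by blast
    then have "card (C \<union> {x, y, z}) \<le> 5" using card_mono[of "UNIV - {p, w}"] card_others by simp
    ultimately show False using C(2) by simp
  qed
qed

text \<open>Follow the successor map on the link of \<open>p\<close>. Orientation excludes a return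
  after two steps and injectivity a return to a later vertex than the first, so the walk closes
  after three or four steps or meets all five available vertices. In the last case only the vertex
  set is recorded.\<close>

lemma link_cycle:
  assumes ab: "triangle p a b"
  obtains (three) c where "triangle p b c" "triangle p c a" "link F p = {a, b, c}"
  | (four) c d where "triangle p b c" "triangle p c d" "triangle p d a" "a \<noteq> c" "b \<noteq> d"
      "link F p = {a, b, c, d}"
  | (five) "link F p = UNIV - {p, w}"
proof -
  obtain c where c: "triangle p b c" using link_next triangle_link(2)[OF ab] by blast
  have ca: "c \<noteq> a"
    using triangle_vol[OF ab] triangle_vol[OF c] vol_swap'[of "v p" "v a" "v b"] by auto
  obtain d where d: "triangle p c d" using link_next triangle_link(2)[OF c] by blast
  have db: "d \<noteq> b"
    using triangle_vol[OF c] triangle_vol[OF d] vol_swap'[of "v p" "v b" "v c"] by auto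
  note n = triangle_link[OF ab] triangle_link[OF c] triangle_link[OF d]
  show ?thesis
  proof (cases "d = a")
    case True
    have "link F p \<subseteq> {a, b, c}"
      using n ca True ab c d by (intro link_no_other_cycle) auto
    then have "link F p = {a, b, c}" using n by auto
    with three c d True show ?thesis by blast
  next
    case da: False
    obtain e where e: "triangle p d e" using link_next triangle_link(2)[OF d] by blast
    note n' = triangle_link[OF e]
    show ?thesis
    proof (cases "e = a")
      case True
      have "link F p \<subseteq> {a, b, c, d}"
      proof (rule link_no_other_cycle)
        show "3 \<le> card {a, b, c, d}" using n ca da db by auto
      qed (use n True ab c d e in auto)
      then have "link F p = {a, b, c, d}" using n by auto
      with four c d e True ca db show ?thesis by blast
    next
      case False
      have "e \<noteq> b" using link_next_inj[OF ab] e da by blast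
      moreover have "e \<noteq> c" using link_next_inj[OF c] e db by blast
      ultimately have "card {a, b, c, d, e} = 5" using n n' ca da db False by auto
      moreover have "card {a, b, c, d, e} \<le> card (link F p)" using n n' by (intro card_mono) auto
      ultimately have "link F p = UNIV - {p, w}"
        using card_others by (intro card_seteq[OF _ link_p]) auto
      with five show ?thesis by blast
    qed
  qed
qed

definition halfplane :: "real^3 \<Rightarrow> (real^3) set" where
  "halfplane u = {q. \<exists>s t. 0 \<le> s \<and> q = s *\<^sub>R u + t *\<^sub>R v p}"

text \<open>Describes the half-plane by one equation and one inequality between linear forms
  vanishing on \<open>v p\<close>, the shape in which the walls of a minimum of linear forms
  appear.\<close>

lemma halfplane_iff1:
  assumes "0 < vol (v p) x y"
  shows "q \<in> halfplane x \<longleftrightarrow> vol (v p) x q = 0 \<and> 0 \<le> vol (v p) q y"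
proof
  assume "q \<in> halfplane x"
  then show "vol (v p) x q = 0 \<and> 0 \<le> vol (v p) q y" using assms by (auto simp: halfplane_def vol_linear)
next
  assume *: "vol (v p) x q = 0 \<and> 0 \<le> vol (v p) q y"
  define g where "g = vol (v p) x y"
  have "g *\<^sub>R q = vol q x y *\<^sub>R v p + vol (v p) q y *\<^sub>R x"
    using cramer[of "v p" x y q] * by (simp add: g_def)
  then have "(1 / g) *\<^sub>R g *\<^sub>R q = (1 / g) *\<^sub>R (vol q x y *\<^sub>R v p + vol (v p) q y *\<^sub>R x)" by (rule arg_cong)
  then have "q = (vol (v p) q y / g) *\<^sub>R x + (vol q x y / g) *\<^sub>R v p"
    using assms by (simp add: g_def scaleR_right_distrib add_ac)
  moreover have "0 \<le> vol (v p) q y / g" using * assms by (simp add: g_def)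
  ultimately show "q \<in> halfplane x" unfolding halfplane_def by blast
qed

lemma halfplane_iff2:
  assumes "0 < vol (v p) x y"
  shows "q \<in> halfplane y \<longleftrightarrow> vol (v p) q y = 0 \<and> 0 \<le> vol (v p) x q"
proof
  assume "q \<in> halfplane y"
  then show "vol (v p) q y = 0 \<and> 0 \<le> vol (v p) x q" using assms by (auto simp: halfplane_def vol_linear)
next
  assume *: "vol (v p) q y = 0 \<and> 0 \<le> vol (v p) x q"
  define g where "g = vol (v p) x y"
  have "g *\<^sub>R q = vol q x y *\<^sub>R v p + vol (v p) x q *\<^sub>R y"
    using cramer[of "v p" x y q] * by (simp add: g_def)
  then have "(1 / g) *\<^sub>R g *\<^sub>R q = (1 / g) *\<^sub>R (vol q x y *\<^sub>R v p + vol (v p) x q *\<^sub>R y)" by (rule arg_cong)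
  then have "q = (vol (v p) x q / g) *\<^sub>R y + (vol q x y / g) *\<^sub>R v p"
    using assms by (simp add: g_def scaleR_right_distrib add_ac)
  moreover have "0 \<le> vol (v p) x q / g" using * assms by (simp add: g_def)
  ultimately show "q \<in> halfplane y" unfolding halfplane_def by blast
qed

lemma halfplane_scale:
  assumes "0 < s"
  shows "halfplane (s *\<^sub>R u + t *\<^sub>R v p) = halfplane u"
proof (rule set_eqI)
  fix q
  have "q \<in> halfplane u" if "q \<in> halfplane (s *\<^sub>R u + t *\<^sub>R v p)"
  proof -
    from that obtain a b where "0 \<le> a" "q = a *\<^sub>R (s *\<^sub>R u + t *\<^sub>R v p) + b *\<^sub>R v p" by (auto simp: halfplane_def)
    then have "0 \<le> a * s" "q = (a * s) *\<^sub>R u + (a * t + b) *\<^sub>R v p" using assms by (simp_all add: algebra_simps)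
    then show ?thesis unfolding halfplane_def by blast
  qed
  moreover have "q \<in> halfplane (s *\<^sub>R u + t *\<^sub>R v p)" if "q \<in> halfplane u"
  proof -
    from that obtain a b where ab: "0 \<le> a" "q = a *\<^sub>R u + b *\<^sub>R v p" by (auto simp: halfplane_def)
    then have "0 \<le> a / s" "q = (a / s) *\<^sub>R (s *\<^sub>R u + t *\<^sub>R v p) + (b - a / s * t) *\<^sub>R v p"
      using assms by (simp_all add: algebra_simps)
    then show ?thesis unfolding halfplane_def by blast
  qed
  ultimately show "q \<in> halfplane (s *\<^sub>R u + t *\<^sub>R v p) \<longleftrightarrow> q \<in> halfplane u" by blast
qed

text \<open>The walls, where two forms tie for the minimum, only have to be unions of cones;
  \<open>common_minimiser\<close> turns this into linearity on every cone.\<close>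

lemma pair_certificate:
  assumes "finite M" "M \<subseteq> lattice_points" "0 \<in> M" "M \<noteq> {0}" and "\<And>m. m \<in> M \<Longrightarrow> m \<bullet> v p = 0"
    and "\<And>m m'. m \<in> M \<Longrightarrow> m' \<in> M \<Longrightarrow> m \<noteq> m' \<Longrightarrow>
      covered {q. m \<bullet> q = m' \<bullet> q \<and> (\<forall>m''\<in>M. m \<bullet> q \<le> m'' \<bullet> q)}"
  shows "\<exists>P M. nef_certificate F v P M"
proof (intro exI)
  have "Q \<in> F" if "Q \<subset> {p, w}" for Q
  proof -
    have "Q \<subseteq> {p} \<or> Q \<subseteq> {w}" using that by blast
    then show ?thesis using face_subset face_single by blast
  qed
  moreover have "\<exists>m\<in>M. \<forall>j\<in>S. \<forall>m'\<in>M. m \<bullet> v j \<le> m' \<bullet> v j" if "S \<in> F" for S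
    using common_minimiser[of M S] assms that by blast
  ultimately show "nef_certificate F v {p, w} M"
    using assms(1-5) p_neq_w pw_not_face opposite by (auto simp: nef_certificate_def)
qed

lemma triple_certificate:
  assumes cov: "covered (halfplane (v x))" "covered (halfplane (v y))" "covered (halfplane (v z))"
    and xy: "0 < vol (v p) (v x) (v y)" and yz: "0 < vol (v p) (v y) (v z)" and zx: "0 < vol (v p) (v z) (v x)"
  shows "\<exists>P M. nef_certificate F v P M"
proof -
  define a b where "a = vol (v p) (v y) (v z)" and "b = vol (v p) (v z) (v x)"
  \<comment> \<open>\<open>m1\<close> vanishes on the half-plane of \<open>v y\<close> and
    \<open>m2\<close> on that of \<open>v x\<close>; the factors \<open>b\<close> and
    \<open>a\<close> give both the value - a b on \<open>v z\<close>. So the walls of the minimum of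
    0, \<open>m1\<close>, \<open>m2\<close> are exactly the three half-planes. As determinants of
    lattice vectors the factors are integers.\<close>
  define m1 m2 where "m1 = b *\<^sub>R cross3 (v y) (v p)" and "m2 = a *\<^sub>R cross3 (v p) (v x)"
  have ab: "0 < a" "0 < b" using yz zx by (simp_all add: a_def b_def)
  have m1: "m1 \<bullet> q = b * vol (v p) q (v y)" for q
    using vol_rotate[of "v p" q "v y"] by (simp add: m1_def cross3_inner)
  have m2: "m2 \<bullet> q = a * vol (v p) (v x) q" for q
    by (simp add: m2_def cross3_inner)
  have Hx: "halfplane (v x) = {q. m2 \<bullet> q = 0 \<and> 0 \<le> m1 \<bullet> q}"
    using halfplane_iff1[OF xy] ab by (auto simp: m1 m2 zero_le_mult_iff)
  have Hy: "halfplane (v y) = {q. m1 \<bullet> q = 0 \<and> 0 \<le> m2 \<bullet> q}"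
    using halfplane_iff2[OF xy] ab by (auto simp: m1 m2 zero_le_mult_iff)
  \<comment> \<open>Expand \<open>q\<close> in \<open>v p\<close>, \<open>v x\<close>,
    \<open>v y\<close> and take the determinant with \<open>v p\<close> and
    \<open>v z\<close>.\<close>
  have "vol (v p) q (v z) = 0 \<longleftrightarrow> m1 \<bullet> q = m2 \<bullet> q" for q
  proof -
    have "vol (v p) (v z) (vol (v p) (v x) (v y) *\<^sub>R q) = vol (v p) (v z) (vol q (v x) (v y) *\<^sub>R v p + vol (v p) q (v y) *\<^sub>R v x + vol (v p) (v x) q *\<^sub>R v y)"
      by (rule arg_cong[OF cramer])
    then have "vol (v p) (v x) (v y) * vol (v p) (v z) q = m1 \<bullet> q - m2 \<bullet> q"
      using vol_swap'[of "v p" "v z" "v y"] by (simp add: vol_linear m1 m2 a_def b_def mult.commute)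
    then show ?thesis using vol_swap'[of "v p" "v z" q] xy by auto
  qed
  then have Hz: "halfplane (v z) = {q. m1 \<bullet> q = m2 \<bullet> q \<and> m1 \<bullet> q \<le> 0}"
    using halfplane_iff2[OF yz] ab by (auto simp: m1 vol_swap'[of "v p" "v y"] mult_le_0_iff)
  let ?M = "{0, m1, m2}"
  show ?thesis
  proof (rule pair_certificate[of ?M])
    show "?M \<subseteq> lattice_points"
      using lattice by (auto simp: m1_def m2_def a_def b_def intro!: zero_lattice_point lattice_points_scaleR cross3_lattice_points vol_in_Ints)
    have "m1 \<bullet> v x \<noteq> 0" using xy ab by (simp add: m1 vol_swap'[of "v p" "v y" "v x"])
    then show "?M \<noteq> {0}" by auto
    show "m \<bullet> v p = 0" if "m \<in> ?M" for m using that m1[of "v p"] m2[of "v p"] by auto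
  next
    fix m m' assume "m \<in> ?M" "m' \<in> ?M" "m \<noteq> m'"
    then consider "m = 0 \<and> m' = m1 \<or> m = m1 \<and> m' = 0" | "m = 0 \<and> m' = m2 \<or> m = m2 \<and> m' = 0"
      | "m = m1 \<and> m' = m2 \<or> m = m2 \<and> m' = m1" by auto
    then show "covered {q. m \<bullet> q = m' \<bullet> q \<and> (\<forall>m''\<in>?M. m \<bullet> q \<le> m'' \<bullet> q)}"
    proof cases
      case 1
      then have "{q. m \<bullet> q = m' \<bullet> q \<and> (\<forall>m''\<in>?M. m \<bullet> q \<le> m'' \<bullet> q)} = halfplane (v y)"
        by (auto simp: Hy)
      then show ?thesis using cov by simp
    next
      case 2
      then have "{q. m \<bullet> q = m' \<bullet> q \<and> (\<forall>m''\<in>?M. m \<bullet> q \<le> m'' \<bullet> q)} = halfplane (v x)"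
        by (auto simp: Hx)
      then show ?thesis using cov by simp
    next
      case 3
      then have "{q. m \<bullet> q = m' \<bullet> q \<and> (\<forall>m''\<in>?M. m \<bullet> q \<le> m'' \<bullet> q)} = halfplane (v z)"
        by (auto simp: Hz)
      then show ?thesis using cov by simp
    qed
  qed simp_all
qed

text \<open>The two half-planes fill the plane through \<open>v p\<close> and \<open>v x\<close>,
  the only wall of the minimum of 0 and \<open>m\<close>. The triangle with \<open>z\<close>
  completes these two vectors to a basis, which gives coordinates and shows that \<open>m\<close> is
  nonzero.\<close>

lemma opposite_certificate:
  assumes cov: "covered (halfplane (v x))" "covered (halfplane (v y))"
    and y: "v y = (- s) *\<^sub>R v x + t *\<^sub>R v p" "0 < s" and z: "triangle p x z"
  shows "\<exists>P M. nef_certificate F v P M"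
proof -
  define m where "m = cross3 (v p) (v x)"
  have m: "m \<bullet> q = vol (v p) (v x) q" for q
    by (simp add: m_def cross3_inner)
  have pxz: "vol (v p) (v x) (v z) = 1" using triangle_vol[OF z] .
  have H: "halfplane (v x) \<union> halfplane (v y) = {q. m \<bullet> q = 0}"
  proof (intro equalityI subsetI)
    fix q assume "q \<in> halfplane (v x) \<union> halfplane (v y)"
    then show "q \<in> {q. m \<bullet> q = 0}" by (auto simp: m halfplane_def y vol_linear)
  next
    fix q assume "q \<in> {q. m \<bullet> q = 0}"
    then have "q = vol q (v x) (v z) *\<^sub>R v p + vol (v p) q (v z) *\<^sub>R v x"
      using cramer[of "v p" "v x" "v z" q] pxz by (simp add: m)
    then obtain \<alpha> \<beta> where q: "q = \<alpha> *\<^sub>R v x + \<beta> *\<^sub>R v p" by (metis add.commute)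
    show "q \<in> halfplane (v x) \<union> halfplane (v y)"
    proof (cases "0 \<le> \<alpha>")
      case True
      then show ?thesis using q unfolding halfplane_def by blast
    next
      case False
      have "q = (- \<alpha> / s) *\<^sub>R v y + (\<beta> + \<alpha> / s * t) *\<^sub>R v p"
        unfolding q y(1) using y(2) by (simp add: algebra_simps)
      moreover have "0 \<le> - \<alpha> / s" using False y(2) by (simp add: divide_nonpos_pos)
      ultimately show ?thesis unfolding halfplane_def by blast
    qed
  qed
  have "covered {q. m \<bullet> q = 0}" using covered_Un[OF cov] H by simp
  have "m \<noteq> 0" using m[of "v z"] pxz by auto
  show ?thesis
  proof (rule pair_certificate[of "{0, m}"])
    show "{0, m} \<subseteq> lattice_points"
      using lattice by (auto simp: m_def intro!: zero_lattice_point cross3_lattice_points)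
    show "k \<bullet> v p = 0" if "k \<in> {0, m}" for k using that m[of "v p"] by auto
  next
    fix k k' assume k: "k \<in> {0, m}" "k' \<in> {0, m}" "k \<noteq> k'"
    then have "{q. k \<bullet> q = k' \<bullet> q \<and> (\<forall>m''\<in>{0, m}. k \<bullet> q \<le> m'' \<bullet> q)} = {q. m \<bullet> q = 0}" by auto
    then show "covered {q. k \<bullet> q = k' \<bullet> q \<and> (\<forall>m''\<in>{0, m}. k \<bullet> q \<le> m'' \<bullet> q)}"
      using \<open>covered {q. m \<bullet> q = 0}\<close> by simp
  qed (use \<open>m \<noteq> 0\<close> in auto)
qed

end

section \<open>Sets covered by edge cones, and zero-sum triples\<close>

context unimodular_fan3
begin

text \<open>By uniqueness the representation of a point can be read off from any cone that contains
  it, so one suitable edge cone per point is enough.\<close>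

lemma covered_by_cones:
  assumes "\<And>q. q \<in> H \<Longrightarrow> \<exists>x y. {x, y} \<in> F \<and> v x \<in> H \<and> v y \<in> H \<and> q \<in> cone2 x y"
  shows "covered H"
  unfolding covered_def
proof (intro ballI allI impI)
  fix q c j assume q: "q \<in> H" and c: "nonneg_rep F v c q" and j: "c j \<noteq> 0"
  obtain x y where xy: "{x, y} \<in> F" "v x \<in> H" "v y \<in> H" "q \<in> cone2 x y" using assms[OF q] by blast
  then obtain r s where "0 \<le> r" "0 \<le> s" "q = r *\<^sub>R v x + s *\<^sub>R v y" by (auto simp: cone2_def)
  then have "nonneg_rep F v (comb3 r x s y 0 y) q" using rep_comb3[of x y y r s 0] xy(1) by simp
  then have "c = comb3 r x s y 0 y" using c rep_unique by blast
  with j have "j = x \<or> j = y" by (auto simp: comb3_def split: if_splits)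
  then show "v j \<in> H" using xy by blast
qed

lemma cone2_I: "q = r *\<^sub>R v x + s *\<^sub>R v y \<Longrightarrow> 0 \<le> r \<Longrightarrow> 0 \<le> s \<Longrightarrow> q \<in> cone2 x y"
  unfolding cone2_def by blast

lemma triangle_vols:
  assumes "triangle x y z"
  shows "vol (v x) (v y) (v z) = 1" "vol (v y) (v z) (v x) = 1" "vol (v z) (v x) (v y) = 1"
    "vol (v x) (v z) (v y) = -1" "vol (v y) (v x) (v z) = -1" "vol (v z) (v y) (v x) = -1"
proof -
  have "triangle y z x" "triangle z x y" using assms triangle_rotate by blast+
  note T = this[THEN triangle_vol] triangle_vol[OF assms]
  show "vol (v x) (v y) (v z) = 1" "vol (v y) (v z) (v x) = 1" "vol (v z) (v x) (v y) = 1" using T by simp_all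
  show "vol (v x) (v z) (v y) = -1" "vol (v y) (v x) (v z) = -1" "vol (v z) (v y) (v x) = -1"
    using T vol_swap'[of "v x" "v z" "v y"] vol_swap'[of "v y" "v x" "v z"] vol_swap'[of "v z" "v y" "v x"] by simp_all
qed

lemma triangle_across:
  assumes "triangle x y z"
  obtains u where "triangle y x u" "u \<noteq> z" "u \<noteq> x" "u \<noteq> y"
proof -
  obtain u where u: "triangle y x u" using triangle_opposite[OF assms] by blast
  moreover have "u \<noteq> z" using triangle_vol[OF u] triangle_vols(5)[OF assms] by auto
  ultimately show ?thesis using that triangle_distinct[OF u] by blast
qed

lemma triple_zero_sum_certificate:
  assumes zero: "v a + v b + v c = 0" and faces: "{a, b} \<in> F" "{b, c} \<in> F" "{a, c} \<in> F"
    and d: "a \<noteq> b" "b \<noteq> c" "a \<noteq> c"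
  shows "\<exists>P M. nef_certificate F v P M"
proof (intro exI)
  have c: "v c = - v a - v b" using zero by (simp add: algebra_simps eq_neg_iff_add_eq_0)
  obtain u where u: "triangle a b u" using edge_triangle d(1) faces(1) by blast
  define m where "m = cross3 (v a) (v b)"
  have m: "m \<bullet> q = vol (v a) (v b) q" for q by (simp add: m_def cross3_inner)
  have nf: "{a, b, c} \<notin> F"
  proof
    assume "{a, b, c} \<in> F"
    then have "comb3 1 a 1 b 1 c = comb3 0 a 0 b 0 c" using zero by (intro rep_comb3_unique) auto
    then have "comb3 1 a 1 b 1 c a = comb3 0 a 0 b 0 c a" by simp
    then show False using d by (simp add: comb3_def)
  qed
  have H: "v a \<in> {q. m \<bullet> q = 0}" "v b \<in> {q. m \<bullet> q = 0}" "v c \<in> {q. m \<bullet> q = 0}"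
    by (simp_all add: m c vol_linear)
  have cov: "covered {q. m \<bullet> q = 0}"
  proof (rule covered_by_cones)
    fix q assume "q \<in> {q. m \<bullet> q = 0}"
    then obtain \<alpha> \<beta> where q: "q = \<alpha> *\<^sub>R v a + \<beta> *\<^sub>R v b"
      using cramer[of "v a" "v b" "v u" q] triangle_vol[OF u] by (auto simp: m)
    \<comment> \<open>Adding a multiple of the relation \<open>v a + v b + v c = 0\<close> that
      turns the smallest of \<alpha>, \<beta>, 0 into 0 leaves a nonnegative combination of two of
      the vectors.\<close>
    consider "0 \<le> \<alpha>" "0 \<le> \<beta>" | "\<alpha> < 0" "\<alpha> \<le> \<beta>" | "\<beta> < 0" "\<beta> \<le> \<alpha>" by linarith
    then show "\<exists>x y. {x, y} \<in> F \<and> v x \<in> {q. m \<bullet> q = 0} \<and> v y \<in> {q. m \<bullet> q = 0} \<and> q \<in> cone2 x y"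
    proof cases
      case 1
      then have "q \<in> cone2 a b" using cone2_I[OF q] by simp
      then show ?thesis using H faces by blast
    next
      case 2
      have "q = (\<beta> - \<alpha>) *\<^sub>R v b + (- \<alpha>) *\<^sub>R v c" by (simp add: q c algebra_simps)
      then have "q \<in> cone2 b c" using cone2_I[of q "\<beta> - \<alpha>" b "- \<alpha>" c] 2 by simp
      then show ?thesis using H faces by blast
    next
      case 3
      have "q = (\<alpha> - \<beta>) *\<^sub>R v a + (- \<beta>) *\<^sub>R v c" by (simp add: q c algebra_simps)
      then have "q \<in> cone2 a c" using cone2_I[of q "\<alpha> - \<beta>" a "- \<beta>" c] 3 by simp
      then show ?thesis using H faces by blast
    qed
  qed
  have "\<exists>k\<in>{0, m}. \<forall>j\<in>S. \<forall>m'\<in>{0, m}. k \<bullet> v j \<le> m' \<bullet> v j" if "S \<in> F" for S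
  proof (rule common_minimiser[OF _ _ _ that])
    fix k k' assume "k \<in> {0, m}" "k' \<in> {0, m}" "k \<noteq> k'"
    then have "{q. k \<bullet> q = k' \<bullet> q \<and> (\<forall>m''\<in>{0, m}. k \<bullet> q \<le> m'' \<bullet> q)} = {q. m \<bullet> q = 0}" by auto
    then show "covered {q. k \<bullet> q = k' \<bullet> q \<and> (\<forall>m''\<in>{0, m}. k \<bullet> q \<le> m'' \<bullet> q)}" using cov by simp
  qed simp_all
  moreover have "Q \<in> F" if "Q \<subset> {a, b, c}" for Q
  proof -
    have "Q \<subseteq> {a, b} \<or> Q \<subseteq> {b, c} \<or> Q \<subseteq> {a, c}" using that by blast
    then show ?thesis using faces face_subset by blast
  qed
  moreover have "m \<noteq> 0" using m[of "v u"] triangle_vol[OF u] by auto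
  moreover have "{0, m} \<subseteq> lattice_points"
    using lattice by (auto simp: m_def intro!: zero_lattice_point cross3_lattice_points)
  ultimately show "nef_certificate F v {a, b, c} {0, m}"
    using nf zero d H by (auto simp: nef_certificate_def add.assoc)
qed

end

section \<open>Good half-planes and nested links\<close>

context opposite_pair
begin

lemma vert_in_halfplane: "v p \<in> halfplane u" "v w \<in> halfplane u" "0 \<le> s \<Longrightarrow> s *\<^sub>R u + t *\<^sub>R v p \<in> halfplane u"
proof -
  have *: "s *\<^sub>R u + t *\<^sub>R v p \<in> halfplane u" if "0 \<le> s" for s t
    using that unfolding halfplane_def by blast
  then show "0 \<le> s \<Longrightarrow> s *\<^sub>R u + t *\<^sub>R v p \<in> halfplane u" .
  show "v p \<in> halfplane u" "v w \<in> halfplane u"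
    using *[of 0 1] *[of 0 "-1"] by (simp_all add: opposite)
qed

lemma self_in_halfplane: "u \<in> halfplane u"
  using vert_in_halfplane(3)[of 1 u 0] by simp

text \<open>With \<open>v p\<close> pointing upwards: the part of the half-plane through \<open>v c\<close> that lies above the ray
  of \<open>v c\<close> is a union of cones.\<close>

definition reach :: "'k \<Rightarrow> bool" where
  "reach c \<longleftrightarrow> (\<forall>s t. 0 \<le> s \<longrightarrow> 0 \<le> t \<longrightarrow> (\<exists>x y. {x, y} \<in> F \<and> v x \<in> halfplane (v c) \<and> v y \<in> halfplane (v c) \<and>
     s *\<^sub>R v c + t *\<^sub>R v p \<in> cone2 x y))"

lemma reach_link: "c \<in> link F p \<Longrightarrow> reach c"
  unfolding reach_def
proof (intro allI impI)
  fix s t :: real assume c: "c \<in> link F p" and st: "0 \<le> s" "0 \<le> t"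
  have "s *\<^sub>R v c + t *\<^sub>R v p \<in> cone2 c p" using cone2_I[OF refl] st by blast
  moreover have "{c, p} \<in> F" using c by (simp add: link_def insert_commute)
  ultimately show "\<exists>x y. {x, y} \<in> F \<and> v x \<in> halfplane (v c) \<and> v y \<in> halfplane (v c) \<and> s *\<^sub>R v c + t *\<^sub>R v p \<in> cone2 x y"
    using vert_in_halfplane self_in_halfplane by blast
qed

text \<open>Both vertices span the same half-plane. A point above the ray of \<open>v d\<close> is
  either above the ray of \<open>v c\<close>, where the hypothesis applies, or between the two rays,
  where the edge from \<open>c\<close> to \<open>d\<close> covers it.\<close>

lemma reach_edge:
  assumes c: "reach c" and cd: "{c, d} \<in> F" and d: "v d = s *\<^sub>R v c + t *\<^sub>R v p" "0 < s"
  shows "reach d"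
  unfolding reach_def
proof (intro allI impI)
  fix s0 t0 :: real assume st: "0 \<le> s0" "0 \<le> t0"
  have H: "halfplane (v d) = halfplane (v c)" unfolding d(1) by (rule halfplane_scale[OF d(2)])
  have eq: "s0 *\<^sub>R v d + t0 *\<^sub>R v p = (s0 * s) *\<^sub>R v c + (s0 * t + t0) *\<^sub>R v p"
    by (simp add: d(1) algebra_simps)
  show "\<exists>x y. {x, y} \<in> F \<and> v x \<in> halfplane (v d) \<and> v y \<in> halfplane (v d) \<and> s0 *\<^sub>R v d + t0 *\<^sub>R v p \<in> cone2 x y"
  proof (cases "0 \<le> s0 * t + t0")
    case True
    then show ?thesis using c st d(2) unfolding reach_def H eq by simp
  next
    case False
    then have t: "t < 0" using st by (smt (verit) mult_nonneg_nonneg)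
    \<comment> \<open>Eliminating \<open>v p\<close> by means of the equation for \<open>v d\<close>
      turns the point into \<open>r * s\<close> times \<open>v c\<close> plus \<open>s0 - r\<close>
      times \<open>v d\<close>.\<close>
    define r where "r = t0 / (- t)"
    have r: "0 \<le> r" using t st by (simp add: r_def divide_nonneg_neg)
    have t0: "t0 = - (r * t)" using t by (simp add: r_def)
    have "r < s0"
    proof (rule ccontr)
      assume "\<not> r < s0"
      then have "r * t \<le> s0 * t" using t by (intro mult_right_mono_neg) auto
      then show False using False t0 by simp
    qed
    moreover have "s0 *\<^sub>R v d + t0 *\<^sub>R v p = (r * s) *\<^sub>R v c + (s0 - r) *\<^sub>R v d"
      by (simp add: d(1) t0 algebra_simps)
    ultimately have "s0 *\<^sub>R v d + t0 *\<^sub>R v p \<in> cone2 c d"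
      using r d(2) by (intro cone2_I[of _ "r * s" _ "s0 - r"]) auto
    then show ?thesis using cd H self_in_halfplane by blast
  qed
qed

lemma reach_covered:
  assumes d: "reach d" "d \<in> link F w"
  shows "covered (halfplane (v d))"
proof (rule covered_by_cones)
  fix q assume "q \<in> halfplane (v d)"
  then obtain s t where st: "0 \<le> s" "q = s *\<^sub>R v d + t *\<^sub>R v p" by (auto simp: halfplane_def)
  show "\<exists>x y. {x, y} \<in> F \<and> v x \<in> halfplane (v d) \<and> v y \<in> halfplane (v d) \<and> q \<in> cone2 x y"
  proof (cases "0 \<le> t")
    case True
    then show ?thesis using d st unfolding reach_def by blast
  next
    case False
    then have "q \<in> cone2 d w" using st by (intro cone2_I[of q s d "-t" w]) (auto simp: opposite)
    moreover have "{d, w} \<in> F" using d(2) by (simp add: link_def insert_commute)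
    ultimately show ?thesis using vert_in_halfplane self_in_halfplane by blast
  qed
qed

lemma common_covered: "c \<in> link F p \<Longrightarrow> c \<in> link F w \<Longrightarrow> covered (halfplane (v c))"
  using reach_link reach_covered by blast

text \<open>The edges from \<open>p\<close> to \<open>c\<close>, from \<open>c\<close> to
  \<open>d\<close> and from \<open>d\<close> to \<open>w\<close> lie in one half-plane and together
  cover it.\<close>

lemma edge_covered:
  assumes "c \<in> link F p" "d \<in> link F w" "{c, d} \<in> F" "v d = s *\<^sub>R v c + t *\<^sub>R v p" "0 < s"
  shows "covered (halfplane (v c))"
proof -
  have "covered (halfplane (v d))" using assms reach_link reach_edge reach_covered by blast
  then show ?thesis unfolding assms(4) halfplane_scale[OF assms(5)] .
qed

lemma coordinates:
  assumes "triangle p a b"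
  obtains x y z where "q = x *\<^sub>R v a + y *\<^sub>R v b + z *\<^sub>R v p"
  using vol_coordinates[of "v p" "v a" "v b" q] triangle_vol[OF assms] by (metis add.commute add.left_commute)

lemma link_subset_certificate:
  assumes sub: "link F w \<subseteq> link F p"
  shows "\<exists>P M. nef_certificate F v P M"
proof -
  interpret W: opposite_pair F v w p by (rule swap)
  have cov: "covered (halfplane (v j))" if "j \<in> link F w" for j
    using common_covered that sub by blast
  obtain a a' where a: "triangle w a a'" using mod_cover[of w 0] by blast
  \<comment> \<open>Modulo \<open>v p\<close> the cone of this triangle contains
    \<open>- v a\<close>. If one coefficient vanishes, two good half-planes are opposite; if none
    does, three of them positively span; if both did, \<open>v a\<close> would be vertical.\<close>
  obtain c d k s t where cd: "triangle w c d" and st: "0 \<le> s" "0 \<le> t"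
    and eq: "- v a = k *\<^sub>R v w + s *\<^sub>R v c + t *\<^sub>R v d" using mod_cover[of w "- v a"] by blast
  have in_w: "a \<in> link F w" "c \<in> link F w" "d \<in> link F w"
    using W.triangle_link[OF a] W.triangle_link[OF cd] by blast+
  have va: "v a = k *\<^sub>R v p - s *\<^sub>R v c - t *\<^sub>R v d"
  proof -
    have "v a = - (k *\<^sub>R v w + s *\<^sub>R v c + t *\<^sub>R v d)" using eq by (metis minus_equation_iff)
    then show ?thesis by (simp add: opposite)
  qed
  \<comment> \<open>Triangles at \<open>w\<close> have the reverse orientation as seen from
    \<open>p\<close>, whence the order \<open>d\<close>, \<open>c\<close>, \<open>a\<close> in the
    application of \<open>triple_certificate\<close>.\<close>
  have pcd: "vol (v p) (v d) (v c) = 1" "vol (v p) (v c) (v d) = -1"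
    using triangle_vols[OF cd] by (simp_all add: opposite vol_linear)
  consider "s = 0" "t = 0" | "s = 0" "0 < t" | "0 < s" "t = 0" | "0 < s" "0 < t" using st by linarith
  then show ?thesis
  proof cases
    case 1
    then have "1 *\<^sub>R v a + 0 *\<^sub>R v a + 0 *\<^sub>R v a = k *\<^sub>R v p" using va by simp
    then have False using no_vertical[of a a a 1 0 0 k] W.triangle_link[OF a] by (simp add: face_single)
    then show ?thesis ..
  next
    case 2
    obtain z where "triangle p d z" using link_next in_w(3) sub by blast
    moreover have "v a = (- t) *\<^sub>R v d + k *\<^sub>R v p" using va 2 by simp
    ultimately show ?thesis using opposite_certificate[of d a t k z] cov in_w 2 by blast
  next
    case 3
    obtain z where "triangle p c z" using link_next in_w(2) sub by blast
    moreover have "v a = (- s) *\<^sub>R v c + k *\<^sub>R v p" using va 3 by simp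
    ultimately show ?thesis using opposite_certificate[of c a s k z] cov in_w 3 by blast
  next
    case 4
    have "0 < vol (v p) (v c) (v a)" "0 < vol (v p) (v a) (v d)"
      using pcd 4 by (simp_all add: va vol_linear)
    then show ?thesis using triple_certificate[of d c a] cov in_w pcd by simp
  qed
qed

end

section \<open>Two links that are cycles of length three\<close>

context opposite_pair
begin

lemma link_face: "{p, x} \<in> F \<Longrightarrow> x \<noteq> p \<Longrightarrow> x \<in> link F p" "{w, x} \<in> F \<Longrightarrow> x \<noteq> w \<Longrightarrow> x \<in> link F w"
  by (simp_all add: link_def)

lemma triangle_w_link:
  assumes "triangle w x y"
  shows "x \<in> link F w" "y \<in> link F w" "x \<noteq> y" "x \<noteq> p" "y \<noteq> p" "x \<noteq> w" "y \<noteq> w"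
proof -
  interpret W: opposite_pair F v w p by (rule swap)
  show "x \<in> link F w" "y \<in> link F w" "x \<noteq> y" "x \<noteq> p" "y \<noteq> p" "x \<noteq> w" "y \<noteq> w"
    using W.triangle_link[OF assms] by auto
qed

text \<open>The two triangles at \<open>c\<close> have determinant 1, which fixes the coefficients
  of \<open>v a\<close> and \<open>v b\<close>; only the height \<open>h\<close> stays free. The sum
  of the three vectors is then vertical, so they cannot form a face.\<close>

lemma three_cycle:
  assumes "triangle p a b" "triangle p b c" "triangle p c a"
  obtains h where "v c = - v a - v b + h *\<^sub>R v p" "{a, b, c} \<notin> F"
proof -
  obtain x y h where c: "v c = x *\<^sub>R v a + y *\<^sub>R v b + h *\<^sub>R v p" using coordinates[OF assms(1)] by blast
  have "x = -1" using triangle_vol[OF assms(2)] by (simp add: c vol_linear triangle_vols[OF assms(1)])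
  moreover have "y = -1" using triangle_vol[OF assms(3)] by (simp add: c vol_linear triangle_vols[OF assms(1)])
  ultimately have c': "v c = - v a - v b + h *\<^sub>R v p" using c by simp
  then have "1 *\<^sub>R v a + 1 *\<^sub>R v b + 1 *\<^sub>R v c = h *\<^sub>R v p" by simp
  then have "{a, b, c} \<notin> F"
    using no_vertical[of a b c 1 1 1 h] triangle_link[OF assms(1)] by auto
  with c' that show ?thesis by blast
qed

lemma three_cycle_zero_certificate:
  assumes "triangle p a b" "triangle p b c" "triangle p c a" "v c = - v a - v b"
  shows "\<exists>P M. nef_certificate F v P M"
proof (rule triple_zero_sum_certificate[of a b c])
  show "{a, b} \<in> F" "{b, c} \<in> F" "{a, c} \<in> F"
    using triangle_face[OF assms(1)] triangle_face[OF assms(2)] triangle_face[OF assms(3)] by auto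
qed (use triangle_link[OF assms(1)] triangle_link[OF assms(2)] triangle_link[OF assms(3)] assms(4) in auto)

lemma three_cycle_triple_certificate:
  assumes "triangle p a b" "triangle p b c" "triangle p c a"
    and "covered (halfplane (v a))" "covered (halfplane (v b))" "covered (halfplane (v c))"
  shows "\<exists>P M. nef_certificate F v P M"
  using triple_certificate[of a b c] assms triangle_vol by simp

text \<open>Modulo \<open>v p\<close> the vertices \<open>c\<close> and \<open>d\<close> agree, and
  the half-planes of \<open>a\<close> and \<open>b\<close> are good. It remains to show that the
  half-plane of \<open>c\<close> is good too or that \<open>h = 0\<close>, which is a zero-sum
  triple. If \<open>c\<close> and \<open>d\<close> are not adjacent, the seventh vertex
  \<open>e\<close> has to fill the gap between them.\<close>

lemma cycles_sharing_edge:
  assumes ab: "triangle p a b" and bc: "triangle p b c" and ca: "triangle p c a"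
    and ba: "triangle w b a" and ad: "triangle w a d" and db: "triangle w d b"
    and U: "UNIV = {p, w, a, b, c, d, e}" and cw: "c \<notin> link F w" and dp: "d \<notin> link F p"
  shows "\<exists>P M. nef_certificate F v P M"
proof -
  note V = triangle_vols[OF ab] and n = triangle_link[OF ab] triangle_link[OF bc] triangle_link[OF ca]
  note n' = triangle_w_link[OF ba] triangle_w_link[OF ad] triangle_w_link[OF db]
  obtain h where c: "v c = - v a - v b + h *\<^sub>R v p" and abc: "{a, b, c} \<notin> F"
    using three_cycle[OF ab bc ca] by blast
  obtain x y g where d0: "v d = x *\<^sub>R v a + y *\<^sub>R v b + g *\<^sub>R v p" using coordinates[OF ab] by blast
  have "y = -1" using triangle_vol[OF ad] by (simp add: d0 vol_linear opposite V)
  moreover have "x = -1" using triangle_vol[OF db] by (simp add: d0 vol_linear opposite V)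
  ultimately have d: "v d = - v a - v b + g *\<^sub>R v p" using d0 by simp
  have dc: "v d = 1 *\<^sub>R v c + (g - h) *\<^sub>R v p" by (simp add: c d algebra_simps)
  have cov: "covered (halfplane (v a))" "covered (halfplane (v b))" using common_covered n n' by blast+
  have "covered (halfplane (v c)) \<or> h = 0"
  proof (cases "{c, d} \<in> F")
    case True
    then show ?thesis using edge_covered[of c d 1 "g - h"] n n' dc by simp
  next
    case cd: False
    have abd: "{a, b, d} \<notin> F"
    proof
      assume "{a, b, d} \<in> F"
      moreover have "1 *\<^sub>R v a + 1 *\<^sub>R v b + 1 *\<^sub>R v d = g *\<^sub>R v p" by (simp add: d)
      ultimately show False using no_vertical[of a b d 1 1 1 g] n by auto
    qed
    obtain k l m where e: "v e = k *\<^sub>R v a + l *\<^sub>R v b + m *\<^sub>R v p" using coordinates[OF ab] by blast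
    have cw': "\<And>S. S \<in> F \<Longrightarrow> c \<in> S \<Longrightarrow> w \<in> S \<Longrightarrow> False"
      using cw link_face(2)[of c] n face_subset by (metis empty_subsetI insert_subset)
    have dp': "\<And>S. S \<in> F \<Longrightarrow> d \<in> S \<Longrightarrow> p \<in> S \<Longrightarrow> False"
      using dp link_face(1)[of d] n' face_subset by (metis empty_subsetI insert_subset)
    have cd': "\<And>S. S \<in> F \<Longrightarrow> c \<in> S \<Longrightarrow> d \<in> S \<Longrightarrow> False"
      using cd face_subset by (metis empty_subsetI insert_subset)
    \<comment> \<open>Every vertex other than \<open>e\<close> is excluded as third vertex across
      this edge. The next two triangles are found by the same elimination.\<close>
    have ace: "triangle a c e"
    proof -
      obtain u where u: "triangle a c u" "u \<noteq> p" "u \<noteq> a" "u \<noteq> c"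
        using triangle_across[OF triangle_rotate[OF ca]] by metis
      have "u \<noteq> w" "u \<noteq> d" using cw'[of "{a, c, u}"] cd'[of "{a, c, u}"] u(1) by (auto simp: triangle_def)
      moreover have "u \<noteq> b" using abc u(1) by (auto simp: triangle_def insert_commute)
      ultimately show ?thesis using u U by auto
    qed
    have cbe: "triangle c b e"
    proof -
      obtain u where u: "triangle c b u" "u \<noteq> p" "u \<noteq> b" "u \<noteq> c"
        using triangle_across[OF triangle_rotate[OF bc]] by metis
      have "u \<noteq> w" "u \<noteq> d" using cw'[of "{c, b, u}"] cd'[of "{c, b, u}"] u(1) by (auto simp: triangle_def)
      moreover have "u \<noteq> a" using abc u(1) by (auto simp: triangle_def insert_commute)
      ultimately show ?thesis using u U by auto
    qed
    have dae: "triangle d a e"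
    proof -
      obtain u where u: "triangle d a u" "u \<noteq> w" "u \<noteq> a" "u \<noteq> d"
        using triangle_across[OF triangle_rotate[OF ad]] by metis
      have "u \<noteq> p" "u \<noteq> c" using dp'[of "{d, a, u}"] cd'[of "{d, a, u}"] u(1) by (auto simp: triangle_def)
      moreover have "u \<noteq> b" using abd u(1) by (auto simp: triangle_def insert_commute)
      ultimately show ?thesis using u U by auto
    qed
    \<comment> \<open>The first two equations give \<open>h * k = h * l\<close>, so for nonzero
      \<open>h\<close> the vertex \<open>e\<close> lies in the plane of \<open>v p\<close> and
      \<open>v c\<close>.\<close>
    have E1: "h * l + m = -1" using triangle_vol[OF ace] by (simp add: e c vol_linear V algebra_simps)
    have E2: "h * k + m = -1" using triangle_vol[OF cbe] by (simp add: e c vol_linear V algebra_simps)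
    have E3: "g * l + m = 1" using triangle_vol[OF dae] by (simp add: e d vol_linear V algebra_simps)
    show ?thesis
    proof (cases "h = 0")
      case False
      have "h * k = h * l" using E1 E2 by linarith
      with False have kl: "k = l" by simp
      have ec: "v e = (- l) *\<^sub>R v c + (m + l * h) *\<^sub>R v p" by (simp add: e c kl algebra_simps)
      \<comment> \<open>For positive \<open>l\<close> the edge from \<open>c\<close> to
        \<open>e\<close> would meet the vertical line; for \<open>l = 0\<close> the equations
        \<open>E1\<close> and \<open>E3\<close> make \<open>m\<close> both -1 and 1.\<close>
      have "l < 0"
      proof (rule ccontr)
        assume "\<not> l < 0"
        moreover have "l *\<^sub>R v c + 1 *\<^sub>R v e + 0 *\<^sub>R v e = (m + l * h) *\<^sub>R v p" by (simp add: ec)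
        moreover have "{c, e, e} \<in> F" using triangle_face[OF ace] by auto
        ultimately have "l = 0" using no_vertical[of c e e l 1 0] n by force
        then show False using E1 E3 by simp
      qed
      \<comment> \<open>The vertices \<open>c\<close>, \<open>e\<close>, \<open>d\<close> lie in one
        half-plane, so \<open>reach\<close> passes along these two edges, and the edge from
        \<open>d\<close> to \<open>w\<close> completes the half-plane.\<close>
      then have "reach e" using reach_edge[of c e "-l"] reach_link n ec triangle_face[OF ace] by auto
      moreover have "v d = (1 / - l) *\<^sub>R v e + (g - h + (m + l * h) / l) *\<^sub>R v p"
      proof -
        have "(1 / - l) *\<^sub>R v e = v c - ((m + l * h) / l) *\<^sub>R v p"
          unfolding ec using \<open>l < 0\<close> by (simp only: scaleR_right_distrib scaleR_scaleR) simp
        then show ?thesis by (simp add: dc algebra_simps)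
      qed
      ultimately have "reach d" using reach_edge[of e d "1 / - l"] triangle_face[OF dae] \<open>l < 0\<close> by auto
      then have "covered (halfplane (v d))" using reach_covered n' by blast
      then have "covered (halfplane (v c))" unfolding dc by (subst (asm) halfplane_scale) auto
      then show ?thesis ..
    qed simp
  qed
  then show ?thesis
    using three_cycle_triple_certificate[OF ab bc ca] three_cycle_zero_certificate[OF ab bc ca] cov c by auto
qed

text \<open>The two links use up all seven vertices, so the triangles across the outer edges have
  very few possible third vertices. All possibilities give \<open>h * (1 + s) = 0\<close>: either a
  zero-sum triple, or \<open>d\<close> and \<open>e\<close> lie in the half-planes of
  \<open>c\<close> and \<open>b\<close>.\<close>

lemma cycles_sharing_vertex:
  assumes ab: "triangle p a b" and bc: "triangle p b c" and ca: "triangle p c a"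
    and ad: "triangle w a d" and de: "triangle w d e" and ea: "triangle w e a"
    and U: "UNIV = {p, w, a, b, c, d, e}" and nw: "b \<notin> link F w" "c \<notin> link F w"
    and np: "d \<notin> link F p" "e \<notin> link F p"
  shows "\<exists>P M. nef_certificate F v P M"
proof -
  note V = triangle_vols[OF ab] and n = triangle_link[OF ab] triangle_link[OF bc] triangle_link[OF ca]
  note n' = triangle_w_link[OF ad] triangle_w_link[OF de] triangle_w_link[OF ea]
  obtain h where c: "v c = - v a - v b + h *\<^sub>R v p" and abc: "{a, b, c} \<notin> F"
    using three_cycle[OF ab bc ca] by blast
  obtain s y g where d0: "v d = s *\<^sub>R v a + y *\<^sub>R v b + g *\<^sub>R v p" using coordinates[OF ab] by blast
  have "y = -1" using triangle_vol[OF ad] by (simp add: d0 vol_linear opposite V)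
  then have d: "v d = s *\<^sub>R v a - v b + g *\<^sub>R v p" using d0 by simp
  obtain k l m where e0: "v e = k *\<^sub>R v a + l *\<^sub>R v b + m *\<^sub>R v p" using coordinates[OF ab] by blast
  have "l = 1" using triangle_vol[OF ea] by (simp add: e0 vol_linear opposite V)
  moreover from this have "k = -1 - s" using triangle_vol[OF de] by (simp add: d e0 vol_linear opposite V)
  ultimately have e: "v e = (-1 - s) *\<^sub>R v a + v b + m *\<^sub>R v p" using e0 by simp
  have w': "\<And>S. S \<in> F \<Longrightarrow> w \<in> S \<Longrightarrow> b \<in> S \<or> c \<in> S \<Longrightarrow> False"
    using nw link_face(2)[of c] link_face(2)[of b] n face_subset by (metis empty_subsetI insert_subset)
  have p': "\<And>S. S \<in> F \<Longrightarrow> p \<in> S \<Longrightarrow> d \<in> S \<or> e \<in> S \<Longrightarrow> False"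
    using np link_face(1)[of d] link_face(1)[of e] n' face_subset by (metis empty_subsetI insert_subset)
  have acd: "triangle a c d"
  proof -
    obtain u where u: "triangle a c u" "u \<noteq> p" "u \<noteq> a" "u \<noteq> c"
      using triangle_across[OF triangle_rotate[OF ca]] by metis
    have "u \<noteq> w" using w'[of "{a, c, u}"] u(1) by (auto simp: triangle_def)
    moreover have "u \<noteq> b" using abc u(1) by (auto simp: triangle_def insert_commute)
    \<comment> \<open>The oriented edge from \<open>e\<close> to \<open>a\<close> already has
      \<open>w\<close> as its third vertex.\<close>
    moreover have "u \<noteq> e"
    proof
      assume "u = e"
      then have "triangle e a c" using u(1) triangle_rotate by blast
      moreover have "triangle e a w" using ea triangle_rotate by blast
      ultimately have "c = w" by (rule triangle_unique)
      then show False using n by simp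
    qed
    ultimately show ?thesis using u U by auto
  qed
  have aeb: "triangle a e b"
  proof -
    obtain u where u: "triangle a e u" "u \<noteq> w" "u \<noteq> a" "u \<noteq> e"
      using triangle_across[OF triangle_rotate[OF ea]] by metis
    have "u \<noteq> p" using p'[of "{a, e, u}"] u(1) by (auto simp: triangle_def)
    moreover have "u \<noteq> d"
    proof
      assume "u = d"
      then have "{a, e, d} \<in> F" using u(1) by (simp add: triangle_def)
      moreover have "1 *\<^sub>R v a + 1 *\<^sub>R v e + 1 *\<^sub>R v d = (g + m) *\<^sub>R v p"
        by (simp add: d e algebra_simps)
      ultimately show False using no_vertical[of a e d 1 1 1 "g + m"] n by auto
    qed
    moreover have "u \<noteq> c"
    proof
      assume "u = c"
      then have "triangle c a e" using u(1) triangle_rotate by blast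
      moreover have "triangle c a p" using ca triangle_rotate by blast
      ultimately have "e = p" by (rule triangle_unique)
      then show False using n' by simp
    qed
    ultimately show ?thesis using u U by auto
  qed
  have E1: "g = h - 1" using triangle_vol[OF acd] by (simp add: d c vol_linear V algebra_simps)
  have E2: "m = -1" using triangle_vol[OF aeb] by (simp add: e vol_linear V algebra_simps)
  obtain u where u: "triangle c b u" "u \<noteq> p" "u \<noteq> b" "u \<noteq> c"
    using triangle_across[OF triangle_rotate[OF bc]] by metis
  have "u \<noteq> w" using w'[of "{c, b, u}"] u(1) by (auto simp: triangle_def)
  moreover have "u \<noteq> a" using abc u(1) by (auto simp: triangle_def insert_commute)
  ultimately have "u = d \<or> u = e" using u U by auto
  \<comment> \<open>The third vertex across this edge stays undecided, but both candidates lead to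
    the same equation.\<close>
  then have "h * (1 + s) = 0"
  proof
    assume "u = d"
    then show ?thesis using triangle_vol[OF u(1)] E1 by (simp add: d c vol_linear V algebra_simps)
  next
    assume "u = e"
    then show ?thesis using triangle_vol[OF u(1)] E2 by (simp add: e c vol_linear V algebra_simps)
  qed
  then consider "h = 0" | "s = -1" by auto
  then show ?thesis
  proof cases
    case 1
    then show ?thesis using three_cycle_zero_certificate[OF ab bc ca] c by simp
  next
    case 2
    have "v d = 1 *\<^sub>R v c + (g - h) *\<^sub>R v p" "v e = 1 *\<^sub>R v b + m *\<^sub>R v p"
      by (simp_all add: c d e 2 algebra_simps)
    then have "covered (halfplane (v c))" "covered (halfplane (v b))"
      using edge_covered[of c d 1] edge_covered[of b e 1] n n' triangle_face[OF acd] triangle_face[OF aeb]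
      by (auto simp: insert_commute)
    then show ?thesis using three_cycle_triple_certificate[OF ab bc ca] common_covered n n' by blast
  qed
qed

end

section \<open>Links that are cycles of length four\<close>

context opposite_pair
begin

lemma link_sym: "x \<in> link F y \<longleftrightarrow> y \<in> link F x"
  by (auto simp: link_def insert_commute)

lemma triangle_in_link:
  assumes "triangle x y z"
  shows "y \<in> link F x" "z \<in> link F x" "x \<in> link F y" "z \<in> link F y" "x \<in> link F z" "y \<in> link F z"
  using triangle_face[OF assms] triangle_distinct[OF assms] by (auto simp: link_def)

lemma vertical_edge:
  assumes "r *\<^sub>R v x + s *\<^sub>R v y = l *\<^sub>R v p" "0 < r" "0 \<le> s" "x \<noteq> p" "x \<noteq> w"
  shows "y \<notin> link F x"
  using no_vertical[of x y y r s 0 l] assms by (auto simp: link_def)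

text \<open>Here \<open>a\<close> and \<open>b\<close> are opposite in the cycle of
  \<open>w\<close>, which places \<open>d\<close> in the half-plane of \<open>c\<close> and
  \<open>e\<close> in the opposite one. Hence \<open>c\<close> and \<open>e\<close> are not
  adjacent, the triangle across the edge from \<open>a\<close> to \<open>c\<close> must end in
  \<open>d\<close>, and the third half-plane is good.\<close>

lemma cycles_three_four_nonadjacent:
  assumes ab: "triangle p a b" and bc: "triangle p b c" and ca: "triangle p c a"
    and ad: "triangle w a d" and db: "triangle w d b" and be: "triangle w b e" and ea: "triangle w e a"
    and U: "UNIV = {p, w, a, b, c, d, e}" and cw: "c \<notin> link F w"
  shows "\<exists>P M. nef_certificate F v P M"
proof -
  note V = triangle_vols[OF ab] and n = triangle_link[OF ab] triangle_link[OF bc] triangle_link[OF ca]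
  note n' = triangle_w_link[OF ad] triangle_w_link[OF db] triangle_w_link[OF be]
  obtain h where c: "v c = - v a - v b + h *\<^sub>R v p" and abc: "{a, b, c} \<notin> F"
    using three_cycle[OF ab bc ca] by blast
  obtain x y g where d0: "v d = x *\<^sub>R v a + y *\<^sub>R v b + g *\<^sub>R v p" using coordinates[OF ab] by blast
  have "y = -1" using triangle_vol[OF ad] by (simp add: d0 vol_linear opposite V)
  moreover have "x = -1" using triangle_vol[OF db] by (simp add: d0 vol_linear opposite V)
  ultimately have d: "v d = - v a - v b + g *\<^sub>R v p" using d0 by simp
  obtain k l m where e0: "v e = k *\<^sub>R v a + l *\<^sub>R v b + m *\<^sub>R v p" using coordinates[OF ab] by blast
  have "k = 1" using triangle_vol[OF be] by (simp add: e0 vol_linear opposite V)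
  moreover have "l = 1" using triangle_vol[OF ea] by (simp add: e0 vol_linear opposite V)
  ultimately have e: "v e = v a + v b + m *\<^sub>R v p" using e0 by simp
  have ce: "e \<notin> link F c"
    using vertical_edge[of 1 c 1 e "h + m"] n by (simp add: c e algebra_simps)
  obtain u where u: "triangle a c u" "u \<noteq> p" "u \<noteq> a" "u \<noteq> c"
    using triangle_across[OF triangle_rotate[OF ca]] by metis
  have "u \<noteq> w" "u \<noteq> e" using triangle_in_link[OF u(1)] cw ce link_sym by blast+
  moreover have "u \<noteq> b" using abc u(1) by (auto simp: triangle_def insert_commute)
  ultimately have acd: "triangle a c d" using u U by auto
  have "v d = 1 *\<^sub>R v c + (g - h) *\<^sub>R v p" by (simp add: c d algebra_simps)
  then have "covered (halfplane (v c))"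
    using edge_covered[of c d 1 "g - h"] n n' triangle_face[OF acd] by simp
  then show ?thesis using three_cycle_triple_certificate[OF ab bc ca] common_covered n n' by blast
qed

text \<open>The triangle \<open>w e d\<close> gives \<open>k * g = 0\<close>, so modulo
  \<open>v p\<close> either \<open>d\<close> is opposite to \<open>a\<close> or \<open>e\<close> is
  opposite to \<open>b\<close>. In each case the triangles around \<open>c\<close> force a good
  half-plane at \<open>c\<close>, a zero-sum triple, or a second pair of opposite rays.\<close>

lemma cycles_three_four_adjacent:
  assumes ab: "triangle p a b" and bc: "triangle p b c" and ca: "triangle p c a"
    and ba: "triangle w b a" and ae: "triangle w a e" and ed: "triangle w e d" and db: "triangle w d b"
    and U: "UNIV = {p, w, a, b, c, d, e}" and cw: "c \<notin> link F w" and dp: "d \<notin> link F p"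
  shows "\<exists>P M. nef_certificate F v P M"
proof -
  note V = triangle_vols[OF ab] and n = triangle_link[OF ab] triangle_link[OF bc] triangle_link[OF ca]
  note n' = triangle_w_link[OF ba] triangle_w_link[OF ae] triangle_w_link[OF ed] triangle_w_link[OF db]
  obtain h where c: "v c = - v a - v b + h *\<^sub>R v p" and abc: "{a, b, c} \<notin> F"
    using three_cycle[OF ab bc ca] by blast
  obtain k y m where e0: "v e = k *\<^sub>R v a + y *\<^sub>R v b + m *\<^sub>R v p" using coordinates[OF ab] by blast
  have "y = -1" using triangle_vol[OF ae] by (simp add: e0 vol_linear opposite V)
  then have e: "v e = k *\<^sub>R v a - v b + m *\<^sub>R v p" using e0 by simp
  obtain x g l where d0: "v d = x *\<^sub>R v a + g *\<^sub>R v b + l *\<^sub>R v p" using coordinates[OF ab] by blast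
  have "x = -1" using triangle_vol[OF db] by (simp add: d0 vol_linear opposite V)
  then have d: "v d = - v a + g *\<^sub>R v b + l *\<^sub>R v p" using d0 by simp
  have kg: "k * g = 0" using triangle_vol[OF ed] by (auto simp: d e vol_linear opposite V)
  have cov: "covered (halfplane (v a))" "covered (halfplane (v b))" using common_covered n n' by blast+
  note zero = three_cycle_zero_certificate[OF ab bc ca] and triple = three_cycle_triple_certificate[OF ab bc ca cov]
  obtain u where u: "triangle c b u" "u \<noteq> p" "u \<noteq> b" "u \<noteq> c"
    using triangle_across[OF triangle_rotate[OF bc]] by metis
  have "u \<noteq> w" using triangle_in_link[OF u(1)] cw link_sym by blast
  moreover have "u \<noteq> a" using abc u(1) by (auto simp: triangle_def insert_commute)
  ultimately have ude: "u = d \<or> u = e" using u U by auto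
  obtain y where y: "triangle a c y" "y \<noteq> p" "y \<noteq> a" "y \<noteq> c"
    using triangle_across[OF triangle_rotate[OF ca]] by metis
  have "y \<noteq> w" using triangle_in_link[OF y(1)] cw link_sym by blast
  moreover have "y \<noteq> b" using abc y(1) by (auto simp: triangle_def insert_commute)
  ultimately have yde: "y = d \<or> y = e" using y U by auto
  have covc_e: "covered (halfplane (v c))" if "k = -1" "e \<in> link F c"
    using edge_covered[of c e 1 "m - h"] n n' that by (simp add: c e link_def algebra_simps)
  have covc_d: "covered (halfplane (v c))" if "g = -1" "d \<in> link F c"
    using edge_covered[of c d 1 "l - h"] n n' that by (simp add: c d link_def algebra_simps)
  show ?thesis
  proof (cases "g = 0")
    case True
    have ad: "d \<notin> link F a" using vertical_edge[of 1 a 1 d l] n by (simp add: d True)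
    then have ace: "triangle a c e" using yde y(1) triangle_in_link[OF y(1)] link_sym by blast
    have E1: "m = h - 1" using triangle_vol[OF ace] by (simp add: e c vol_linear V algebra_simps)
    note ce = triangle_in_link(4)[OF ace]
    from ude show ?thesis
    proof
      assume "u = e"
      then have "h * (k + 1) = 0" using triangle_vol[OF u(1)] E1 by (simp add: e c vol_linear V algebra_simps)
      then consider "h = 0" | "k = -1" by auto
      then show ?thesis using zero triple covc_e ce c by cases auto
    next
      assume "u = d"
      then have cbd: "triangle c b d" using u(1) by simp
      have E2: "l = h - 1" using triangle_vol[OF cbd] by (simp add: d c True vol_linear V algebra_simps)
      have "triangle d c b" using cbd triangle_rotate by blast
      then obtain z where z: "triangle c d z" "z \<noteq> b" "z \<noteq> c" "z \<noteq> d" using triangle_across by metis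
      have "z \<noteq> p" "z \<noteq> w" "z \<noteq> a" using triangle_in_link[OF z(1)] cw dp ad link_sym by blast+
      then have "z = e" using z U by auto
      \<comment> \<open>The equation of the forced triangle \<open>c d e\<close> factors: one factor
        puts \<open>e\<close> into the half-plane of \<open>c\<close>, the other makes
        \<open>v d\<close> the negative of \<open>v a\<close>.\<close>
      moreover have "(h - 1) * (k + 1) = 1 - vol (v c) (v d) (v e)"
        by (simp add: E1 E2 d e c True vol_linear V algebra_simps)
      ultimately have "(h - 1) * (k + 1) = 0" using triangle_vol[OF z(1)] by simp
      then consider "h = 1" | "k = -1" by auto
      then show ?thesis
      proof cases
        case 1
        \<comment> \<open>All five remaining vertices are neighbours of \<open>a\<close>, so for
          this new pair the links are nested.\<close>
        interpret A: opposite_pair F v a d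
          by unfold_locales (simp_all add: card_seven d True E2 1)
        interpret D: opposite_pair F v d a by (rule A.swap)
        have "link F d \<subseteq> {p, w, b, c, e}" using D.link_p U by auto
        also have "\<dots> \<subseteq> link F a"
          using triangle_in_link[OF ab] triangle_in_link[OF ae] triangle_in_link[OF ace] by blast
        finally show ?thesis by (rule A.link_subset_certificate)
      qed (use triple covc_e ce in auto)
    qed
  next
    \<comment> \<open>The mirror image of the case above, with \<open>a\<close> and
      \<open>b\<close>, \<open>d\<close> and \<open>e\<close>, \<open>k\<close> and \<open>g\<close>
      exchanged.\<close>
    case False
    then have k: "k = 0" using kg by simp
    have be: "e \<notin> link F b" using vertical_edge[of 1 b 1 e m] n by (simp add: e k)
    then have cbd: "triangle c b d" using ude u(1) triangle_in_link[OF u(1)] by blast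
    have E1: "l = h - 1" using triangle_vol[OF cbd] by (simp add: d c vol_linear V algebra_simps)
    note cd = triangle_in_link(2)[OF cbd]
    from yde show ?thesis
    proof
      assume "y = d"
      then have "h * (g + 1) = 0" using triangle_vol[OF y(1)] E1 by (simp add: d c vol_linear V algebra_simps)
      then consider "h = 0" | "g = -1" by auto
      then show ?thesis using zero triple covc_d cd c by cases auto
    next
      assume "y = e"
      then have ace: "triangle a c e" using y(1) by simp
      have E2: "m = h - 1" using triangle_vol[OF ace] by (simp add: e c vol_linear V algebra_simps)
      have "triangle d c b" using cbd triangle_rotate by blast
      then obtain z where z: "triangle c d z" "z \<noteq> b" "z \<noteq> c" "z \<noteq> d" using triangle_across by metis
      have "z \<noteq> p" "z \<noteq> w" using triangle_in_link[OF z(1)] cw dp link_sym by blast+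
      moreover have "z \<noteq> a"
      proof
        assume "z = a"
        then have "triangle a c d" using z(1) triangle_rotate by blast
        then show False using triangle_unique[OF ace] n' by blast
      qed
      ultimately have "z = e" using z U by auto
      moreover have "(h - 1) * (g + 1) = 1 - vol (v c) (v d) (v e)"
        by (simp add: E1 E2 d e c k vol_linear V algebra_simps)
      ultimately have "(h - 1) * (g + 1) = 0" using triangle_vol[OF z(1)] by simp
      then consider "h = 1" | "g = -1" by auto
      then show ?thesis
      proof cases
        case 1
        interpret B: opposite_pair F v b e
          by unfold_locales (simp_all add: card_seven e k E2 1)
        interpret E: opposite_pair F v e b by (rule B.swap)
        have "link F e \<subseteq> {p, w, a, c, d}" using E.link_p U by auto
        also have "\<dots> \<subseteq> link F b"
          using triangle_in_link[OF ab] triangle_in_link[OF ba] triangle_in_link[OF cbd] by blast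
        finally show ?thesis by (rule B.link_subset_certificate)
      qed (use triple covc_d cd in auto)
    qed
  qed
qed

text \<open>The half-planes of \<open>a\<close>, \<open>b\<close>, \<open>d\<close> are good because
  these vertices lie in both links. The sign of \<open>k\<close> decides whether two of them are
  opposite, whether all three positively span, or whether a gap opposite to \<open>a\<close> is
  left. In the last case the half-plane of \<open>c\<close> fills the gap.\<close>

lemma cycles_four_four:
  assumes ab: "triangle p a b" and bc: "triangle p b c" and cd: "triangle p c d" and da: "triangle p d a"
    and ax: "triangle w a x" and xy: "triangle w x y" and yz: "triangle w y z" and za: "triangle w z a"
    and S: "{b, d, e} = {x, y, z}" "x \<noteq> z"
    and U: "UNIV = {p, w, a, b, c, d, e}" and cw: "c \<notin> link F w"
  shows "\<exists>P M. nef_certificate F v P M"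
proof -
  note V = triangle_vols[OF ab] and n = triangle_link[OF ab] triangle_link[OF bc] triangle_link[OF cd]
  note n' = triangle_w_link[OF ax] triangle_w_link[OF xy] triangle_w_link[OF yz]
  have lw: "a \<in> link F w" "b \<in> link F w" "d \<in> link F w" "e \<in> link F w"
    using n' S by (auto simp: set_eq_iff)
  have cov: "covered (halfplane (v a))" "covered (halfplane (v b))" "covered (halfplane (v d))"
    using common_covered n lw by blast+
  obtain x0 m h where c0: "v c = x0 *\<^sub>R v a + m *\<^sub>R v b + h *\<^sub>R v p" using coordinates[OF ab] by blast
  have "x0 = -1" using triangle_vol[OF bc] by (simp add: c0 vol_linear V)
  then have c: "v c = - v a + m *\<^sub>R v b + h *\<^sub>R v p" using c0 by simp
  obtain k y0 g where d0: "v d = k *\<^sub>R v a + y0 *\<^sub>R v b + g *\<^sub>R v p" using coordinates[OF ab] by blast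
  have "y0 = -1" using triangle_vol[OF da] by (simp add: d0 vol_linear V)
  then have d: "v d = k *\<^sub>R v a - v b + g *\<^sub>R v p" using d0 by simp
  have mk: "m * k = 0" using triangle_vol[OF cd] by (simp add: c d vol_linear V algebra_simps)
  consider "k = 0" | "k < 0" | "0 < k" "m = 0" using mk by (metis linorder_neqE_linordered_idom mult_eq_0_iff)
  then show ?thesis
  proof cases
    case 1
    then have "v d = (- 1) *\<^sub>R v b + g *\<^sub>R v p" by (simp add: d)
    then show ?thesis using opposite_certificate[of b d 1 g c] bc cov by simp
  next
    case 2
    then show ?thesis using triple_certificate[of b d a] cov by (simp add: d vol_linear V)
  next
    case 3
    obtain r s t where e0: "v e = r *\<^sub>R v a + s *\<^sub>R v b + t *\<^sub>R v p" using coordinates[OF ab] by blast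
    \<comment> \<open>The cycle of \<open>w\<close> runs in the reverse direction, so the
      determinants exclude every order of \<open>b\<close>, \<open>d\<close>, \<open>e\<close>
      except \<open>d\<close>, \<open>e\<close>, \<open>b\<close>.\<close>
    have "x \<noteq> b" using triangle_vol[OF ax] by (auto simp: opposite vol_linear V)
    moreover have "z \<noteq> d" using triangle_vol[OF za] by (auto simp: d opposite vol_linear V)
    moreover have "\<not> (y = b \<and> x = d)" using triangle_vol[OF xy] 3 by (auto simp: d opposite vol_linear V)
    moreover have "\<not> (z = b \<and> y = d)" using triangle_vol[OF yz] 3 by (auto simp: d opposite vol_linear V)
    moreover have "x \<noteq> y" "y \<noteq> z" "x \<noteq> z" using n' S(2) by blast+
    moreover have "x \<in> {b, d, e}" "y \<in> {b, d, e}" "z \<in> {b, d, e}" "b \<in> {x, y, z}" using S by blast+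
    ultimately have "x = d" "y = e" "z = b" by auto
    then have de: "triangle w d e" and eb: "triangle w e b" using xy yz by simp_all
    have "r = -1" using triangle_vol[OF eb] by (simp add: e0 opposite vol_linear V)
    moreover from this have "s = 0" using triangle_vol[OF de] 3 by (simp add: e0 d opposite vol_linear V)
    ultimately have e: "v e = - v a + t *\<^sub>R v p" using e0 by simp
    have ac: "c \<notin> link F a" using vertical_edge[of 1 a 1 c h] n by (simp add: c 3)
    have bd: "d \<notin> link F b"
    proof
      assume "d \<in> link F b"
      then have F: "{b, d, d} \<in> F" by (simp add: link_def)
      \<comment> \<open>\<open>v b + v d\<close> already lies in the cone of \<open>a\<close> with
        \<open>p\<close> or with \<open>w\<close>, depending on the sign of \<open>g\<close>, so
        \<open>b\<close> and \<open>d\<close> cannot span a second cone through it.\<close>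
      have eq: "1 *\<^sub>R v b + 1 *\<^sub>R v d + 0 *\<^sub>R v d = k *\<^sub>R v a + g *\<^sub>R v p + 0 *\<^sub>R v p" by (simp add: d)
      show False
      proof (cases "0 \<le> g")
        case True
        have "comb3 1 b 1 d 0 d = comb3 k a g p 0 p"
          using F eq True 3 triangle_face[OF ab] by (intro rep_comb3_unique) auto
        then have "comb3 1 b 1 d 0 d b = comb3 k a g p 0 p b" by simp
        then show False using n by (auto simp: comb3_def split: if_splits)
      next
        case False
        have "comb3 1 b 1 d 0 d = comb3 k a (-g) w 0 w"
          using F eq False 3 triangle_face[OF ax] by (intro rep_comb3_unique) (auto simp: opposite insert_commute)
        then have "comb3 1 b 1 d 0 d b = comb3 k a (-g) w 0 w b" by simp
        then show False using n by (auto simp: comb3_def split: if_splits)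
      qed
    qed
    obtain u where u: "triangle c b u" "u \<noteq> p" "u \<noteq> b" "u \<noteq> c"
      using triangle_across[OF triangle_rotate[OF bc]] by metis
    have "u \<noteq> w" "u \<noteq> a" "u \<noteq> d" using triangle_in_link[OF u(1)] cw ac bd link_sym by blast+
    then have "triangle c b e" using u U by auto
    then have "{c, e} \<in> F" using triangle_face by auto
    moreover have "v e = 1 *\<^sub>R v c + (t - h) *\<^sub>R v p" by (simp add: c e 3 algebra_simps)
    ultimately have "covered (halfplane (v c))" using edge_covered[of c e 1 "t - h"] n lw by simp
    moreover have "v c = (- 1) *\<^sub>R v a + h *\<^sub>R v p" by (simp add: c 3)
    ultimately show ?thesis using opposite_certificate[of a c 1 h b] ab cov by simp
  qed
qed

end

section \<open>Sorting the cases by counting vertices\<close>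

context opposite_pair
begin

lemma four_others:
  assumes "c \<noteq> p" "c \<noteq> w"
  shows "card (UNIV - {p, w, c}) = 4"
  using card_seven p_neq_w assms by (simp add: card_Diff_subset)

lemma seventh:
  assumes "card S = 6"
  shows "\<exists>e. UNIV = insert e (S :: 'k set)"
proof -
  have "card (UNIV - S) = 1" using assms card_seven by (simp add: card_Diff_subset)
  then obtain e where "UNIV - S = {e}" by (auto simp: card_1_singleton_iff)
  then show ?thesis by blast
qed

text \<open>As \<open>c\<close> is missing, the link of \<open>w\<close> lies in a set of four
  vertices, so it is a cycle of length three or all of that set. The position of \<open>a\<close>
  and \<open>b\<close> in it selects one of the configurations above.\<close>

lemma three_cycle_certificate:
  assumes ab: "triangle p a b" and bc: "triangle p b c" and ca: "triangle p c a"
    and L: "link F p = {a, b, c}" and cw: "c \<notin> link F w"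
  shows "\<exists>P M. nef_certificate F v P M"
proof -
  interpret W: opposite_pair F v w p by (rule swap)
  note n = triangle_link[OF ab] triangle_link[OF bc] triangle_link[OF ca]
  have sub: "link F w \<subseteq> UNIV - {p, w, c}" using W.link_p cw by auto
  have all: "link F w = UNIV - {p, w, c}" if "4 \<le> card (link F w)"
    using four_others[of c] n that by (intro card_seteq[OF _ sub]) auto
  have not_five: "link F w \<noteq> UNIV - {w, p}" using cw n by auto
  consider "a \<in> link F w" | "a \<notin> link F w" "b \<in> link F w" | "a \<notin> link F w" "b \<notin> link F w" by blast
  then show ?thesis
  proof cases
    case 1
    obtain x where x: "triangle w a x" using W.link_next 1 by blast
    \<comment> \<open>With \<open>x = b\<close> the determinant would be -1, because
      \<open>w\<close> reverses orientations.\<close>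
    have xb: "x \<noteq> b" using triangle_vol[OF x] triangle_vol[OF ab] by (auto simp: opposite vol_linear)
    from x show ?thesis
    proof (cases rule: W.link_cycle)
      case (three y)
      note n' = triangle_w_link[OF x] triangle_w_link[OF three(1)] triangle_w_link[OF three(2)]
      show ?thesis
      proof (cases "b \<in> link F w")
        case True
        then have y: "y = b" using three(3) xb n by auto
        have "c \<noteq> x" using n' cw by blast
        then have "card {p, w, a, b, c, x} = 6" using n n' p_neq_w xb by auto
        then obtain e where "UNIV = insert e {p, w, a, b, c, x}" using seventh by blast
        then have "UNIV = {p, w, a, b, c, x, e}" by auto
        moreover have "x \<notin> link F p" using L n' cw xb by auto
        ultimately show ?thesis using cycles_sharing_edge[OF ab bc ca _ x] three y cw by blast
      next
        case False
        have "c \<noteq> x" "c \<noteq> y" "b \<noteq> x" "b \<noteq> y" using n' cw False by blast+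
        then have "card {p, w, a, b, c, x, y} = 7" using n n' p_neq_w by auto
        then have "UNIV = {p, w, a, b, c, x, y}" using card_seven by (metis card_subset_eq finite subset_UNIV)
        moreover have "x \<notin> link F p" "y \<notin> link F p" using L n' cw False by auto
        ultimately show ?thesis using cycles_sharing_vertex[OF ab bc ca x three(1,2)] False cw by blast
      qed
    next
      case (four y z)
      note n' = triangle_w_link[OF x] triangle_w_link[OF four(1)] triangle_w_link[OF four(2)] triangle_w_link[OF four(3)]
      have "card (link F w) = 4" using four n' by auto
      then have lw: "link F w = UNIV - {p, w, c}" using all by simp
      have "b \<in> link F w" unfolding lw using n by auto
      then consider "b = y" | "b = z" using four(6) xb n by auto
      then show ?thesis
      proof cases
        case 1
        have "UNIV = {p, w, a, b, c, x, z}" using lw four(6) 1 by auto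
        then show ?thesis using cycles_three_four_nonadjacent[OF ab bc ca x] four 1 cw by blast
      next
        case 2
        have "UNIV = {p, w, a, b, c, y, x}" using lw four(6) 2 by auto
        moreover have "y \<notin> link F p" using L n' cw 2 four by auto
        ultimately show ?thesis using cycles_three_four_adjacent[OF ab bc ca _ x] four 2 cw by blast
      qed
    next
      case five
      then show ?thesis using not_five by simp
    qed
  next
    case 2
    obtain x where x: "triangle w b x" using W.link_next 2 by blast
    from x show ?thesis
    proof (cases rule: W.link_cycle)
      case (three y)
      note n' = triangle_w_link[OF x] triangle_w_link[OF three(1)] triangle_w_link[OF three(2)]
      have "c \<noteq> x" "c \<noteq> y" "a \<noteq> x" "a \<noteq> y" using n' cw 2 by blast+
      then have "card {p, w, b, c, a, x, y} = 7" using n n' p_neq_w by auto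
      then have "UNIV = {p, w, b, c, a, x, y}" using card_seven by (metis card_subset_eq finite subset_UNIV)
      moreover have "x \<notin> link F p" "y \<notin> link F p" using L n' cw 2 by auto
      ultimately show ?thesis using cycles_sharing_vertex[OF bc ca ab x three(1,2)] 2 cw by blast
    next
      case (four y z)
      note n' = triangle_w_link[OF x] triangle_w_link[OF four(1)] triangle_w_link[OF four(2)] triangle_w_link[OF four(3)]
      have "card (link F w) = 4" using four n' by auto
      then show ?thesis using all 2 n by auto
    next
      case five
      then show ?thesis using not_five by simp
    qed
  next
    case 3
    obtain x x' where x: "triangle w x x'" using mod_cover[of w 0] by blast
    from x have False
    proof (cases rule: W.link_cycle)
      case (three y)
      note n' = triangle_w_link[OF x] triangle_w_link[OF three(1)] triangle_w_link[OF three(2)]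
      \<comment> \<open>Two disjoint links of three vertices would, together with \<open>p\<close>
        and \<open>w\<close>, need eight vertices.\<close>
      have "{a, b, c} \<inter> {x, x', y} = {}" using n' cw 3 by blast
      then have "card {p, w, a, b, c, x, x', y} = 8" using n n' p_neq_w by auto
      then show False using card_seven card_mono[of UNIV "{p, w, a, b, c, x, x', y}"] by simp
    next
      case (four y z)
      note n' = triangle_w_link[OF x] triangle_w_link[OF four(1)] triangle_w_link[OF four(2)] triangle_w_link[OF four(3)]
      have "card (link F w) = 4" using four n' by auto
      then show ?thesis using all 3 n by auto
    next
      case five
      then show ?thesis using not_five by simp
    qed
    then show ?thesis ..
  qed
qed

text \<open>Without nesting, each link misses a vertex of the other and so has at most four
  vertices. A cycle of length three on either side is settled by
  \<open>three_cycle_certificate\<close>, for the swapped pair if necessary; otherwise both have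
  length four.\<close>

lemma certificate_exists: "\<exists>P M. nef_certificate F v P M"
proof (cases "link F w \<subseteq> link F p \<or> link F p \<subseteq> link F w")
  case True
  interpret W: opposite_pair F v w p by (rule swap)
  show ?thesis using True link_subset_certificate W.link_subset_certificate by blast
next
  case False
  interpret W: opposite_pair F v w p by (rule swap)
  obtain c e where c: "c \<in> link F p" "c \<notin> link F w" and e: "e \<in> link F w" "e \<notin> link F p"
    using False by blast
  obtain d where cd: "triangle p c d" using link_next c by blast
  obtain f where ef: "triangle w e f" using W.link_next e by blast
  from cd show ?thesis
  proof (cases rule: link_cycle)
    case (three a)
    then show ?thesis using three_cycle_certificate[of d a c] cd c by (auto simp: insert_commute)
  next
    case (four a b)
    from ef show ?thesis
    proof (cases rule: W.link_cycle)
      case (three x)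
      then show ?thesis using W.three_cycle_certificate[of f x e] ef e by (auto simp: insert_commute)
    next
      case (four x y)
      note n = triangle_link[OF cd] triangle_link[OF \<open>triangle p d a\<close>] triangle_link[OF \<open>triangle p a b\<close>] triangle_link[OF \<open>triangle p b c\<close>]
      note n' = triangle_w_link[OF ef] triangle_w_link[OF four(1)] triangle_w_link[OF four(2)] triangle_w_link[OF four(3)]
      have card_w: "card (link F w) = 4" using four n' by auto
      have sub: "link F w \<subseteq> UNIV - {p, w, c}" using W.link_p c by auto
      have lw: "link F w = UNIV - {p, w, c}"
        using four_others[of c] n card_w by (intro card_seteq[OF _ sub]) auto
      have "e \<notin> {a, b, c, d}" using n e by blast
      then have "card {p, w, a, b, c, d, e} = 7"
        using n n' p_neq_w \<open>c \<noteq> a\<close> \<open>d \<noteq> b\<close> by auto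
      then have U: "UNIV = {p, w, a, b, c, d, e}" using card_seven by (metis card_subset_eq finite subset_UNIV)
      \<comment> \<open>\<open>a\<close> is opposite to \<open>c\<close> in the cycle of
        \<open>p\<close>. The cycle of \<open>w\<close> is traversed again from this vertex, to
        match \<open>cycles_four_four\<close>.\<close>
      have "a \<in> link F w" unfolding lw using n \<open>c \<noteq> a\<close> by auto
      then obtain x where x: "triangle w a x" using W.link_next by blast
      from x show ?thesis
      proof (cases rule: W.link_cycle)
        case (three y)
        have "card (link F w) \<le> 3" unfolding three(3) by (simp add: card_insert_if)
        then show ?thesis using card_w by simp
      next
        case w4: (four y z)
        note m = triangle_w_link[OF x] triangle_w_link[OF w4(1)] triangle_w_link[OF w4(2)] triangle_w_link[OF w4(3)]
        have "{a, x, y, z} = {a, b, d, e}"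
          using lw U n n' c e \<open>c \<noteq> a\<close> unfolding w4(6)[symmetric] by auto
        moreover have "a \<notin> {x, y, z}" "a \<notin> {b, d, e}" using m w4 n e by auto
        ultimately have "{b, d, e} = {x, y, z}" by (simp add: insert_ident)
        then show ?thesis
          using cycles_four_four[of a b c d x y z e] \<open>triangle p d a\<close> \<open>triangle p a b\<close> \<open>triangle p b c\<close> cd x w4 U c by blast
      next
        case five
        then show ?thesis using c n lw by auto
      qed
    next
      case five
      then show ?thesis using c triangle_link[OF cd] by auto
    qed
  next
    case five
    then show ?thesis using e triangle_w_link[OF ef] by auto
  qed
qed

end

section \<open>Zero-sum primitive collections\<close>

context unimodular_fan3
begin

lemma empty_face: "{} \<in> F"
  using face_subset face_single by blast

text \<open>The support extends to a unimodular triple, and up to sign the coefficient is a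
  determinant of lattice vectors.\<close>

lemma rep_coeff_Ints:
  assumes c: "nonneg_rep F v c q" and q: "q \<in> lattice_points"
  shows "c j \<in> \<int>"
proof (cases "c j = 0")
  case False
  have S: "{j. c j \<noteq> 0} \<in> F" using c by (simp add: nonneg_rep_def)
  then obtain y z where yz: "{i. c i \<noteq> 0} \<subseteq> {j, y, z}" "\<bar>vol (v j) (v y) (v z)\<bar> = 1"
    using face_max1[OF S, of j] False by blast
  then have "j \<noteq> y" "y \<noteq> z" "j \<noteq> z" by auto
  then have "q = c j *\<^sub>R v j + c y *\<^sub>R v y + c z *\<^sub>R v z" using c yz(1) by (intro rep_expand)
  then have "vol q (v y) (v z) = c j * vol (v j) (v y) (v z)" by (simp add: vol_linear)
  then have "c j = vol q (v y) (v z) \<or> c j = - vol q (v y) (v z)" using yz(2) by (auto simp: abs_if split: if_splits)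
  moreover have "vol q (v y) (v z) \<in> \<int>" using vol_in_Ints q lattice by blast
  ultimately show ?thesis by auto
qed simp

text \<open>Batyrev's argument: in a nonzero nonnegative integral relation of least degree with respect to an
  ample divisor, the sum over a primitive collection can be replaced by its expression in a cone,
  which lowers the degree. Minimality forces the relation to be that collection, summing to zero.\<close>

lemma zero_sum_collection:
  fixes a :: "'k \<Rightarrow> int"
  assumes ample: "\<And>S. S \<in> F \<Longrightarrow> \<exists>R m. R \<in> F \<and> S \<subseteq> R \<and> (\<forall>j\<in>R. m \<bullet> v j = - of_int (a j)) \<and>
      (\<forall>j. j \<notin> R \<longrightarrow> - of_int (a j) < m \<bullet> v j)"
  shows "\<exists>P. P \<notin> F \<and> (\<forall>Q. Q \<subset> P \<longrightarrow> Q \<in> F) \<and> (\<Sum>j\<in>P. v j) = 0"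
proof -
  define rel :: "('k \<Rightarrow> int) \<Rightarrow> bool" where
    "rel c \<longleftrightarrow> (\<forall>j. 0 \<le> c j) \<and> (\<Sum>j\<in>UNIV. of_int (c j) *\<^sub>R v j) = 0 \<and> c \<noteq> (\<lambda>_. 0)" for c
  \<comment> \<open>The intersection number of the curve class given by the relation with the
    divisor \<open>a\<close>.\<close>
  define deg where "deg c = (\<Sum>j\<in>UNIV. c j * a j)" for c
  have deg_nonneg: "0 \<le> deg c" if "rel c" for c
  proof -
    obtain R m where m: "\<And>j. j \<in> R \<Longrightarrow> m \<bullet> v j = - of_int (a j)" "\<And>j. j \<notin> R \<Longrightarrow> - of_int (a j) < m \<bullet> v j"
      using ample[OF empty_face] by blast
    have "0 \<le> of_int (a j) + m \<bullet> v j" for j using m[of j] by (cases "j \<in> R") auto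
    then have "0 \<le> (\<Sum>j\<in>UNIV. of_int (c j) * (of_int (a j) + m \<bullet> v j))"
      using that by (intro sum_nonneg mult_nonneg_nonneg) (auto simp: rel_def)
    also have "\<dots> = of_int (deg c) + m \<bullet> (\<Sum>j\<in>UNIV. of_int (c j) *\<^sub>R v j)"
      by (simp add: deg_def distrib_left sum.distrib inner_sum_right)
    also have "\<dots> = of_int (deg c)" using that by (simp add: rel_def)
    finally show ?thesis by simp
  qed
  have "\<exists>c. rel c"
  proof -
    fix i :: 'k
    \<comment> \<open>A relation exists by completeness: add \<open>v i\<close> to the
      representation of its negative.\<close>
    obtain d where d: "nonneg_rep F v d (- v i)" using rep_exists by blast
    have "- v i \<in> lattice_points" using lattice[of i] by (simp add: lattice_points_def)
    then have "\<exists>n. d j = of_int n" for j using rep_coeff_Ints[OF d, of j] by (auto elim: Ints_cases)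
    then obtain d' where d': "\<And>j. d j = of_int (d' j)" by metis
    have nn: "0 \<le> d' j" for j
  proof -
    have "0 \<le> d j" using d by (simp add: nonneg_rep_def)
    then show ?thesis by (simp add: d')
  qed
    let ?c = "\<lambda>j. d' j + (if j = i then 1 else 0)"
    have "(\<Sum>j\<in>UNIV. of_int (?c j) *\<^sub>R v j) = (\<Sum>j\<in>UNIV. d j *\<^sub>R v j) + v i"
      by (simp add: d' scaleR_add_left sum.distrib if_distrib[of "\<lambda>r. r *\<^sub>R _"] if_distrib[of real_of_int] cong: if_cong)
    also have "(\<Sum>j\<in>UNIV. d j *\<^sub>R v j) = - v i" using d by (simp add: nonneg_rep_def)
    also have "- v i + v i = 0" by simp
    finally have "(\<Sum>j\<in>UNIV. of_int (?c j) *\<^sub>R v j) = 0" .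
    moreover have "?c \<noteq> (\<lambda>_. 0)" using nn[of i] by (auto simp: fun_eq_iff intro!: exI[of _ i])
    ultimately have "rel ?c" using nn by (auto simp: rel_def)
    then show ?thesis by blast
  qed
  then obtain c where c: "rel c" "\<And>c'. rel c' \<Longrightarrow> nat (deg c) \<le> nat (deg c')"
    using ex_has_least_nat[of rel _ "\<lambda>c. nat (deg c)"] by blast
  have supp: "{j. c j \<noteq> 0} \<notin> F"
  proof
    assume "{j. c j \<noteq> 0} \<in> F"
    then have "nonneg_rep F v (\<lambda>j. of_int (c j)) 0" using c(1) by (simp add: nonneg_rep_def rel_def)
    moreover have "nonneg_rep F v (\<lambda>j. 0) 0" using empty_face by (simp add: nonneg_rep_def)
    ultimately have "(\<lambda>j. real_of_int (c j)) = (\<lambda>j. 0)" by (rule rep_unique)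
    then show False using c(1) by (auto simp: rel_def fun_eq_iff)
  qed
  \<comment> \<open>A minimal non-face inside the support is a primitive collection. There is one
    because a relation supported on a face vanishes.\<close>
  define N where "N = {Q. Q \<subseteq> {j. c j \<noteq> 0} \<and> Q \<notin> F}"
  have "finite N" "N \<noteq> {}" using supp by (auto simp: N_def)
  then obtain P where P: "P \<in> N" "\<And>Q. Q \<in> N \<Longrightarrow> Q \<subseteq> P \<Longrightarrow> P = Q"
    using finite_has_minimal[of N] by blast
  have PF: "P \<notin> F" and Psub: "P \<subseteq> {j. c j \<noteq> 0}" using P by (auto simp: N_def)
  have proper: "Q \<in> F" if "Q \<subset> P" for Q
    using P(2)[of Q] that Psub by (auto simp: N_def)
  obtain d where d: "nonneg_rep F v d (\<Sum>j\<in>P. v j)" using rep_exists by blast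
  have "(\<Sum>j\<in>P. v j) \<in> lattice_points"
    using lattice by (auto simp: lattice_points_def intro!: Ints_sum)
  then have "\<exists>n. d j = of_int n" for j using rep_coeff_Ints[OF d, of j] by (auto elim: Ints_cases)
  then obtain d' where d': "\<And>j. d j = of_int (d' j)" by metis
  have nn: "0 \<le> d' j" for j
  proof -
    have "0 \<le> d j" using d by (simp add: nonneg_rep_def)
    then show ?thesis by (simp add: d')
  qed
  have eq: "(\<Sum>j\<in>P. v j) = (\<Sum>j\<in>UNIV. d j *\<^sub>R v j)" using d by (simp add: nonneg_rep_def)
  define c' where "c' j = c j - (if j \<in> P then 1 else 0) + d' j" for j
  have "1 \<le> c j" if "j \<in> P" for j
  proof -
    have "c j \<noteq> 0" "0 \<le> c j" using that Psub c(1) by (auto simp: rel_def)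
    then show ?thesis by linarith
  qed
  then have ge: "0 \<le> c j - (if j \<in> P then 1 else 0)" for j using c(1) by (auto simp: rel_def)
  have "(\<Sum>j\<in>UNIV. of_int (c' j) *\<^sub>R v j) = (\<Sum>j\<in>UNIV. of_int (c j) *\<^sub>R v j) - (\<Sum>j\<in>P. v j) + (\<Sum>j\<in>UNIV. d j *\<^sub>R v j)"
    by (simp add: c'_def d' scaleR_add_left scaleR_diff_left sum.distrib sum_subtractf if_distrib[of "\<lambda>r. r *\<^sub>R _"]
        if_distrib[of real_of_int] sum.If_cases cong: if_cong)
  also have "\<dots> = 0" using c(1) eq by (simp add: rel_def)
  finally have zero: "(\<Sum>j\<in>UNIV. of_int (c' j) *\<^sub>R v j) = 0" .
  have "deg c' < deg c"
  proof -
    obtain R m where R: "R \<in> F" "{j. d j \<noteq> 0} \<subseteq> R" and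
      m: "\<And>j. j \<in> R \<Longrightarrow> m \<bullet> v j = - of_int (a j)" "\<And>j. j \<notin> R \<Longrightarrow> - of_int (a j) < m \<bullet> v j"
      using ample[of "{j. d j \<noteq> 0}"] d unfolding nonneg_rep_def by blast
    \<comment> \<open>This vertex makes the descent strict: the non-face \<open>P\<close> is not
      contained in \<open>R\<close>, and outside \<open>R\<close> the convexity inequality is
      strict.\<close>
    obtain i where i: "i \<in> P" "i \<notin> R" using PF R(1) face_subset by blast
    have "0 < (\<Sum>j\<in>P. of_int (a j) + m \<bullet> v j)"
    proof (rule sum_pos2[OF _ i(1)])
      show "0 < of_int (a i) + m \<bullet> v i" using m(2)[OF i(2)] by simp
      show "0 \<le> of_int (a j) + m \<bullet> v j" for j using m[of j] by (cases "j \<in> R") auto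
    qed simp
    also have "\<dots> = of_int (\<Sum>j\<in>P. a j) + m \<bullet> (\<Sum>j\<in>P. v j)" by (simp add: sum.distrib inner_sum_right)
    also have "m \<bullet> (\<Sum>j\<in>P. v j) = (\<Sum>j\<in>UNIV. d j * (m \<bullet> v j))" unfolding eq by (simp add: inner_sum_right)
    also have "\<dots> = (\<Sum>j\<in>UNIV. - (d j * of_int (a j)))"
    proof (rule sum.cong[OF refl])
      fix j show "d j * (m \<bullet> v j) = - (d j * of_int (a j))" using R(2) m(1)[of j] by (cases "d j = 0") auto
    qed
    also have "\<dots> = - of_int (\<Sum>j\<in>UNIV. d' j * a j)" by (simp add: d' sum_negf)
    finally have "(\<Sum>j\<in>UNIV. d' j * a j) < (\<Sum>j\<in>P. a j)" by linarith
    moreover have "deg c' = deg c - (\<Sum>j\<in>P. a j) + (\<Sum>j\<in>UNIV. d' j * a j)"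
      by (simp add: deg_def c'_def algebra_simps sum.distrib sum_subtractf if_distrib[of "\<lambda>r. r * _"] if_distrib[of "\<lambda>r. _ * r"] sum.If_cases cong: if_cong)
    ultimately show ?thesis by linarith
  qed
  then have "\<not> rel c'" using c(2)[of c'] deg_nonneg[of c'] by auto
  \<comment> \<open>Only the zero relation can have smaller degree. As a sum of two nonnegative
    parts it vanishes termwise, so \<open>c\<close> is the indicator of \<open>P\<close> and
    \<open>d\<close> is zero.\<close>
  then have "c' = (\<lambda>_. 0)" using zero ge nn by (force simp: rel_def c'_def)
  then have "c j - (if j \<in> P then 1 else 0) + d' j = 0" for j by (metis c'_def)
  then have "d' j = 0" for j using ge[of j] nn[of j] by (smt (verit))
  then have "(\<Sum>j\<in>P. v j) = 0" unfolding eq by (simp add: d')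
  then show ?thesis using PF proper by blast
qed

text \<open>Removing one member of \<open>P\<close> leaves a face, so \<open>P\<close> has at most
  four members. Four vectors with sum zero cover the space by their four cones and would be the only
  rays, as for projective space; seven rays exclude this.\<close>

lemma nef_certificate_of_zero_sum:
  assumes card7: "CARD('k) = 7" and P: "P \<notin> F" "\<And>Q. Q \<subset> P \<Longrightarrow> Q \<in> F" and zero: "(\<Sum>j\<in>P. v j) = 0"
  shows "\<exists>P M. nef_certificate F v P M"
proof -
  obtain x where x: "x \<in> P" using P(1) empty_face by (metis ex_in_conv)
  then have "P - {x} \<in> F" using P(2) by blast
  then obtain y z u where xyz: "P - {x} \<subseteq> {y, z, u}" using face_max by blast
  have "card (P - {x}) \<le> 3"
    using card_mono[OF _ xyz] by (rule order_trans) (simp_all add: card_insert_if)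
  then have "card P \<le> 4" using x by simp
  moreover have "card P \<noteq> 0" using x by auto
  moreover have "card P \<noteq> 1" using P(1) face_single by (auto simp: card_1_singleton_iff)
  ultimately consider "card P = 2" | "card P = 3" | "card P = 4" by linarith
  then show ?thesis
  proof cases
    case 1
    then obtain p w where pw: "P = {p, w}" "p \<noteq> w" by (meson card_2_iff)
    then have "v w = - v p" using zero by (simp add: eq_neg_iff_add_eq_0 add.commute)
    then interpret opposite_pair F v p w using card7 by unfold_locales
    show ?thesis by (rule certificate_exists)
  next
    case 2
    then obtain a b c where abc: "P = {a, b, c}" "a \<noteq> b" "b \<noteq> c" "a \<noteq> c" by (metis card_3_iff)
    have "{a, b} \<in> F" "{b, c} \<in> F" "{a, c} \<in> F" by (rule P(2); use abc in auto)+
    moreover have "v a + v b + v c = 0" using zero abc by (simp add: add.assoc)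
    ultimately show ?thesis using triple_zero_sum_certificate abc by blast
  next
    case 3
    then have "card (P - {x}) = 3" using x by simp
    then obtain a b c where abc: "P - {x} = {a, b, c}" "a \<noteq> b" "b \<noteq> c" "a \<noteq> c" by (metis card_3_iff)
    have Px: "P = {x, a, b, c}" "x \<notin> {a, b, c}" using abc(1) x by auto
    then have vx: "v x = - v a - v b - v c" using zero abc by (simp add: eq_neg_iff_add_eq_0 algebra_simps)
    have faces: "{a, b, c} \<in> F" "{x, b, c} \<in> F" "{a, x, c} \<in> F" "{a, b, x} \<in> F"
      by (rule P(2); use Px abc in auto)+
    obtain u where "{a, b, c} \<subseteq> {a, b, u}" "\<bar>vol (v a) (v b) (v u)\<bar> = 1"
      using face_max2[OF faces(1), of a b] abc by auto
    then have vol: "vol (v a) (v b) (v c) \<noteq> 0" using abc by auto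
    have "j \<in> P" for j
    proof -
      define e where "e = vol (v a) (v b) (v c)"
      define \<alpha> \<beta> \<gamma> where "\<alpha> = vol (v j) (v b) (v c) / e" and "\<beta> = vol (v a) (v j) (v c) / e"
        and "\<gamma> = vol (v a) (v b) (v j) / e"
      have "(1 / e) *\<^sub>R e *\<^sub>R v j = (1 / e) *\<^sub>R (vol (v j) (v b) (v c) *\<^sub>R v a + vol (v a) (v j) (v c) *\<^sub>R v b + vol (v a) (v b) (v j) *\<^sub>R v c)"
        unfolding e_def by (rule arg_cong[OF cramer])
      then have j: "v j = \<alpha> *\<^sub>R v a + \<beta> *\<^sub>R v b + \<gamma> *\<^sub>R v c"
        using vol by (simp add: e_def[symmetric] \<alpha>_def \<beta>_def \<gamma>_def scaleR_right_distrib)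
      have in_face: "j \<in> {y, z, t}" if "{y, z, t} \<in> F" "0 \<le> k" "0 \<le> l" "0 \<le> m" "v j = k *\<^sub>R v y + l *\<^sub>R v z + m *\<^sub>R v t"
        for y z t k l m
      proof -
        have "comb3 1 j 0 j 0 j = comb3 k y l z m t"
          using that by (intro rep_comb3_unique) (auto simp: face_single)
        then have "comb3 1 j 0 j 0 j j = comb3 k y l z m t j" by simp
        then show ?thesis by (auto simp: comb3_def split: if_splits)
      qed
      \<comment> \<open>As for triples: adding a multiple of the relation turns the smallest of the
        three coefficients and 0 into 0 and thereby selects the cone.\<close>
      consider "0 \<le> \<alpha>" "0 \<le> \<beta>" "0 \<le> \<gamma>" | "\<alpha> < 0" "\<alpha> \<le> \<beta>" "\<alpha> \<le> \<gamma>" | "\<beta> < 0" "\<beta> \<le> \<alpha>" "\<beta> \<le> \<gamma>"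
        | "\<gamma> < 0" "\<gamma> \<le> \<alpha>" "\<gamma> \<le> \<beta>" by linarith
      then have "j \<in> {a, b, c} \<or> j \<in> {x, b, c} \<or> j \<in> {a, x, c} \<or> j \<in> {a, b, x}"
      proof cases
        case 1 then show ?thesis using in_face[OF faces(1)] j by blast
      next
        case 2
        have "v j = (- \<alpha>) *\<^sub>R v x + (\<beta> - \<alpha>) *\<^sub>R v b + (\<gamma> - \<alpha>) *\<^sub>R v c" by (simp add: j vx algebra_simps)
        then show ?thesis using in_face[OF faces(2), of "-\<alpha>" "\<beta> - \<alpha>" "\<gamma> - \<alpha>"] 2 by simp
      next
        case 3
        have "v j = (\<alpha> - \<beta>) *\<^sub>R v a + (- \<beta>) *\<^sub>R v x + (\<gamma> - \<beta>) *\<^sub>R v c" by (simp add: j vx algebra_simps)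
        then show ?thesis using in_face[OF faces(3), of "\<alpha> - \<beta>" "- \<beta>" "\<gamma> - \<beta>"] 3 by simp
      next
        case 4
        have "v j = (\<alpha> - \<gamma>) *\<^sub>R v a + (\<beta> - \<gamma>) *\<^sub>R v b + (- \<gamma>) *\<^sub>R v x" by (simp add: j vx algebra_simps)
        then show ?thesis using in_face[OF faces(4), of "\<alpha> - \<gamma>" "\<beta> - \<gamma>" "- \<gamma>"] 4 by simp
      qed
      then show ?thesis using Px by auto
    qed
    then have "P = UNIV" by blast
    then show ?thesis using 3 card7 by simp
  qed
qed

end

section \<open>Smooth complete fans\<close>

lemma convex_cone_hull_finite:
  fixes S :: "'a::real_vector set"
  assumes "finite S"
  shows "convex_cone hull S = {\<Sum>s\<in>S. c s *\<^sub>R s |c. \<forall>s\<in>S. 0 \<le> c s}" (is "_ = ?H")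
proof (rule hull_unique)
  show "S \<subseteq> ?H"
  proof
    fix x assume "x \<in> S"
    then have "x = (\<Sum>s\<in>S. (if s = x then 1 else 0) *\<^sub>R s)" using assms by (simp add: if_distrib[of "\<lambda>r. r *\<^sub>R _"] cong: if_cong)
    then show "x \<in> ?H" by (intro CollectI exI[of _ "\<lambda>s. if s = x then 1 else 0"]) simp
  qed
  show "convex_cone ?H"
    unfolding convex_cone_iff
  proof (intro conjI ballI allI impI)
    show "0 \<in> ?H" by (intro CollectI exI[of _ "\<lambda>_. 0"]) simp
    fix x y assume "x \<in> ?H" "y \<in> ?H"
    then obtain c d where "\<forall>s\<in>S. 0 \<le> c s" "\<forall>s\<in>S. 0 \<le> d s" "x = (\<Sum>s\<in>S. c s *\<^sub>R s)" "y = (\<Sum>s\<in>S. d s *\<^sub>R s)" by blast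
    then show "x + y \<in> ?H"
      by (intro CollectI exI[of _ "\<lambda>s. c s + d s"]) (simp add: scaleR_add_left sum.distrib)
  next
    fix x and k :: real assume "x \<in> ?H" "0 \<le> k"
    then obtain c where "\<forall>s\<in>S. 0 \<le> c s" "x = (\<Sum>s\<in>S. c s *\<^sub>R s)" by blast
    with \<open>0 \<le> k\<close> show "k *\<^sub>R x \<in> ?H"
      by (intro CollectI exI[of _ "\<lambda>s. k * c s"]) (simp add: scaleR_sum_right)
  qed
  fix T assume T: "S \<subseteq> T" "convex_cone T"
  have "(\<Sum>s\<in>A. c s *\<^sub>R s) \<in> T" if "finite A" "A \<subseteq> S" "\<forall>s\<in>S. 0 \<le> c s" for A and c :: "'a \<Rightarrow> real"
    using that
  proof (induction A)
    case empty
    then show ?case using T by (simp add: convex_cone_contains_0)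
  next
    case (insert x A)
    then have "c x *\<^sub>R x \<in> T" using T by (intro convex_cone_scaleR) auto
    then show ?case using insert T by (auto intro: convex_cone_add)
  qed
  then show "?H \<subseteq> T" using assms by blast
qed

lemma convex_cone_hull_singleton: "convex_cone hull {x} = {t *\<^sub>R x |t. 0 \<le> t}"
proof -
  have "convex_cone hull {x} = {c x *\<^sub>R x |c. 0 \<le> c x}" by (simp add: convex_cone_hull_finite)
  also have "\<dots> = {t *\<^sub>R x |t. 0 \<le> t}" by (auto intro: exI[of _ "\<lambda>_. _"])
  finally show ?thesis .
qed

lemma independent_coeff_eq:
  assumes "independent S" "finite S" "(\<Sum>s\<in>S. c s *\<^sub>R s) = (\<Sum>s\<in>S. d s *\<^sub>R s)" "s \<in> S"
  shows "c s = d s"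
proof -
  have "(\<Sum>s\<in>S. (c s - d s) *\<^sub>R s) = 0" using assms(3) by (simp add: scaleR_diff_left sum_subtractf)
  then have "c s - d s = 0" using independentD[OF assms(1,2) subset_refl, of "\<lambda>s. c s - d s" s] assms(4) by simp
  then show ?thesis by simp
qed

lemma face_of_independent_generator:
  assumes S: "independent S" "finite S" and s: "s \<in> S"
  shows "(convex_cone hull {s}) face_of (convex_cone hull S)"
  unfolding face_of_def
proof (intro conjI ballI impI)
  show "convex_cone hull {s} \<subseteq> convex_cone hull S" using s by (simp add: hull_mono)
  show "convex (convex_cone hull {s})" by (rule convex_convex_cone_hull)
  have main: "a \<in> convex_cone hull {s}"
    if a: "a \<in> convex_cone hull S" and b: "b \<in> convex_cone hull S" and x: "x \<in> convex_cone hull {s}" and seg: "x \<in> open_segment a b"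
    for a b x
  proof -
    obtain \<alpha> where \<alpha>: "\<And>i. i \<in> S \<Longrightarrow> 0 \<le> \<alpha> i" "a = (\<Sum>i\<in>S. \<alpha> i *\<^sub>R i)" using a convex_cone_hull_finite[OF S(2)] by auto
    obtain \<beta> where \<beta>: "\<And>i. i \<in> S \<Longrightarrow> 0 \<le> \<beta> i" "b = (\<Sum>i\<in>S. \<beta> i *\<^sub>R i)" using b convex_cone_hull_finite[OF S(2)] by auto
    obtain t where t: "x = t *\<^sub>R s" using x by (auto simp: convex_cone_hull_singleton)
    obtain u where u: "0 < u" "u < 1" "x = (1 - u) *\<^sub>R a + u *\<^sub>R b" using seg by (auto simp: in_segment)
    have "(\<Sum>i\<in>S. (if i = s then t else 0) *\<^sub>R i) = x"
      using s S(2) t by (simp add: if_distrib[of "\<lambda>r. r *\<^sub>R _"] cong: if_cong)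
    also have "\<dots> = (\<Sum>i\<in>S. ((1 - u) * \<alpha> i + u * \<beta> i) *\<^sub>R i)"
      unfolding u(3) \<alpha>(2) \<beta>(2) by (simp add: scaleR_sum_right scaleR_add_left sum.distrib)
    finally have eq: "(if i = s then t else 0) = (1 - u) * \<alpha> i + u * \<beta> i" if "i \<in> S" for i
      using independent_coeff_eq[OF S _ that, of "\<lambda>i. if i = s then t else 0" "\<lambda>i. (1 - u) * \<alpha> i + u * \<beta> i"] by simp
    have "\<alpha> i = 0" if "i \<in> S" "i \<noteq> s" for i
    proof -
      have "(1 - u) * \<alpha> i + u * \<beta> i = 0" using eq[OF that(1)] that by simp
      moreover have "0 \<le> (1 - u) * \<alpha> i" "0 \<le> u * \<beta> i" using \<alpha>(1) \<beta>(1) that u by simp_all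
      ultimately have "(1 - u) * \<alpha> i = 0" by linarith
      then show ?thesis using u by simp
    qed
    then have "a = (\<Sum>i\<in>S. (if i = s then \<alpha> s else 0) *\<^sub>R i)" unfolding \<alpha>(2) by (intro sum.cong) auto
    also have "\<dots> = \<alpha> s *\<^sub>R s" using s S(2) by (simp add: if_distrib[of "\<lambda>r. r *\<^sub>R _"] cong: if_cong)
    finally show ?thesis using \<alpha>(1)[OF s] by (auto simp: convex_cone_hull_singleton)
  qed
  fix a b x assume h: "a \<in> convex_cone hull S" "b \<in> convex_cone hull S" "x \<in> convex_cone hull {s}" "x \<in> open_segment a b"
  show "a \<in> convex_cone hull {s}" using main[OF h] .
  show "b \<in> convex_cone hull {s}" using main[OF h(2,1,3)] h(4) by (simp add: open_segment_commute)
qed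

text \<open>The sum is the midpoint of \<open>2 x\<close> and \<open>2 y\<close>, which makes the
  definition of faces by open segments applicable to sums. Equal summands have no open segment and
  are treated separately.\<close>

lemma face_of_cone_summand:
  assumes face: "\<tau> face_of \<sigma>" and cones: "convex_cone \<tau>" "convex_cone \<sigma>" and xy: "x \<in> \<sigma>" "y \<in> \<sigma>" "x + y \<in> \<tau>"
  shows "x \<in> \<tau>"
proof (cases "x = y")
  case True
  then have "(1/2) *\<^sub>R (x + y) = x" by (simp add: scaleR_2[symmetric])
  then show ?thesis using convex_cone_scaleR[OF cones(1) _ xy(3), of "1/2"] by simp
next
  case False
  have "x + y \<in> open_segment (2 *\<^sub>R x) (2 *\<^sub>R y)"
    unfolding in_segment using False by (auto intro!: exI[of _ "1/2"])
  moreover have "2 *\<^sub>R x \<in> \<sigma>" "2 *\<^sub>R y \<in> \<sigma>" using convex_cone_scaleR[OF cones(2)] xy by simp_all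
  ultimately have "2 *\<^sub>R x \<in> \<tau>" using face xy(3) by (auto simp: face_of_def)
  then show ?thesis using convex_cone_scaleR[OF cones(1), of "1/2" "2 *\<^sub>R x"] by simp
qed

lemma lattice_basis_primitive:
  fixes B :: "(real^'n) set"
  assumes B: "lattice_basis B" and s: "s \<in> B"
  shows "primitive_vector s"
proof -
  have ind: "independent B" "finite B" and lat: "lattice_points = range (\<lambda>c :: real^'n \<Rightarrow> int. \<Sum>b\<in>B. of_int (c b) *\<^sub>R b)"
    using B by (auto simp: lattice_basis_def)
  have one: "(\<Sum>b\<in>B. (if b = s then t else 0) *\<^sub>R b) = t *\<^sub>R s" for t :: real
    using s ind(2) by (simp add: if_distrib[of "\<lambda>r. r *\<^sub>R _"] cong: if_cong)
  have "s = (\<Sum>b\<in>B. of_int (if b = s then 1 else 0) *\<^sub>R b)"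
    using one[of 1] by (simp add: if_distrib[of real_of_int] cong: if_cong)
  then have "s \<in> lattice_points"
    unfolding lat by (rule range_eqI[of s "\<lambda>c :: real^'n \<Rightarrow> int. \<Sum>b\<in>B. of_int (c b) *\<^sub>R b" "\<lambda>b. if b = s then 1 else 0"])
  moreover have "s \<noteq> 0" using ind(1) s dependent_zero by blast
  moreover have "1 \<le> t" if t: "0 < t" "t *\<^sub>R s \<in> lattice_points" for t
  proof -
    obtain c :: "real^'n \<Rightarrow> int" where "t *\<^sub>R s = (\<Sum>b\<in>B. of_int (c b) *\<^sub>R b)" using t(2) unfolding lat by blast
    then have "t = of_int (c s)"
      using independent_coeff_eq[OF ind _ s, of "\<lambda>b. if b = s then t else 0" "\<lambda>b. of_int (c b)"] one by simp
    then show ?thesis using t(1) by simp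
  qed
  ultimately show ?thesis by (simp add: primitive_vector_def)
qed

text \<open>The standard basis vectors are integral combinations of \<open>x\<close>,
  \<open>y\<close>, \<open>z\<close>, so 1 is the product of \<open>vol x y z\<close> with another
  integer determinant.\<close>

lemma lattice_basis_vol:
  assumes B: "lattice_basis {x, y, z}" and d: "x \<noteq> y" "y \<noteq> z" "x \<noteq> z"
  shows "\<bar>vol x y z\<bar> = 1"
proof -
  have prim: "x \<in> lattice_points" "y \<in> lattice_points" "z \<in> lattice_points"
    using lattice_basis_primitive[OF B] by (auto simp: primitive_vector_def)
  have "\<exists>a b c :: int. q = of_int a *\<^sub>R x + of_int b *\<^sub>R y + of_int c *\<^sub>R z" if q: "q \<in> lattice_points" for q
  proof -
    obtain c :: "real^3 \<Rightarrow> int" where "q = (\<Sum>b\<in>{x, y, z}. of_int (c b) *\<^sub>R b)"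
      using B q unfolding lattice_basis_def by blast
    then have "q = of_int (c x) *\<^sub>R x + of_int (c y) *\<^sub>R y + of_int (c z) *\<^sub>R z" using d by simp
    then show ?thesis by blast
  qed
  moreover have "axis i 1 \<in> (lattice_points :: (real^3) set)" for i by (auto simp: lattice_points_def axis_def)
  ultimately have ax: "\<exists>a b c :: int. axis i 1 = of_int a *\<^sub>R x + of_int b *\<^sub>R y + of_int c *\<^sub>R z" for i by blast
  obtain a1 b1 c1 where 1: "axis 1 1 = of_int a1 *\<^sub>R x + of_int b1 *\<^sub>R y + of_int c1 *\<^sub>R z" using ax by blast
  obtain a2 b2 c2 where 2: "axis 2 1 = of_int a2 *\<^sub>R x + of_int b2 *\<^sub>R y + of_int c2 *\<^sub>R z" using ax by blast
  obtain a3 b3 c3 where 3: "axis 3 1 = of_int a3 *\<^sub>R x + of_int b3 *\<^sub>R y + of_int c3 *\<^sub>R z" using ax by blast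
  define D where "D = a1 * (b2 * c3 - c2 * b3) - b1 * (a2 * c3 - c2 * a3) + c1 * (a2 * b3 - b2 * a3)"
  have "vol x z y = - vol x y z" "vol y x z = - vol x y z" "vol y z x = vol x y z" "vol z x y = vol x y z" "vol z y x = - vol x y z"
    using vol_swap'[of x z y] vol_swap[of y x z] vol_rotate[of y z x] vol_rotate[of z x y] vol_swap[of z y x] vol_rotate[of y z x] by simp_all
  then have "vol (axis 1 1) (axis 2 1) (axis 3 1) = of_int D * vol x y z"
    unfolding 1 2 3 by (simp add: vol_linear D_def algebra_simps)
  moreover have "vol (axis 1 1) (axis 2 1) (axis 3 1) = 1" by (simp add: vol_def cross_basis inner_axis_axis)
  moreover obtain V where V: "vol x y z = of_int V" using vol_in_Ints[OF prim] by (auto elim: Ints_cases)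
  ultimately have "of_int (D * V) = (1 :: real)" by simp
  then have "D * V = 1" by linarith
  then have "\<bar>V\<bar> = 1" using abs_zmult_eq_1[of V D] by (simp add: mult.commute)
  then show ?thesis using V by (metis of_int_abs of_int_1)
qed

locale smooth_complete_fan3 =
  fixes \<Sigma> :: "(real^3) set set" and v :: "'k::finite \<Rightarrow> real^3"
  assumes complete: "complete_fan \<Sigma>" and regular: "regular_fan \<Sigma>" and rays: "ray_generators \<Sigma> v"
begin

lemma finite_fan: "finite \<Sigma>" and cone_face: "\<sigma> \<in> \<Sigma> \<Longrightarrow> \<tau> face_of \<sigma> \<Longrightarrow> \<tau> \<noteq> {} \<Longrightarrow> \<tau> \<in> \<Sigma>"
  and cone_Int: "\<sigma> \<in> \<Sigma> \<Longrightarrow> \<tau> \<in> \<Sigma> \<Longrightarrow> (\<sigma> \<inter> \<tau>) face_of \<sigma>" and covers: "\<Union>\<Sigma> = UNIV"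
  using complete by (auto simp: complete_fan_def fan_def)

lemma inj_rays: "inj v" and primitive: "primitive_vector (v j)" and ray_in_fan: "convex_cone hull {v j} \<in> \<Sigma>"
  using rays by (auto simp: ray_generators_def)

lemma v_lattice: "v j \<in> lattice_points" and v_nonzero: "v j \<noteq> 0"
  using primitive by (auto simp: primitive_vector_def)

text \<open>Links the lattice basis of a regular cone with its one-dimensional faces. A basis
  generator is primitive and spans a face, hence is some \<open>v j\<close>. Conversely the ray of
  \<open>v j\<close> contains a summand of the expansion of \<open>v j\<close>, and two primitive
  vectors on one ray agree.\<close>

lemma cone_generated:
  assumes \<sigma>: "\<sigma> \<in> \<Sigma>"
  shows "\<exists>B. lattice_basis B \<and> v ` rays_of v \<sigma> \<subseteq> B \<and> \<sigma> = convex_cone hull (v ` rays_of v \<sigma>)"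
proof -
  obtain B S where B: "lattice_basis B" "S \<subseteq> B" "\<sigma> = convex_cone hull S"
    using regular \<sigma> by (auto simp: regular_fan_def)
  have ind: "independent S" "finite S"
    using B independent_mono[of B S] finite_subset[of S B] by (simp_all add: lattice_basis_def)
  have "S = v ` rays_of v \<sigma>"
  proof
    show "S \<subseteq> v ` rays_of v \<sigma>"
    proof
      fix s assume s: "s \<in> S"
      have face: "(convex_cone hull {s}) face_of \<sigma>" unfolding B(3) by (rule face_of_independent_generator[OF ind s])
      then have "convex_cone hull {s} \<in> \<Sigma>" using cone_face[OF \<sigma>] convex_cone_hull_nonempty by blast
      moreover have "primitive_vector s" using lattice_basis_primitive[OF B(1)] s B(2) by blast
      ultimately obtain j where "s = v j" using rays by (auto simp: ray_generators_def)
      then show "s \<in> v ` rays_of v \<sigma>" using face by (auto simp: rays_of_def)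
    qed
    show "v ` rays_of v \<sigma> \<subseteq> S"
    proof clarify
      fix j assume "j \<in> rays_of v \<sigma>"
      then have face: "(convex_cone hull {v j}) face_of \<sigma>" by (simp add: rays_of_def)
      have "v j \<in> \<sigma>" using face_of_imp_subset[OF face] by (simp add: hull_inc subset_iff)
      then obtain c where c: "\<And>s. s \<in> S \<Longrightarrow> 0 \<le> c s" "v j = (\<Sum>s\<in>S. c s *\<^sub>R s)"
        unfolding B(3) convex_cone_hull_finite[OF ind(2)] by auto
      obtain s where s: "s \<in> S" "0 < c s"
      proof -
        have "\<exists>s\<in>S. c s *\<^sub>R s \<noteq> 0"
        proof (rule ccontr)
          assume "\<not> ?thesis"
          then have "(\<Sum>s\<in>S. c s *\<^sub>R s) = 0" by (intro sum.neutral) blast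
          then show False using c(2) v_nonzero[of j] by simp
        qed
        then obtain s where "s \<in> S" "c s \<noteq> 0" by auto
        with c(1)[of s] that show ?thesis by force
      qed
      have in_\<sigma>: "(\<Sum>i\<in>A. c i *\<^sub>R i) \<in> \<sigma>" if "A \<subseteq> S" for A
      proof -
        have "(\<Sum>i\<in>A. c i *\<^sub>R i) = (\<Sum>i\<in>S. (if i \<in> A then c i else 0) *\<^sub>R i)"
          using that ind(2) by (simp add: if_distrib[of "\<lambda>r. r *\<^sub>R _"] sum.If_cases Int_absorb1 cong: if_cong)
        then show ?thesis unfolding B(3) convex_cone_hull_finite[OF ind(2)] using c(1)
          by (intro CollectI exI[of _ "\<lambda>i. if i \<in> A then c i else 0"]) auto
      qed
      have "c s *\<^sub>R s + (\<Sum>i\<in>S - {s}. c i *\<^sub>R i) = v j" using c(2) s(1) ind(2) by (simp add: sum.remove)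
      then have "c s *\<^sub>R s + (\<Sum>i\<in>S - {s}. c i *\<^sub>R i) \<in> convex_cone hull {v j}" by (simp add: hull_inc)
      moreover have "c s *\<^sub>R s \<in> \<sigma>" "(\<Sum>i\<in>S - {s}. c i *\<^sub>R i) \<in> \<sigma>"
        using in_\<sigma>[of "{s}"] in_\<sigma>[of "S - {s}"] s(1) by auto
      ultimately have "c s *\<^sub>R s \<in> convex_cone hull {v j}"
        using face_of_cone_summand[OF face convex_cone_convex_cone_hull] convex_cone_convex_cone_hull[of S]
        unfolding B(3)[symmetric] by blast
      then obtain t where t: "0 \<le> t" "c s *\<^sub>R s = t *\<^sub>R v j" by (auto simp: convex_cone_hull_singleton)
      have prim: "primitive_vector s" using lattice_basis_primitive[OF B(1)] s B(2) by blast
      then have "c s *\<^sub>R s \<noteq> 0" using s(2) by (auto simp: primitive_vector_def)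
      then have t0: "0 < t" using t by (cases "t = 0") auto
      define r where "r = t / c s"
      have r: "0 < r" using t0 s(2) by (simp add: r_def)
      have "(1 / c s) *\<^sub>R c s *\<^sub>R s = (1 / c s) *\<^sub>R t *\<^sub>R v j" using t(2) by simp
      then have sr: "s = r *\<^sub>R v j" using s(2) by (simp add: r_def)
      then have "r *\<^sub>R v j \<in> lattice_points" using prim by (simp add: primitive_vector_def)
      then have "1 \<le> r" using primitive[of j] r by (simp add: primitive_vector_def)
      \<comment> \<open>Primitivity of \<open>v j\<close> bounds \<open>r\<close> from below by 1,
        primitivity of \<open>s\<close> does the same for its inverse.\<close>
      moreover have "(1 / r) *\<^sub>R s \<in> lattice_points" using sr r v_lattice by simp
      then have "1 \<le> 1 / r" using prim r by (simp add: primitive_vector_def)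
      ultimately have "r = 1" using r by (simp add: field_simps)
      then show "v j \<in> S" using sr s(1) by simp
    qed
  qed
  then show ?thesis using B by blast
qed

lemma cone_convex: "\<sigma> \<in> \<Sigma> \<Longrightarrow> convex_cone \<sigma>"
  using cone_generated convex_cone_convex_cone_hull by metis

lemma rays_in_cone: "\<sigma> \<in> \<Sigma> \<Longrightarrow> j \<in> rays_of v \<sigma> \<Longrightarrow> v j \<in> \<sigma>"
  by (metis cone_generated hull_inc imageI)

lemma sum_in_cone:
  assumes "\<sigma> \<in> \<Sigma>" "\<And>j. j \<in> A \<Longrightarrow> 0 \<le> c j \<and> v j \<in> \<sigma>"
  shows "(\<Sum>j\<in>A. c j *\<^sub>R v j) \<in> \<sigma>"
proof -
  have "finite A" by simp
  then show ?thesis using assms(2)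
  proof (induction A)
    case empty
    then show ?case using cone_convex[OF assms(1)] by (simp add: convex_cone_contains_0)
  next
    case (insert x A)
    then have "c x *\<^sub>R v x \<in> \<sigma>" using cone_convex[OF assms(1)] by (intro convex_cone_scaleR) auto
    then show ?case using insert cone_convex[OF assms(1)] by (auto intro: convex_cone_add)
  qed
qed

text \<open>The point lies in the common face of the two cones, and a face contains the summands of
  every sum that it contains.\<close>

lemma in_cone_rays:
  assumes \<sigma>: "\<sigma> \<in> \<Sigma>" and \<tau>: "\<tau> \<in> \<Sigma>" and A: "A \<subseteq> rays_of v \<sigma>" "\<And>j. j \<in> A \<Longrightarrow> 0 < c j"
    and q: "(\<Sum>j\<in>A. c j *\<^sub>R v j) \<in> \<tau>"
  shows "A \<subseteq> rays_of v \<tau>"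
proof
  fix j assume j: "j \<in> A"
  have in_\<sigma>: "\<And>i. i \<in> A \<Longrightarrow> 0 \<le> c i \<and> v i \<in> \<sigma>" using A rays_in_cone[OF \<sigma>] less_imp_le by blast
  have int: "convex_cone (\<sigma> \<inter> \<tau>)" using cone_convex[OF \<sigma>] cone_convex[OF \<tau>] by (simp add: convex_cone_iff)
  have "c j *\<^sub>R v j + (\<Sum>i\<in>A - {j}. c i *\<^sub>R v i) = (\<Sum>i\<in>A. c i *\<^sub>R v i)" using j by (simp add: sum.remove)
  then have "c j *\<^sub>R v j + (\<Sum>i\<in>A - {j}. c i *\<^sub>R v i) \<in> \<sigma> \<inter> \<tau>" using q sum_in_cone[OF \<sigma>, of A c] in_\<sigma> by simp
  moreover have "c j *\<^sub>R v j \<in> \<sigma>" using in_\<sigma>[OF j] convex_cone_scaleR[OF cone_convex[OF \<sigma>]] by blast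
  moreover have "(\<Sum>i\<in>A - {j}. c i *\<^sub>R v i) \<in> \<sigma>" using in_\<sigma> by (intro sum_in_cone[OF \<sigma>]) auto
  ultimately have "c j *\<^sub>R v j \<in> \<sigma> \<inter> \<tau>"
    using face_of_cone_summand[OF cone_Int[OF \<sigma> \<tau>] int cone_convex[OF \<sigma>]] by blast
  then have "(1 / c j) *\<^sub>R c j *\<^sub>R v j \<in> \<tau>" using convex_cone_scaleR[OF cone_convex[OF \<tau>], of "1 / c j" "c j *\<^sub>R v j"] A(2)[OF j] by auto
  then have "v j \<in> \<tau>" using A(2)[OF j] by simp
  then have "convex_cone hull {v j} \<subseteq> \<tau>" using cone_convex[OF \<tau>] by (simp add: hull_minimal)
  moreover have "(\<tau> \<inter> convex_cone hull {v j}) face_of \<tau>" by (rule cone_Int[OF \<tau> ray_in_fan])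
  ultimately show "j \<in> rays_of v \<tau>" by (simp add: rays_of_def Int_absorb1)
qed

lemma cone_independent:
  assumes "\<sigma> \<in> \<Sigma>"
  shows "independent (v ` rays_of v \<sigma>)"
  using cone_generated[OF assms] independent_mono unfolding lattice_basis_def by blast

lemma cone_coordinates:
  assumes \<sigma>: "\<sigma> \<in> \<Sigma>" and q: "q \<in> \<sigma>"
  shows "\<exists>c. (\<forall>j. 0 \<le> c j) \<and> {j. c j \<noteq> 0} \<subseteq> rays_of v \<sigma> \<and> q = (\<Sum>j\<in>UNIV. c j *\<^sub>R v j)"
proof -
  have "q \<in> convex_cone hull (v ` rays_of v \<sigma>)" using q cone_generated[OF \<sigma>] by blast
  then obtain c where c: "\<And>s. s \<in> v ` rays_of v \<sigma> \<Longrightarrow> 0 \<le> c s" "q = (\<Sum>s\<in>v ` rays_of v \<sigma>. c s *\<^sub>R s)"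
    unfolding convex_cone_hull_finite[OF finite_imageI[OF finite]] by blast
  have "q = (\<Sum>j\<in>rays_of v \<sigma>. c (v j) *\<^sub>R v j)"
    unfolding c(2) by (rule sum.reindex_cong[OF inj_on_subset[OF inj_rays]]) auto
  also have "\<dots> = (\<Sum>j\<in>UNIV. (if j \<in> rays_of v \<sigma> then c (v j) else 0) *\<^sub>R v j)"
    by (simp add: if_distrib[of "\<lambda>r. r *\<^sub>R _"] sum.If_cases cong: if_cong)
  finally show ?thesis using c(1)
    by (intro exI[of _ "\<lambda>j. if j \<in> rays_of v \<sigma> then c (v j) else 0"]) auto
qed

text \<open>An uncovered part would be open, nonempty and contained in finitely many cones of lower
  dimension, which have measure zero.\<close>

lemma maximal_cover: "\<Union>(maximal_cones \<Sigma>) = UNIV"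
proof (rule ccontr)
  assume ne: "\<Union>(maximal_cones \<Sigma>) \<noteq> UNIV"
  have "closed \<sigma>" if "\<sigma> \<in> \<Sigma>" for \<sigma>
    using cone_generated[OF that] closed_convex_cone_hull[of "v ` rays_of v \<sigma>"] by auto
  then have "closed (\<Union>(maximal_cones \<Sigma>))"
    using finite_fan by (intro closed_Union) (auto simp: maximal_cones_def)
  then have "\<not> negligible (- \<Union>(maximal_cones \<Sigma>))" using ne by (intro open_not_negligible) auto
  moreover have "negligible (\<Union>(\<Sigma> - maximal_cones \<Sigma>))"
  proof (rule negligible_Union)
    fix \<sigma> assume \<sigma>: "\<sigma> \<in> \<Sigma> - maximal_cones \<Sigma>"
    have "dim \<sigma> \<le> 3" using dim_subset_UNIV[of \<sigma>] by simp
    moreover have "dim \<sigma> \<noteq> 3" using \<sigma> by (auto simp: maximal_cones_def)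
    ultimately show "negligible \<sigma>" by (intro negligible_lowdim) simp
  qed (use finite_fan in auto)
  moreover have "- \<Union>(maximal_cones \<Sigma>) \<subseteq> \<Union>(\<Sigma> - maximal_cones \<Sigma>)" using covers by auto
  ultimately show False using negligible_subset by blast
qed

lemma maximal_cone_rays:
  assumes \<sigma>: "\<sigma> \<in> maximal_cones \<Sigma>"
  shows "\<exists>x y z. rays_of v \<sigma> = {x, y, z} \<and> \<bar>vol (v x) (v y) (v z)\<bar> = 1"
proof -
  have \<sigma>': "\<sigma> \<in> \<Sigma>" and dim: "dim \<sigma> = 3" using \<sigma> by (auto simp: maximal_cones_def)
  obtain B where B: "lattice_basis B" "v ` rays_of v \<sigma> \<subseteq> B" "\<sigma> = convex_cone hull (v ` rays_of v \<sigma>)"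
    using cone_generated[OF \<sigma>'] by blast
  have "\<sigma> \<subseteq> span (v ` rays_of v \<sigma>)"
    by (subst B(3)) (intro hull_minimal span_superset convex_cone_span)
  then have "dim \<sigma> \<le> dim (span (v ` rays_of v \<sigma>))" by (rule dim_subset)
  also have "\<dots> = card (v ` rays_of v \<sigma>)" using cone_independent[OF \<sigma>'] by (simp add: dim_eq_card_independent)
  finally have ge: "3 \<le> card (v ` rays_of v \<sigma>)" using dim by simp
  have "card B \<le> 3" using independent_bound[of B] B(1) by (auto simp: lattice_basis_def)
  moreover have fin: "finite B" using B(1) by (simp add: lattice_basis_def)
  ultimately have BB: "v ` rays_of v \<sigma> = B" using ge B(2) by (intro card_seteq) auto
  then have "card (rays_of v \<sigma>) = 3"
    using ge \<open>card B \<le> 3\<close> card_image[OF inj_on_subset[OF inj_rays], of "rays_of v \<sigma>"] by simp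
  then obtain x y z where xyz: "rays_of v \<sigma> = {x, y, z}" "x \<noteq> y" "y \<noteq> z" "x \<noteq> z" by (metis card_3_iff)
  then have "\<bar>vol (v x) (v y) (v z)\<bar> = 1"
    using lattice_basis_vol[of "v x" "v y" "v z"] B(1) BB inj_rays by (auto dest: injD)
  with xyz show ?thesis by blast
qed

definition face_sets :: "'k set set" where
  "face_sets = {S. \<exists>\<sigma>\<in>\<Sigma>. S \<subseteq> rays_of v \<sigma>}"

text \<open>A maximal cone through the sum of the generators of \<open>S\<close> has all of them
  among its rays.\<close>

lemma face_in_maximal:
  assumes "S \<in> face_sets"
  shows "\<exists>\<sigma>\<in>maximal_cones \<Sigma>. S \<subseteq> rays_of v \<sigma>"
proof -
  obtain \<sigma> where \<sigma>: "\<sigma> \<in> \<Sigma>" "S \<subseteq> rays_of v \<sigma>" using assms by (auto simp: face_sets_def)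
  obtain \<tau> where \<tau>: "\<tau> \<in> maximal_cones \<Sigma>" "(\<Sum>j\<in>S. 1 *\<^sub>R v j) \<in> \<tau>" using maximal_cover by blast
  then have "S \<subseteq> rays_of v \<tau>" by (intro in_cone_rays[OF \<sigma>(1) _ \<sigma>(2), of _ "\<lambda>_. 1"]) (auto simp: maximal_cones_def)
  then show ?thesis using \<tau> by blast
qed

sublocale unimodular_fan3 face_sets v
proof
  show "v j \<in> lattice_points" for j by (rule v_lattice)
  show "S' \<in> face_sets" if "S \<in> face_sets" "S' \<subseteq> S" for S S' using that by (auto simp: face_sets_def)
  show "{j} \<in> face_sets" for j
  proof -
    have "j \<in> rays_of v (convex_cone hull {v j})"
      by (simp add: rays_of_def face_of_refl convex_convex_cone_hull)
    then show ?thesis using ray_in_fan by (auto simp: face_sets_def)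
  qed
  show "\<exists>x y z. S \<subseteq> {x, y, z} \<and> {x, y, z} \<in> face_sets \<and> \<bar>vol (v x) (v y) (v z)\<bar> = 1" if S: "S \<in> face_sets" for S
  proof -
    obtain \<sigma> where \<sigma>: "\<sigma> \<in> maximal_cones \<Sigma>" "S \<subseteq> rays_of v \<sigma>" using face_in_maximal[OF S] by blast
    obtain x y z where "rays_of v \<sigma> = {x, y, z}" "\<bar>vol (v x) (v y) (v z)\<bar> = 1" using maximal_cone_rays[OF \<sigma>(1)] by blast
    moreover have "rays_of v \<sigma> \<in> face_sets" using \<sigma>(1) by (auto simp: face_sets_def maximal_cones_def)
    ultimately show ?thesis using \<sigma>(2) by metis
  qed
  show "\<exists>c. nonneg_rep face_sets v c q" for q
  proof -
    obtain \<sigma> where \<sigma>: "\<sigma> \<in> \<Sigma>" "q \<in> \<sigma>" using covers by blast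
    then show ?thesis using cone_coordinates[OF \<sigma>] by (auto simp: nonneg_rep_def face_sets_def)
  qed
  show "c = c'" if c: "nonneg_rep face_sets v c q" and c': "nonneg_rep face_sets v c' q" for c c' q
  proof -
    obtain \<sigma> where \<sigma>: "\<sigma> \<in> \<Sigma>" "{j. c j \<noteq> 0} \<subseteq> rays_of v \<sigma>" using c by (auto simp: nonneg_rep_def face_sets_def)
    obtain \<tau> where \<tau>: "\<tau> \<in> \<Sigma>" "{j. c' j \<noteq> 0} \<subseteq> rays_of v \<tau>" using c' by (auto simp: nonneg_rep_def face_sets_def)
    have pos: "0 < c j" if "j \<in> {j. c j \<noteq> 0}" for j
    proof -
      have "0 \<le> c j" using c by (simp add: nonneg_rep_def)
      then show ?thesis using that by simp
    qed
    have expand: "(\<Sum>j\<in>A. d j *\<^sub>R v j) = q" if "nonneg_rep face_sets v d q" "{j. d j \<noteq> 0} \<subseteq> A" for d A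
    proof -
      have "(\<Sum>j\<in>A. d j *\<^sub>R v j) = (\<Sum>j\<in>UNIV. d j *\<^sub>R v j)" using that(2) by (intro sum.mono_neutral_left) auto
      then show ?thesis using that(1) by (simp add: nonneg_rep_def)
    qed
    have "0 \<le> c' j" for j using c' by (simp add: nonneg_rep_def)
    then have "(\<Sum>j\<in>rays_of v \<tau>. c' j *\<^sub>R v j) \<in> \<tau>" using rays_in_cone[OF \<tau>(1)] by (intro sum_in_cone[OF \<tau>(1)]) auto
    then have "(\<Sum>j\<in>{j. c j \<noteq> 0}. c j *\<^sub>R v j) \<in> \<tau>" using expand[OF c] expand[OF c' \<tau>(2)] by simp
    \<comment> \<open>With the support of \<open>c\<close> moved into the cone \<tau> of
      \<open>c'\<close>, both representations use the same independent generators.\<close>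
    then have c\<tau>: "{j. c j \<noteq> 0} \<subseteq> rays_of v \<tau>" using in_cone_rays[OF \<sigma>(1) \<tau>(1) \<sigma>(2), of c] pos by blast
    let ?R = "rays_of v \<tau>"
    have sum_image: "(\<Sum>j\<in>?R. d j *\<^sub>R v j) = (\<Sum>s\<in>v ` ?R. d (inv v s) *\<^sub>R s)" for d :: "'k \<Rightarrow> real"
      by (rule sum.reindex_cong[OF inj_on_subset[OF inj_rays], symmetric]) (auto simp: inv_f_f[OF inj_rays])
    have "(\<Sum>s\<in>v ` ?R. c (inv v s) *\<^sub>R s) = (\<Sum>s\<in>v ` ?R. c' (inv v s) *\<^sub>R s)"
      using expand[OF c c\<tau>] expand[OF c' \<tau>(2)] by (simp add: sum_image)
    then have "c (inv v s) = c' (inv v s)" if "s \<in> v ` ?R" for s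
      using independent_coeff_eq[OF cone_independent[OF \<tau>(1)], of "\<lambda>s. c (inv v s)" "\<lambda>s. c' (inv v s)"] that by simp
    then have eq: "c j = c' j" if "j \<in> ?R" for j using that by (force simp: inv_f_f[OF inj_rays])
    show "c = c'"
    proof
      fix j
      show "c j = c' j"
      proof (cases "j \<in> ?R")
        case False
        then have "c j = 0" "c' j = 0" using c\<tau> \<tau>(2) by blast+
        then show ?thesis by simp
      qed (rule eq)
    qed
  qed
qed

end

section \<open>Divisor classes\<close>

text \<open>A relation among the generators pairs to zero with every principal divisor, so the
  pairing descends to classes; a linear section of \<open>cl\<close> makes it explicit.\<close>

lemma class_map_functional:
  fixes cl :: "real^'k::finite \<Rightarrow> 'c::euclidean_space" and v :: "'k \<Rightarrow> real^'n"
  assumes cm: "class_map v cl" and b: "(\<Sum>j\<in>UNIV. b j *\<^sub>R v j) = 0"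
  shows "\<exists>f. linear f \<and> (\<forall>a. f (cl a) = (\<Sum>j\<in>UNIV. b j * a $ j))"
proof -
  have cl: "linear cl" "surj cl" and ker: "{a. cl a = 0} = range (\<lambda>m. \<chi> j. m \<bullet> v j)"
    using cm by (auto simp: class_map_def)
  obtain h where h: "linear h" "cl \<circ> h = id" using linear_surjective_right_inverse[OF cl] by blast
  define g where "g a = (\<Sum>j\<in>UNIV. b j * a $ j)" for a :: "real^'k"
  have g: "linear g"
    by (rule linearI) (simp_all add: g_def algebra_simps sum.distrib sum_distrib_left)
  have "g (h (cl a)) = g a" for a
  proof -
    have "cl (h (cl a) - a) = 0" using h(2) by (simp add: linear_diff[OF cl(1)] fun_eq_iff)
    then obtain m where m: "h (cl a) - a = (\<chi> j. m \<bullet> v j)" using ker by blast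
    have "g (h (cl a)) - g a = g (h (cl a) - a)" by (simp add: linear_diff[OF g])
    also have "\<dots> = m \<bullet> (\<Sum>j\<in>UNIV. b j *\<^sub>R v j)" unfolding m by (simp add: g_def inner_sum_right)
    finally show ?thesis using b by simp
  qed
  then show ?thesis using linear_compose[OF h(1) g] by (intro exI[of _ "g \<circ> h"]) (simp add: g_def)
qed

section \<open>Facets of the effective cone and the nef class of a certificate\<close>

context smooth_complete_fan3
begin

text \<open>By completeness \<open>- m\<close> is a nonnegative combination of the rays, so the
  product of \<open>m\<close> with itself is at most 0.\<close>

lemma separating: "(\<And>j. 0 \<le> m \<bullet> v j) \<Longrightarrow> m = 0"
proof -
  assume m: "\<And>j. 0 \<le> m \<bullet> v j"
  obtain c where "nonneg_rep face_sets v c (- m)" using rep_exists by blast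
  then have c: "\<And>j. 0 \<le> c j" "- m = (\<Sum>j\<in>UNIV. c j *\<^sub>R v j)" by (auto simp: nonneg_rep_def)
  have "m \<bullet> (- m) = (\<Sum>j\<in>UNIV. c j * (m \<bullet> v j))" unfolding c(2) by (simp add: inner_sum_right)
  also have "\<dots> \<ge> 0" using m c(1) by (simp add: sum_nonneg)
  finally have "m \<bullet> m \<le> 0" by simp
  then show "m = 0" by (metis inner_eq_zero_iff inner_ge_zero order_antisym)
qed

text \<open>The principal divisors form the kernel of \<open>cl\<close> and have dimension 3,
  because \<open>separating\<close> makes \<open>p\<close> injective; a section of \<open>cl\<close>
  supplies a complement.\<close>

lemma number_of_rays:
  fixes cl :: "real^'k \<Rightarrow> 'c::euclidean_space"
  assumes cm: "class_map v cl"
  shows "CARD('k) = DIM('c) + 3"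
proof -
  have cl: "linear cl" "surj cl" and ker: "{a. cl a = 0} = range (\<lambda>m. \<chi> j. m \<bullet> v j)"
    using cm by (auto simp: class_map_def)
  obtain h where h: "linear h" "cl \<circ> h = id" using linear_surjective_right_inverse[OF cl] by blast
  then have clh: "cl (h y) = y" for y by (simp add: fun_eq_iff)
  define p where "p m = (\<chi> j. m \<bullet> v j)" for m :: "real^3"
  have p: "linear p" by (rule linearI) (simp_all add: p_def vec_eq_iff inner_add_left)
  have "inj p"
  proof (rule linear_injective_0[OF p, THEN iffD2], intro allI impI)
    fix m assume "p m = 0"
    then have "m \<bullet> v j = 0" for j by (simp add: p_def vec_eq_iff)
    then show "m = 0" by (intro separating) simp
  qed
  have "inj h" using clh by (metis injI)
  have K: "{a. cl a = 0} = range p" using ker by (simp add: p_def)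
  have dims: "dim (range p) = 3" "dim (range h) = DIM('c)"
    using dim_image_eq[OF p, of UNIV] dim_image_eq[OF h(1), of UNIV] \<open>inj p\<close> \<open>inj h\<close>
    by (simp_all add: dim_UNIV)
  have "{x + y |x y. x \<in> range p \<and> y \<in> range h} = UNIV"
  proof -
    have "a = (a - h (cl a)) + h (cl a) \<and> a - h (cl a) \<in> range p" for a
      unfolding K[symmetric] by (simp add: linear_diff[OF cl(1)] clh)
    then show ?thesis by blast
  qed
  moreover have "range p \<inter> range h = {0}"
  proof -
    have "x = 0" if x: "x \<in> range p" "x \<in> range h" for x
    proof -
      obtain y where y: "x = h y" using x(2) by blast
      have "cl x = 0" using x(1) unfolding K[symmetric] by simp
      then show ?thesis using y clh linear_0[OF h(1)] by simp
    qed
    moreover have "0 \<in> range p" "0 \<in> range h" using linear_0[OF p] linear_0[OF h(1)] by (metis rangeI)+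
    ultimately show ?thesis by blast
  qed
  moreover have "subspace (range p)" "subspace (range h)"
    using linear_subspace_image[OF p subspace_UNIV] linear_subspace_image[OF h(1) subspace_UNIV] by auto
  ultimately have "dim (UNIV :: (real^'k) set) + dim {0 :: real^'k} = 3 + DIM('c)"
    using dim_sums_Int[of "range p" "range h"] dims by simp
  then show ?thesis by (simp add: dim_UNIV)
qed

text \<open>The cross products divided by the determinant are the dual basis.\<close>

lemma interpolation:
  assumes "{x, y, z} \<in> face_sets" "\<bar>vol (v x) (v y) (v z)\<bar> = 1"
  shows "\<exists>m. \<forall>j\<in>{x, y, z}. m \<bullet> v j = a j"
proof -
  define e where "e = vol (v x) (v y) (v z)"
  have e: "e \<noteq> 0" using assms(2) by (auto simp: e_def)
  define m where "m = (1 / e) *\<^sub>R (a x *\<^sub>R cross3 (v y) (v z) + a y *\<^sub>R cross3 (v z) (v x) + a z *\<^sub>R cross3 (v x) (v y))"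
  have m: "m \<bullet> q = (1 / e) * (a x * vol (v y) (v z) q + a y * vol (v z) (v x) q + a z * vol (v x) (v y) q)" for q
    by (simp add: m_def inner_add_left cross3_inner)
  have "vol (v y) (v z) (v x) = e" "vol (v z) (v x) (v y) = e"
    unfolding e_def using vol_rotate[of "v y" "v z" "v x"] vol_rotate[of "v z" "v x" "v y"] by simp_all
  then have "m \<bullet> v x = a x" "m \<bullet> v y = a y" "m \<bullet> v z = a z" using e by (simp_all add: m e_def[symmetric])
  then show ?thesis by blast
qed

text \<open>Without one member, \<open>P\<close> is part of a basis on which values can be
  prescribed; the value on the last member is then forced by the two zero sums.\<close>

lemma zero_sum_interpolation:
  assumes P: "P \<noteq> {}" "\<And>Q. Q \<subset> P \<Longrightarrow> Q \<in> face_sets" "(\<Sum>j\<in>P. v j) = 0" and a: "(\<Sum>j\<in>P. a j) = 0"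
  shows "\<exists>m. \<forall>j\<in>P. m \<bullet> v j = a j"
proof -
  obtain i where i: "i \<in> P" using P(1) by blast
  then have "P - {i} \<in> face_sets" using P(2) by blast
  then obtain x y z where "P - {i} \<subseteq> {x, y, z}" "{x, y, z} \<in> face_sets" "\<bar>vol (v x) (v y) (v z)\<bar> = 1"
    using face_max by blast
  then obtain m where m: "\<And>j. j \<in> P - {i} \<Longrightarrow> m \<bullet> v j = a j" using interpolation[of x y z a] by blast
  have "0 = m \<bullet> (\<Sum>j\<in>P. v j)" using P(3) by simp
  also have "\<dots> = (\<Sum>j\<in>P. m \<bullet> v j)" by (simp add: inner_sum_right)
  also have "\<dots> = m \<bullet> v i + (\<Sum>j\<in>P - {i}. m \<bullet> v j)" using i by (simp add: sum.remove)
  also have "(\<Sum>j\<in>P - {i}. m \<bullet> v j) = (\<Sum>j\<in>P - {i}. a j)" using m by (rule sum.cong[OF refl])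
  also have "\<dots> = - a i" using a i by (simp add: sum.remove)
  finally have "m \<bullet> v i = a i" by simp
  then show ?thesis using m by blast
qed

text \<open>The hyperplane supports the cone because \<open>f\<close> is nonnegative on the prime
  classes. By interpolation every class in it has a representative supported off \<open>P\<close>,
  so the prime classes outside \<open>P\<close>, which lie in the face, span it.\<close>

lemma zero_sum_facet:
  fixes cl :: "real^'k \<Rightarrow> 'c::euclidean_space"
  assumes cm: "class_map v cl" and P: "P \<noteq> {}" "\<And>Q. Q \<subset> P \<Longrightarrow> Q \<in> face_sets" "(\<Sum>j\<in>P. v j) = 0"
    and f: "linear f" "\<And>a. f (cl a) = (\<Sum>j\<in>P. a $ j)"
  shows "(eff_cone cl \<inter> {x. f x = 0}) facet_of (eff_cone cl)"
proof -
  have lin: "linear cl" and "surj cl" and ker: "{a. cl a = 0} = range (\<lambda>m. \<chi> j. m \<bullet> v j)"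
    using cm by (auto simp: class_map_def)
  define u where "u = adjoint f 1"
  have u: "u \<bullet> x = f x" for x using adjoint_works[OF f(1), of x 1] by (simp add: u_def inner_commute)
  have f_prime: "f (prime_class cl j) = (if j \<in> P then 1 else 0)" for j
    by (simp add: prime_class_def f(2) axis_def)
  have eff: "eff_cone cl = cl ` {l. \<forall>j. 0 \<le> l $ j}"
    using cone_of_prime_classes[OF lin, of UNIV] by (simp add: eff_cone_def)
  have f_nonneg: "0 \<le> f x" if "x \<in> eff_cone cl" for x
    using that unfolding eff by (auto simp: f(2) intro!: sum_nonneg)
  obtain i where i: "i \<in> P" using P(1) by blast
  have "u \<noteq> 0"
  proof
    assume "u = 0"
    then show False using u[of "prime_class cl i"] f_prime[of i] i by simp
  qed
  have prime_eff: "prime_class cl j \<in> eff_cone cl" for j unfolding eff_cone_def by (simp add: hull_inc)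
  have "(eff_cone cl \<inter> {x. u \<bullet> x = 0}) face_of eff_cone cl"
    unfolding eff_cone_def[of cl]
    by (intro face_of_Int_supporting_hyperplane_ge convex_convex_cone_hull)
      (simp add: u f_nonneg[unfolded eff_cone_def])
  then have face: "(eff_cone cl \<inter> {x. f x = 0}) face_of eff_cone cl" by (simp add: u)
  have zero: "0 \<in> eff_cone cl" unfolding eff_cone_def by (rule convex_cone_hull_contains_0)
  have expand: "cl a = (\<Sum>j\<in>UNIV. a $ j *\<^sub>R prime_class cl j)" for a by (rule class_eq_sum[OF lin])
  have "span (eff_cone cl) = UNIV"
  proof -
    have "cl a \<in> span (eff_cone cl)" for a
      unfolding expand[of a] by (intro span_sum span_scale span_base prime_eff)
    then have "range cl \<subseteq> span (eff_cone cl)" by blast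
    then show ?thesis using \<open>surj cl\<close> by auto
  qed
  then have dim_eff: "dim (eff_cone cl) = DIM('c)"
    using dim_span[of "eff_cone cl"] by (simp add: dim_UNIV)
  have H: "{x. f x = 0} \<subseteq> span (eff_cone cl \<inter> {x. f x = 0})"
  proof
    fix x assume "x \<in> {x. f x = 0}"
    moreover obtain a where a: "x = cl a" using \<open>surj cl\<close> by (metis surjD)
    ultimately have "(\<Sum>j\<in>P. a $ j) = 0" using f(2) by simp
    then obtain m where m: "\<And>j. j \<in> P \<Longrightarrow> m \<bullet> v j = a $ j"
      using zero_sum_interpolation[of P "\<lambda>j. a $ j"] P by blast
    define a' where "a' = a - (\<chi> j. m \<bullet> v j)"
    have "cl (\<chi> j. m \<bullet> v j) = 0" using ker by blast
    then have "x = cl a'" unfolding a'_def a by (simp add: linear_diff[OF lin])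
    also have "\<dots> = (\<Sum>j\<in>- P. a' $ j *\<^sub>R prime_class cl j)"
      unfolding expand[of a'] by (rule sum.mono_neutral_right) (auto simp: a'_def m)
    also have "\<dots> \<in> span (eff_cone cl \<inter> {x. f x = 0})"
      using prime_eff f_prime by (intro span_sum span_scale span_base) auto
    finally show "x \<in> span (eff_cone cl \<inter> {x. f x = 0})" .
  qed
  have "dim {x. f x = 0} = DIM('c) - 1" using dim_hyperplane[OF \<open>u \<noteq> 0\<close>] by (simp add: u)
  moreover have "dim {x. f x = 0} \<le> dim (eff_cone cl \<inter> {x. f x = 0})" using dim_subset[OF H] by simp
  moreover have "dim (eff_cone cl \<inter> {x. f x = 0}) \<le> dim {x. f x = 0}" by (rule dim_subset) simp
  ultimately have dim_face: "dim (eff_cone cl \<inter> {x. f x = 0}) = DIM('c) - 1" by simp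
  have z: "0 \<in> eff_cone cl \<inter> {x. f x = 0}" using zero linear_0[OF f(1)] by simp
  \<comment> \<open>Both sets contain 0, so their affine dimensions are their linear
    dimensions.\<close>
  have "aff_dim (eff_cone cl \<inter> {x. f x = 0}) = aff_dim (eff_cone cl) - 1"
    using aff_dim_zero[OF hull_inc[OF z]] aff_dim_zero[OF hull_inc[OF zero]] dim_eff dim_face
    by (simp add: of_nat_diff Suc_leI)
  then show ?thesis using face z by (auto simp: facet_of_def)
qed

text \<open>The cone through the zero sum is \<open>{0}\<close>, a face of every ray. It has no rays
  itself, so the relation has no negative part.\<close>

lemma primitive_relation_zero:
  assumes "(\<Sum>j\<in>P. v j) = 0"
  shows "primitive_relation \<Sigma> v P (\<lambda>j. if j \<in> P then 1 else 0)"
proof -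
  fix i :: 'k
  have "{0} face_of (convex_cone hull {v i})"
    unfolding face_of_def
  proof (intro conjI ballI impI)
    fix a b x assume ab: "a \<in> convex_cone hull {v i}" "b \<in> convex_cone hull {v i}"
      and x: "x \<in> {0}" "x \<in> open_segment a b"
    obtain s t where st: "0 \<le> s" "0 \<le> t" "a = s *\<^sub>R v i" "b = t *\<^sub>R v i" using ab by (auto simp: convex_cone_hull_singleton)
    obtain r where r: "0 < r" "r < 1" "x = (1 - r) *\<^sub>R a + r *\<^sub>R b" using x(2) by (auto simp: in_segment)
    then have "((1 - r) * s + r * t) *\<^sub>R v i = 0" using x(1) st by (simp add: scaleR_add_left)
    then have "(1 - r) * s + r * t = 0" using v_nonzero by simp
    moreover have "0 \<le> (1 - r) * s" "0 \<le> r * t" using r st by simp_all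
    ultimately have "(1 - r) * s = 0" "r * t = 0" by linarith+
    then show "a \<in> {0}" "b \<in> {0}" using r st by simp_all
  qed (auto simp: convex_cone_hull_contains_0)
  then have "{0} \<in> \<Sigma>" using cone_face[OF ray_in_fan[of i]] by blast
  moreover have "rays_of v {0} = {}"
  proof -
    have False if "(convex_cone hull {v j}) face_of {0}" for j
      using face_of_imp_subset[OF that] v_nonzero[of j] by (auto dest: subsetD[OF _ hull_inc[of "v j"]])
    then show ?thesis by (auto simp: rays_of_def)
  qed
  ultimately show ?thesis using assms by (auto simp: primitive_relation_def intro!: bexI[of _ "{0}"])
qed

text \<open>On each cone one form of \<open>M\<close> is the minimum, and this form is the linear
  datum that the description of the nef cone asks for.\<close>

lemma fibration_divisor:
  fixes cl :: "real^'k \<Rightarrow> 'c::euclidean_space"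
  assumes cm: "class_map v cl" and cert: "nef_certificate face_sets v P M"
    and f: "\<And>a. f (cl a) = (\<Sum>j\<in>P. a $ j)"
  shows "\<exists>a. divisor_class cl a \<noteq> 0 \<and> nef_divisor \<Sigma> v cl a \<and> f (divisor_class cl a) = 0"
proof -
  have M: "finite M" "M \<subseteq> lattice_points" "0 \<in> M" "M \<noteq> {0}" "\<And>m j. m \<in> M \<Longrightarrow> j \<in> P \<Longrightarrow> m \<bullet> v j = 0"
    and lin: "\<And>S. S \<in> face_sets \<Longrightarrow> \<exists>m\<in>M. \<forall>j\<in>S. \<forall>m'\<in>M. m \<bullet> v j \<le> m' \<bullet> v j"
    using cert by (auto simp: nef_certificate_def)
  have ker: "{a. cl a = 0} = range (\<lambda>m. \<chi> j. m \<bullet> v j)" using cm by (auto simp: class_map_def)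
  define \<mu> where "\<mu> j = Min ((\<lambda>m. m \<bullet> v j) ` M)" for j
  have \<mu>_le: "\<mu> j \<le> m \<bullet> v j" if "m \<in> M" for m j using that M(1) by (simp add: \<mu>_def)
  have \<mu>_in: "\<exists>m\<in>M. \<mu> j = m \<bullet> v j" for j
  proof -
    have "\<mu> j \<in> (\<lambda>m. m \<bullet> v j) ` M" unfolding \<mu>_def using M(1,3) by (intro Min_in) auto
    then show ?thesis by blast
  qed
  have "m \<bullet> v j \<in> \<int>" if "m \<in> M" for m j
    using M(2) that v_lattice[of j] by (auto simp: lattice_points_def inner_vec_def intro!: Ints_sum Ints_mult)
  then have "\<exists>n. \<mu> j = of_int n" for j using \<mu>_in[of j] by (metis Ints_cases)
  then obtain n where n: "\<And>j. \<mu> j = of_int (n j)" by metis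
  define a :: "int^'k" where "a = (\<chi> j. - n j)"
  have cla: "divisor_class cl a = cl (\<chi> j. - \<mu> j)" by (simp add: divisor_class_def a_def n)
  have "\<mu> j = 0" if "j \<in> P" for j using \<mu>_in[of j] M(5) that by auto
  then have "f (divisor_class cl a) = 0" by (simp add: cla f)
  moreover have "nef_divisor \<Sigma> v cl a"
    unfolding nef_divisor_def cla nef_cone_iff[OF cm]
  proof
    fix \<sigma> assume "\<sigma> \<in> maximal_cones \<Sigma>"
    then have "rays_of v \<sigma> \<in> face_sets" by (auto simp: face_sets_def maximal_cones_def)
    then obtain m where m: "m \<in> M" "\<And>j m'. j \<in> rays_of v \<sigma> \<Longrightarrow> m' \<in> M \<Longrightarrow> m \<bullet> v j \<le> m' \<bullet> v j" using lin by blast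
    have "\<mu> j = m \<bullet> v j" if "j \<in> rays_of v \<sigma>" for j
      using \<mu>_in[of j] \<mu>_le[OF m(1), of j] m(2)[OF that] by force
    then show "\<exists>m. (\<forall>j\<in>rays_of v \<sigma>. m \<bullet> v j = - ((\<chi> j. - \<mu> j) $ j)) \<and>
        (\<forall>j. j \<notin> rays_of v \<sigma> \<longrightarrow> - ((\<chi> j. - \<mu> j) $ j) \<le> m \<bullet> v j)"
      using \<mu>_le[OF m(1)] by (intro exI[of _ m]) simp
  qed
  moreover have "divisor_class cl a \<noteq> 0"
  proof
    assume "divisor_class cl a = 0"
    then obtain k where "(\<chi> j. - \<mu> j) = (\<chi> j. k \<bullet> v j)" unfolding cla using ker by blast
    then have k: "k \<bullet> v j = - \<mu> j" for j by (simp add: vec_eq_iff)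
    \<comment> \<open>As 0 belongs to \<open>M\<close>, no \<open>\<mu> j\<close> is positive, so
      \<open>k\<close> is nonnegative on all rays. Then all forms in \<open>M\<close> are
      nonnegative on the rays and vanish as well.\<close>
    have "k = 0" using separating[of k] \<mu>_le[OF M(3)] by (simp add: k)
    then have "\<mu> j = 0" for j using k[of j] by simp
    then have "m = 0" if "m \<in> M" for m using separating[of m] \<mu>_le[OF that] by simp
    then show False using M(3,4) by blast
  qed
  ultimately show ?thesis by blast
qed

end

section \<open>From an ample divisor to the bordering chamber\<close>

context smooth_complete_fan3
begin

lemma ample_strictly_convex:
  assumes a: "ample_divisor \<Sigma> v a" and S: "S \<in> face_sets"
  shows "\<exists>R m. R \<in> face_sets \<and> S \<subseteq> R \<and> (\<forall>j\<in>R. m \<bullet> v j = - of_int (a $ j)) \<and>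
    (\<forall>j. j \<notin> R \<longrightarrow> - of_int (a $ j) < m \<bullet> v j)"
proof -
  obtain \<sigma> where \<sigma>: "\<sigma> \<in> maximal_cones \<Sigma>" "S \<subseteq> rays_of v \<sigma>" using face_in_maximal[OF S] by blast
  then have "rays_of v \<sigma> \<in> face_sets" by (auto simp: face_sets_def maximal_cones_def)
  then show ?thesis using a \<sigma> unfolding ample_divisor_def by blast
qed

lemma certificate:
  fixes cl :: "real^'k \<Rightarrow> real^4"
  assumes "projective_fan \<Sigma> v" "class_map v cl"
  shows "\<exists>P M. nef_certificate face_sets v P M"
proof -
  obtain a where "ample_divisor \<Sigma> v a" using assms(1) by (auto simp: projective_fan_def)
  then obtain P where "P \<notin> face_sets" "\<And>Q. Q \<subset> P \<Longrightarrow> Q \<in> face_sets" "(\<Sum>j\<in>P. v j) = 0"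
    using zero_sum_collection[of "\<lambda>j. a $ j"] ample_strictly_convex by blast
  moreover have "CARD('k) = 7" using number_of_rays[OF assms(2)] by simp
  ultimately show ?thesis by (intro nef_certificate_of_zero_sum)
qed

end

theorem theorem4p1:
  fixes \<Sigma> :: "(real^3) set set"
    and v :: "'k::finite \<Rightarrow> real^3"
    and cl :: "real^'k \<Rightarrow> real^4"
  assumes "complete_fan \<Sigma>" and "regular_fan \<Sigma>"
    and "ray_generators \<Sigma> v"
    and "projective_fan \<Sigma> v"
    and "class_map v cl"
  shows "(\<exists>P b f. primitive_collection \<Sigma> v P \<and> primitive_relation \<Sigma> v P b \<and> (\<forall>j. b j \<ge> 0) \<and>
            support_functional cl b f \<and>
            bordering_chamber cl (nef_cone \<Sigma> v cl) {x. f x = 0}) \<and>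
         (\<exists>a. divisor_class cl a \<noteq> 0 \<and> nef_divisor \<Sigma> v cl a \<and> \<not> big_divisor cl a)"
proof -
  interpret smooth_complete_fan3 \<Sigma> v
    using assms by unfold_locales
  obtain P M where cert: "nef_certificate face_sets v P M" using certificate assms(4,5) by blast
  then have P: "P \<notin> face_sets" "\<And>Q. Q \<subset> P \<Longrightarrow> Q \<in> face_sets" "(\<Sum>j\<in>P. v j) = 0"
    by (auto simp: nef_certificate_def)
  have ne: "P \<noteq> {}" using P(1) empty_face by blast
  define b :: "'k \<Rightarrow> real" where "b j = (if j \<in> P then 1 else 0)" for j
  have "(\<Sum>j\<in>UNIV. b j *\<^sub>R v j) = 0"
    using P(3) by (simp add: b_def if_distrib[of "\<lambda>r. r *\<^sub>R _"] sum.If_cases cong: if_cong)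
  then obtain f where f: "linear f" "\<And>a. f (cl a) = (\<Sum>j\<in>UNIV. b j * a $ j)"
    using class_map_functional[OF assms(5)] by blast
  have fP: "f (cl a) = (\<Sum>j\<in>P. a $ j)" for a
    by (simp add: f(2) b_def if_distrib[of "\<lambda>r. r * _"] sum.If_cases cong: if_cong)
  have fb: "f (prime_class cl j) = b j" for j
    by (simp add: prime_class_def f(2) axis_def if_distrib[of "\<lambda>r. _ * r"] cong: if_cong)
  obtain a where a: "divisor_class cl a \<noteq> 0" "nef_divisor \<Sigma> v cl a" "f (divisor_class cl a) = 0"
    using fibration_divisor[OF assms(5) cert fP] by blast
  have facet: "(eff_cone cl \<inter> {x. f x = 0}) facet_of (eff_cone cl)"
    using zero_sum_facet[OF assms(5) ne P(2,3) f(1) fP] .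
  have "divisor_class cl a \<in> nef_cone \<Sigma> v cl \<inter> {x. f x = 0}" using a by (simp add: nef_divisor_def)
  then have "\<not> nef_cone \<Sigma> v cl \<inter> {x. f x = 0} \<subseteq> {0}" using a(1) by blast
  then have "1 \<le> dim (nef_cone \<Sigma> v cl \<inter> {x. f x = 0})"
    using dim_eq_0[of "nef_cone \<Sigma> v cl \<inter> {x. f x = 0}"] by linarith
  then have "bordering_chamber cl (nef_cone \<Sigma> v cl) {x. f x = 0}"
    using facet by (simp add: bordering_chamber_def)
  moreover have "primitive_collection \<Sigma> v P"
    using P by (auto simp: primitive_collection_def face_sets_def)
  moreover have "primitive_relation \<Sigma> v P b"
    using primitive_relation_zero[OF P(3)] by (simp add: b_def[abs_def])
  moreover have "\<forall>j. 0 \<le> b j" by (simp add: b_def)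
  moreover have "support_functional cl b f" using f(1) fb by (simp add: support_functional_def)
  \<comment> \<open>A proper face of a convex set misses its interior, so a class in the facet is
    not big.\<close>
  moreover have "\<not> big_divisor cl a"
  proof
    assume "big_divisor cl a"
    then have int: "divisor_class cl a \<in> interior (eff_cone cl)" by (simp add: big_divisor_def)
    have "divisor_class cl a \<in> eff_cone cl \<inter> {x. f x = 0}" using int a(3) interior_subset by blast
    moreover have "(eff_cone cl \<inter> {x. f x = 0}) \<inter> interior (eff_cone cl) = {}"
      using facet_of_imp_face_of[OF facet] facet_of_irrefl facet face_of_disjoint_interior by metis
    ultimately show False using int by blast
  qed
  ultimately show ?thesis using a(1,2) by blast
qed

end
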